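(* Let $\Gamma$ be a limit cycle of $\dot u=F(u)$ at a generalized period-doubling (GPD) bifurcation, with the critical center manifold near $\Gamma$ parametrized by $(\tau,\xi)$ as in the context, so that the restricted dynamics has the GPD periodic normal form with coefficients $\alpha_1,\alpha_2,e$. Let $v,\varphi^*,v^*$ be as in the context. Then $$\alpha_1=\frac12\int_0^T\langle\varphi^*,B(\tau;v,v)\rangle d\tau,$$ $h_2$ is the unique solution of $$\dot h_2-A h_2-B(\tau;v,v)+2\alpha_1F(u_0)=0,\quad h_2(T)-h_2(0)=0,\quad\int_0^T\langle\varphi^*,h_2\rangle d\tau=0,$$ $h_3$ is the unique solution of $$\dot h_3-A h_3-C(\tau;v,v,v)-3B(\tau;v,h_2)+6\alpha_1A v=0,\quad h_3(T)+h_3(0)=0,\quad\int_0^T\langle v^*,h_3\rangle d\tau=0,$$ $$\alpha_2=\frac1{24}\int_0^T\langle\varphi^*,D(\tau;v,v,v,v)+6C(\tau;v,v,h_2)+3B(\tau;h_2,h_2)+4B(\tau;v,h_3)-12\alpha_1(Ah_2+B(\tau;v,v))\rangle d\tau+\alpha_1^2,$$ $h_4$ is the unique solution of $$\begin{aligned}&\dot h_4-Ah_4-D(\tau;v,v,v,v)-6C(\tau;v,v,h_2)-3B(\tau;h_2,h_2)-4B(\tau;v,h_3)\\&\quad+12\alpha_1\big(Ah_2+B(\tau;v,v)-2\alpha_1F(u_0)\big)+24\alpha_2F(u_0)=0,\quad h_4(T)-h_4(0)=0,\quad \int_0^T\langle\varphi^*,h_4\rangle d\tau=0,\end{aligned}$$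 and $$\begin{aligned}e=\frac1{120}\int_0^T\langle v^*,\;&E(\tau;v,v,v,v,v)+10D(\tau;v,v,v,h_2)+15C(\tau;v,h_2,h_2)+10C(\tau;v,v,h_3)\\&+10B(\tau;h_2,h_3)+5B(\tau;v,h_4)-120\alpha_2Av-20\alpha_1Ah_3\rangle\,d\tau .\end{aligned}$$ (All differential equations are on $[0,T]$.)
   Context: Setting. $F:\mathbb R^n\to\mathbb R^n$ is sufficiently smooth and $u_0$ is a nonconstant periodic solution of $\dot u=F(u)$ with minimal period $T>0$; $\Gamma$ is its orbit. Write $F(u_0(\tau)+w)=F(u_0)+A(\tau)w+\frac12B(\tau;w,w)+\frac1{3!}C(\tau;w,w,w)+\frac1{4!}D(\tau;w,w,w,w)+\frac1{5!}E(\tau;w,w,w,w,w)+\dots$, where $A(\tau)=F_u(u_0(\tau))$ and $B,C,D,E$ are the symmetric multilinear forms of second to fifth derivatives of $F$ at $u_0(\tau)$. Dots over functions of $\tau$ denote $d/d\tau$; $\langle a,b\rangle=a^{\rm T}b$. Let $Y$ solve $\dot Y=A(\tau)Y$, $Y(0)=I_n$; the eigenvalues of $Y(T)$ are the multipliers, critical if of modulus 1. GPD bifurcation: the multiplier $1$ is simple, the only other critical multiplier is $-1$, which is simple, and the cubic coefficient of the normal form vanishes, so that the following holds. The two-dimensional critical center manifold near $\Gamma$ is parametrized as $u(\tau,\xi)=u_0(\tau)+\xi v(\tau)+H(\tau,\xi)$, $\xi\in\mathbb R$ small, $H$ smooth and $2T$-periodic in $\tau$, $H=\frac12h_2\xi^2+\frac16h_3\xi^3+\frac1{24}h_4\xi^4+\frac1{120}h_5\xi^5+O(\xi^6)$,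 with $u(\tau,\xi)=u(\tau+T,-\xi)$ (so $h_i(\tau+T)=(-1)^ih_i(\tau)$), and the remaining freedom in the $h_i$ is fixed by $\int_0^T\langle\varphi^*,h_2\rangle d\tau=\int_0^T\langle v^*,h_3\rangle d\tau=\int_0^T\langle\varphi^*,h_4\rangle d\tau=0$. The dynamics restricted to it is $$\frac{d\tau}{dt}=1+\alpha_1\xi^2+\alpha_2\xi^4+\dots,\qquad\frac{d\xi}{dt}=e\,\xi^5+\dots,$$ with real $\alpha_1,\alpha_2,e$ and dots denoting $O(\xi^6)$ terms $2T$-periodic in $\tau$; that is, if $(\tau(t),\xi(t))$ solves this system then $u(\tau(t),\xi(t))$ solves $\dot u=F(u)$. Here $v$ satisfies $\dot v-A(\tau)v=0$ on $[0,T]$, $v(T)=-v(0)$, $\int_0^T\langle v,v\rangle d\tau=1$, extended by $v(\tau+T)=-v(\tau)$; $\varphi^*$ satisfies $\dot\varphi^*+A^{\rm T}(\tau)\varphi^*=0$, $\varphi^*(T)=\varphi^*(0)$, $\int_0^T\langle\varphi^*,F(u_0)\rangle d\tau=1$; $v^*$ satisfies $\dot v^*+A^{\rm T}(\tau)v^*=0$, $v^*(T)=-v^*(0)$, $\int_0^T\langle v^*,v\rangle d\tau=1$. *)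

theory Defs
  imports "HOL-Analysis.Analysis" "HOL-Computational_Algebra.Polynomial"
begin

(* Intended for open S: between finite-dimensional spaces this is the usual class C^k,
   phrased through iterated directional derivatives. *)
primrec Ck_on :: "nat \<Rightarrow> 'a::real_normed_vector set \<Rightarrow> ('a \<Rightarrow> 'b::real_normed_vector) \<Rightarrow> bool" where
  "Ck_on 0 S f \<longleftrightarrow> continuous_on S f"
| "Ck_on (Suc k) S f \<longleftrightarrow>
     (\<forall>x\<in>S. f differentiable (at x)) \<and>
     (\<forall>w. Ck_on k S (\<lambda>x. frechet_derivative f (at x) w))"

(* deriv_form f [w1,...,wk] x is the k-th derivative of f at x, as a multilinear form,
   evaluated at (w1,...,wk). *)
primrec deriv_form :: "('a::real_normed_vector \<Rightarrow> 'b::real_normed_vector) \<Rightarrow> 'a list \<Rightarrow> 'a \<Rightarrow> 'b" where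
  "deriv_form f [] = f"
| "deriv_form f (w # ws) = (\<lambda>x. frechet_derivative (deriv_form f ws) (at x) w)"

definition minimal_period :: "(real \<Rightarrow> 'a) \<Rightarrow> real \<Rightarrow> bool" where
  "minimal_period x T \<longleftrightarrow>
     T > 0 \<and> (\<forall>t. x (t + T) = x t) \<and> (\<forall>s. 0 < s \<and> s < T \<longrightarrow> (\<exists>t. x (t + s) \<noteq> x t))"

(* Eigenvalues of a real matrix are taken over the complex numbers. *)
definition eigenvalue_of :: "real^'n^'n \<Rightarrow> complex \<Rightarrow> bool" where
  "eigenvalue_of M z \<longleftrightarrow>
     (\<exists>w::complex^'n. w \<noteq> 0 \<and> (\<chi> i j. complex_of_real (M $ i $ j)) *v w = z *s w)"

definition charpoly :: "real^'n^'n \<Rightarrow> complex poly" where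
  "charpoly M = det (\<chi> i j. (if i = j then [:0, 1:] else 0) - [:complex_of_real (M $ i $ j):])"

(* Simple = algebraic multiplicity one. *)
definition simple_eigenvalue_of :: "real^'n^'n \<Rightarrow> complex \<Rightarrow> bool" where
  "simple_eigenvalue_of M z \<longleftrightarrow> eigenvalue_of M z \<and> order z (charpoly M) = 1"

(* Uniform in tau. *)
definition O_xi6 :: "(real \<Rightarrow> real \<Rightarrow> 'a::real_normed_vector) \<Rightarrow> bool" where
  "O_xi6 R \<longleftrightarrow> (\<exists>K. \<forall>\<^sub>F \<xi> in nhds 0. \<forall>\<tau>. norm (R \<tau> \<xi>) \<le> K * \<bar>\<xi>\<bar> ^ 6)"

definition solves_bvp ::
    "real \<Rightarrow> (real \<Rightarrow> real^'n^'n) \<Rightarrow> (real \<Rightarrow> real^'n) \<Rightarrow> real \<Rightarrow> (real \<Rightarrow> real^'n) \<Rightarrow> (real \<Rightarrow> real^'n) \<Rightarrow> bool"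
  where
  "solves_bvp T A r s \<psi> h \<longleftrightarrow>
     (\<forall>\<tau>\<in>{0..T}. \<exists>h'. (h has_vector_derivative h') (at \<tau> within {0..T}) \<and>
                      h' - A \<tau> *v h \<tau> + r \<tau> = 0) \<and>
     h T = s *\<^sub>R h 0 \<and>
     integral {0..T} (\<lambda>\<tau>. \<psi> \<tau> \<bullet> h \<tau>) = 0"

(* The problem lives on [0,T], so uniqueness is as a function on [0,T]. *)
definition unique_bvp_solution ::
    "real \<Rightarrow> (real \<Rightarrow> real^'n^'n) \<Rightarrow> (real \<Rightarrow> real^'n) \<Rightarrow> real \<Rightarrow> (real \<Rightarrow> real^'n) \<Rightarrow> (real \<Rightarrow> real^'n) \<Rightarrow> bool"
  where
  "unique_bvp_solution T A r s \<psi> h \<longleftrightarrow>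
     solves_bvp T A r s \<psi> h \<and>
     (\<forall>g. solves_bvp T A r s \<psi> g \<longrightarrow> (\<forall>\<tau>\<in>{0..T}. g \<tau> = h \<tau>))"

end

(* The flow hypothesis, applied to local solutions of the planar system (which exist by Picard
   iteration), turns into the invariance equation
     u_tau (1 + alpha1 xi^2 + alpha2 xi^4 + p) + u_xi (e xi^5 + q) = F(u).
   Integrating it over tau and comparing the coefficients of xi^k, k <= 5, yields an integral equation
   for each h_k, hence the linear equations h_k' = A h_k - r_k. Pairing them with the adjoint
   eigenfunctions and integrating over a period gives alpha1, alpha2 and e; in the formula for e the
   terms -20 alpha1 (h3' - A h3) produced by the expansion integrate to zero because the equation for h3
   is itself solvable. Uniqueness holds because a simple multiplier has a one-dimensional eigenspace, so
   the homogeneous problems are solved only by multiples of F(u0), respectively v, which the integral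
   conditions exclude. *)
theory Submission
  imports Defs
begin

section \<open>Iterated directional derivatives\<close>

text \<open>The expansion of \<open>H\<close> only bounds the size of a remainder: nothing is said
  about continuity or differentiability of \<open>h2\<close>, ..., \<open>h5\<close> in \<tau>, and
  no bound on the \<tau>-derivative of the remainder is given. All regularity is therefore
  recovered. Continuity of the coefficients comes from uniformity of the remainder in \<tau>;
  differentiability appears only once the integral equations are known, since each h_k is then an
  integral plus multiples of lower coefficients that are already differentiable. The parity h_k(T) =
  (-1)^k h_k(0) is likewise read off from the symmetry of \<open>u\<close>. Smoothness is phrased
  through iterated directional derivatives, so multilinearity, symmetry and joint continuity of the
  derivative forms have to be established before any Taylor expansion. With c_k = h_k / k!, the
  coefficient of \<xi>^k in F(u), multiplied by k!, is a sum over the set partitions of k objects by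
  block sizes; this is the origin of the constants 3, 4, 6, 10 and 15. The square of \<alpha>1 in
  the formula for \<alpha>2 arises when the derivative of \<open>h2\<close> is eliminated from the
  raw equation for \<open>h4\<close>.\<close>

text \<open>The head of the list is the derivative taken last, whereas \<open>Ck_on\<close> peels
  off the one taken first, which is the last entry. This identity reconciles the two orders and is
  why the induction in \<open>Ck_on_deriv_form\<close> runs from the right.\<close>

lemma deriv_form_snoc:
  "deriv_form f (ws @ [w]) = deriv_form (\<lambda>x. frechet_derivative f (at x) w) ws"
  by (induction ws) simp_all

lemma Ck_on_imp_continuous_on:
  assumes "Ck_on k S f"
  shows "continuous_on S f"
proof (cases k)
  case (Suc j)
  then show ?thesis
    using assms by (simp add: continuous_at_imp_continuous_on differentiable_imp_continuous_within)
qed (use assms in simp)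

lemma Ck_on_deriv_form:
  assumes "Ck_on k S f" "length ws \<le> k"
  shows "Ck_on (k - length ws) S (deriv_form f ws)"
  using assms
proof (induction ws arbitrary: f k rule: rev_induct)
  case (snoc w ws)
  then obtain j where j: "k = Suc j"
    by (cases k) auto
  then show ?case
    using snoc.IH[of j "\<lambda>x. frechet_derivative f (at x) w"] snoc.prems
    by (simp add: deriv_form_snoc)
qed simp

lemma deriv_form_has_derivative:
  assumes "Ck_on k S f" "length ws < k" "x \<in> S"
  shows "(deriv_form f ws has_derivative (\<lambda>w. deriv_form f (w # ws) x)) (at x)"
proof -
  obtain j where "k - length ws = Suc j"
    using assms(2) by (metis Suc_diff_Suc)
  then have "deriv_form f ws differentiable (at x)"
    using Ck_on_deriv_form[OF assms(1), of ws] assms by auto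
  then show ?thesis
    by (simp add: frechet_derivative_works)
qed

lemma deriv_form_continuous_on:
  assumes "Ck_on k S f" "length ws \<le> k"
  shows "continuous_on S (deriv_form f ws)"
  using Ck_on_deriv_form[OF assms] by (rule Ck_on_imp_continuous_on)

text \<open>In the front slot this is linearity of a Frechet derivative. A deeper slot is reached by
  differentiating the additivity and homogeneity identities in the base point, once for every
  direction standing in front, and using uniqueness of derivatives.\<close>

lemma deriv_form_linear_slot:
  fixes f :: "'a::real_normed_vector \<Rightarrow> 'b::real_normed_vector"
  assumes "Ck_on k UNIV f" "length xs + length ys < k"
  shows "linear (\<lambda>w. deriv_form f (xs @ w # ys) x)"
  using assms(2)
proof (induction xs arbitrary: x)
  case Nil
  then show ?case
    using has_derivative_linear[OF deriv_form_has_derivative[OF assms(1), of ys x]] by simp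
next
  case (Cons y xs)
  define g where "g w = deriv_form f (xs @ w # ys)" for w
  have D: "(g w has_derivative (\<lambda>z. deriv_form f (z # xs @ w # ys) x)) (at x)" for w x
    unfolding g_def by (rule deriv_form_has_derivative[OF assms(1)]) (use Cons.prems in auto)
  have lin: "linear (\<lambda>w. g w x)" for x
    unfolding g_def using Cons by simp
  show ?case
  proof (rule linearI)
    fix a b
    have "g (a + b) = (\<lambda>x. g a x + g b x)"
      using linear_add[OF lin] by blast
    then have "((\<lambda>x. g a x + g b x) has_derivative (\<lambda>z. deriv_form f (z # xs @ (a + b) # ys) x)) (at x)"
      using D[of "a + b" x] by simp
    from fun_cong[OF has_derivative_unique[OF this has_derivative_add[OF D[of a] D[of b]]], of y]
    show "deriv_form f ((y # xs) @ (a + b) # ys) x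
        = deriv_form f ((y # xs) @ a # ys) x + deriv_form f ((y # xs) @ b # ys) x"
      by simp
  next
    fix r a
    have "g (r *\<^sub>R a) = (\<lambda>x. r *\<^sub>R g a x)"
      using linear_scale[OF lin] by blast
    then have "((\<lambda>x. r *\<^sub>R g a x) has_derivative (\<lambda>z. deriv_form f (z # xs @ (r *\<^sub>R a) # ys) x)) (at x)"
      using D[of "r *\<^sub>R a" x] by simp
    from fun_cong[OF has_derivative_unique[OF this has_derivative_scaleR_right[OF D[of a], of r]], of y]
    show "deriv_form f ((y # xs) @ (r *\<^sub>R a) # ys) x = r *\<^sub>R deriv_form f ((y # xs) @ a # ys) x"
      by simp
  qed
qed

text \<open>Differentiate \<open>G (x + s a + t b) - G (x + s a) = \<integral>\<^sub>0\<^sup>t D\<^sub>b G (x + s a + r b) dr\<close> under the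
  integral sign at \<open>s = 0\<close>, and then with respect to \<open>t\<close> at \<open>t = 0\<close>.\<close>
lemma second_derivatives_commute:
  fixes G :: "'a::real_normed_vector \<Rightarrow> 'b::banach"
  assumes G: "\<And>x. (G has_derivative DG x) (at x)"
    and Db: "\<And>x. ((\<lambda>x. DG x b) has_derivative DDb x) (at x)"
    and Da: "\<And>x. ((\<lambda>x. DG x a) has_derivative DDa x) (at x)"
    and cont: "continuous_on UNIV (\<lambda>x. DDb x a)"
  shows "DDb x a = DDa x b"
proof -
  define X where "X s t = x + s *\<^sub>R a + t *\<^sub>R b" for s t :: real
  have Xs: "((\<lambda>s. X s t) has_derivative (\<lambda>h. h *\<^sub>R a)) (at s within U)" for s t U
    unfolding X_def by (auto intro!: derivative_eq_intros)
  have Xt: "(X s has_derivative (\<lambda>h. h *\<^sub>R b)) (at t within U)" for s t U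
    unfolding X_def by (auto intro!: derivative_eq_intros)
  have vec: "((\<lambda>r. g (c r)) has_vector_derivative Dg w) (at r within U)"
    if "(g has_derivative Dg) (at (c r))" "(c has_derivative (\<lambda>h. h *\<^sub>R w)) (at r within U)"
    for g :: "'a \<Rightarrow> 'b" and c :: "real \<Rightarrow> 'a" and Dg w r U
    using has_derivative_in_compose[OF that(2) has_derivative_at_withinI[OF that(1)]]
      linear_scale[OF has_derivative_linear[OF that(1)]]
    by (simp add: has_vector_derivative_def)
  have "DG (X 0 t) a - DG x a = integral {0..t} (\<lambda>r. DDb (X 0 r) a)" if t: "t \<in> {0..1}" for t
  proof -
    have diff: "integral {0..t} (\<lambda>r. DG (X s r) b) = G (X s t) - G (X s 0)" for s
      using t by (intro integral_unique fundamental_theorem_of_calculus vec G Xt) auto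
    have "((\<lambda>s. integral (cbox 0 t) (\<lambda>r. DG (X s r) b)) has_vector_derivative
            integral (cbox 0 t) (\<lambda>r. DDb (X 0 r) a)) (at 0 within UNIV)"
    proof (rule leibniz_rule_vector_derivative)
      show "((\<lambda>s. DG (X s r) b) has_vector_derivative DDb (X s r) a) (at s within UNIV)" for s r
        by (rule vec[OF Db Xs])
      show "(\<lambda>r. DG (X s r) b) integrable_on cbox 0 t" for s
        by (intro integrable_continuous continuous_at_imp_continuous_on ballI
            has_vector_derivative_continuous[OF vec[OF Db Xt]])
      have "continuous_on (UNIV \<times> cbox 0 t) (\<lambda>z. X (fst z) (snd z))"
        unfolding X_def by (intro continuous_intros)
      then show "continuous_on (UNIV \<times> cbox 0 t) (\<lambda>(s, r). DDb (X s r) a)"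
        unfolding case_prod_unfold by (rule continuous_on_compose2[OF cont]) auto
    qed auto
    moreover have "((\<lambda>s. G (X s t) - G (X s 0)) has_vector_derivative
        DG (X 0 t) a - DG (X 0 0) a) (at 0)"
      by (intro has_vector_derivative_diff vec G Xs)
    ultimately have "integral (cbox 0 t) (\<lambda>r. DDb (X 0 r) a) = DG (X 0 t) a - DG (X 0 0) a"
      unfolding diff cbox_interval by (rule vector_derivative_unique_at)
    then show ?thesis
      by (simp add: X_def)
  qed
  note eq = this
  have "continuous_on {0..1} (\<lambda>r. DDb (X 0 r) a)"
    unfolding X_def by (rule continuous_on_compose2[OF cont]) (auto intro!: continuous_intros)
  then have "((\<lambda>t. integral {0..t} (\<lambda>r. DDb (X 0 r) a)) has_vector_derivative DDb (X 0 0) a)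
      (at 0 within {0..1})"
    by (rule integral_has_vector_derivative) auto
  then have 1: "((\<lambda>t. DG (X 0 t) a - DG x a) has_vector_derivative DDb (X 0 0) a) (at 0 within {0..1})"
    by (rule has_vector_derivative_transform[rotated 2]) (use eq in auto)
  have 2: "((\<lambda>t. DG (X 0 t) a - DG x a) has_vector_derivative DDa (X 0 0) b - 0) (at 0 within {0..1})"
    by (intro has_vector_derivative_diff has_vector_derivative_const vec Da Xt)
  show ?thesis
    using vector_derivative_unique_within_closed_interval[of 0 1 0, OF _ _ 1[folded cbox_interval] 2[folded cbox_interval]]
    by (simp add: X_def)
qed

lemma deriv_form_swap:
  fixes f :: "'a::real_normed_vector \<Rightarrow> 'b::banach"
  assumes "Ck_on k UNIV f" "length ws + 2 \<le> k"
  shows "deriv_form f (a # b # ws) = deriv_form f (b # a # ws)"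
proof
  fix x
  show "deriv_form f (a # b # ws) x = deriv_form f (b # a # ws) x"
  proof (rule second_derivatives_commute[where G = "deriv_form f ws"
        and DG = "\<lambda>x w. deriv_form f (w # ws) x" and DDb = "\<lambda>x w. deriv_form f (w # b # ws) x"
        and DDa = "\<lambda>x w. deriv_form f (w # a # ws) x"])
    show "(deriv_form f ws has_derivative (\<lambda>w. deriv_form f (w # ws) x)) (at x)" for x
      by (rule deriv_form_has_derivative[OF assms(1)]) (use assms in auto)
    show "(deriv_form f (b # ws) has_derivative (\<lambda>w. deriv_form f (w # b # ws) x)) (at x)"
      "(deriv_form f (a # ws) has_derivative (\<lambda>w. deriv_form f (w # a # ws) x)) (at x)" for x
      by (rule deriv_form_has_derivative[OF assms(1)]; use assms in auto)+
    show "continuous_on UNIV (deriv_form f (a # b # ws))"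
      by (rule deriv_form_continuous_on[OF assms(1)]) (use assms in auto)
  qed
qed

text \<open>\<open>deriv_form_swap\<close> exchanges only the two outermost directions, so
  \<open>w\<close> travels to the front one place at a time. The equality is one of functions of the
  base point, which is what allows a further direction to be put in front of it.\<close>

lemma deriv_form_move_front:
  fixes f :: "'a::real_normed_vector \<Rightarrow> 'b::banach"
  assumes "Ck_on k UNIV f" "length xs + length ys < k"
  shows "deriv_form f (xs @ w # ys) = deriv_form f (w # xs @ ys)"
  using assms(2)
proof (induction xs)
  case (Cons x xs)
  have "deriv_form f ((x # xs) @ w # ys) = deriv_form f (x # w # xs @ ys)"
    using Cons by simp
  also have "\<dots> = deriv_form f (w # (x # xs) @ ys)"
    using deriv_form_swap[OF assms(1), of "xs @ ys" x w] Cons.prems by simp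
  finally show ?case .
qed simp

text \<open>\<open>Ck_on\<close> yields continuity in the base point for fixed directions only.
  Expanding a moving direction in the standard basis trades it for fixed directions with continuous
  scalar coefficients; \<open>es\<close> collects the basis vectors chosen so far, and symmetry
  carries each of them behind the slots that still move.\<close>

lemma deriv_form_continuous_slots:
  fixes f :: "'a::euclidean_space \<Rightarrow> 'b::banach" and X :: "'c::topological_space \<Rightarrow> 'a"
  assumes "Ck_on k UNIV f" "length cs + length es \<le> k"
    and "continuous_on S X" "\<And>c. c \<in> set cs \<Longrightarrow> continuous_on S c"
  shows "continuous_on S (\<lambda>s. deriv_form f (map (\<lambda>c. c s) cs @ es) (X s))"
  using assms(2,4)
proof (induction cs arbitrary: es)
  case Nil
  then show ?case
    using continuous_on_compose2[OF deriv_form_continuous_on[OF assms(1)] assms(3)] by auto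
next
  case (Cons c cs)
  have "deriv_form f (map (\<lambda>c. c s) (c # cs) @ es) (X s)
      = (\<Sum>b\<in>Basis. (c s \<bullet> b) *\<^sub>R deriv_form f (map (\<lambda>c. c s) cs @ b # es) (X s))" for s
  proof -
    have lin: "linear (\<lambda>w. deriv_form f (w # map (\<lambda>c. c s) cs @ es) (X s))"
      using deriv_form_linear_slot[OF assms(1), of "[]" "map (\<lambda>c. c s) cs @ es"] Cons.prems by simp
    have "deriv_form f (map (\<lambda>c. c s) (c # cs) @ es) (X s)
        = deriv_form f ((\<Sum>b\<in>Basis. (c s \<bullet> b) *\<^sub>R b) # map (\<lambda>c. c s) cs @ es) (X s)"
      by (simp add: euclidean_representation)
    also have "\<dots> = (\<Sum>b\<in>Basis. (c s \<bullet> b) *\<^sub>R deriv_form f (b # map (\<lambda>c. c s) cs @ es) (X s))"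
      by (simp only: linear_sum[OF lin] linear_scale[OF lin])
    also have "\<dots> = (\<Sum>b\<in>Basis. (c s \<bullet> b) *\<^sub>R deriv_form f (map (\<lambda>c. c s) cs @ b # es) (X s))"
      using deriv_form_move_front[OF assms(1), of "map (\<lambda>c. c s) cs" es] Cons.prems by simp
    finally show ?thesis .
  qed
  then show ?case
    using Cons by (auto intro!: continuous_intros)
qed

section \<open>Uniform remainders and Taylor expansion\<close>

text \<open>Uniformity over \<open>S\<close> is what survives integration over \<tau> and makes
  coefficients continuous. The neighbourhood contains \<xi> = 0 itself, so a remainder of positive
  order vanishes there.\<close>

definition unif_O :: "nat \<Rightarrow> 's set \<Rightarrow> ('s \<Rightarrow> real \<Rightarrow> 'a::real_normed_vector) \<Rightarrow> bool" where
  "unif_O n S g \<longleftrightarrow> (\<exists>K. \<forall>\<^sub>F \<xi> in nhds 0. \<forall>\<tau>\<in>S. norm (g \<tau> \<xi>) \<le> K * \<bar>\<xi>\<bar> ^ n)"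

lemma unif_O_cong:
  assumes "unif_O n S g" "\<forall>\<^sub>F \<xi> in nhds 0. \<forall>\<tau>\<in>S. g \<tau> \<xi> = h \<tau> \<xi>"
  shows "unif_O n S h"
proof -
  obtain K where "\<forall>\<^sub>F \<xi> in nhds 0. \<forall>\<tau>\<in>S. norm (g \<tau> \<xi>) \<le> K * \<bar>\<xi>\<bar> ^ n"
    using assms(1) unfolding unif_O_def by blast
  with assms(2) have "\<forall>\<^sub>F \<xi> in nhds 0. \<forall>\<tau>\<in>S. norm (h \<tau> \<xi>) \<le> K * \<bar>\<xi>\<bar> ^ n"
    by eventually_elim auto
  then show ?thesis
    unfolding unif_O_def by blast
qed

lemma unif_O_subset: "unif_O n S g \<Longrightarrow> R \<subseteq> S \<Longrightarrow> unif_O n R g"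
  unfolding unif_O_def by (force elim!: eventually_mono)

text \<open>Freezing the parameter leaves a function that no longer depends on it, hence the
  arbitrary index set \<open>R\<close>. This serves for values at the ends of the period.\<close>

lemma unif_O_at:
  assumes "unif_O n S g" "s \<in> S"
  shows "unif_O n R (\<lambda>_. g s)"
proof -
  obtain K where "\<forall>\<^sub>F \<xi> in nhds 0. \<forall>\<tau>\<in>S. norm (g \<tau> \<xi>) \<le> K * \<bar>\<xi>\<bar> ^ n"
    using assms(1) unfolding unif_O_def by blast
  then have "\<forall>\<^sub>F \<xi> in nhds 0. \<forall>\<tau>\<in>R. norm (g s \<xi>) \<le> K * \<bar>\<xi>\<bar> ^ n"
    by eventually_elim (use assms(2) in blast)
  then show ?thesis
    unfolding unif_O_def by blast
qed

lemma unif_O_zero: "unif_O n S (\<lambda>\<tau> \<xi>. 0)"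
  unfolding unif_O_def by (rule exI[of _ 0]) simp

lemma unif_O_add:
  assumes "unif_O n S f" "unif_O n S g"
  shows "unif_O n S (\<lambda>\<tau> \<xi>. f \<tau> \<xi> + g \<tau> \<xi>)"
proof -
  obtain K L where "\<forall>\<^sub>F \<xi> in nhds 0. \<forall>\<tau>\<in>S. norm (f \<tau> \<xi>) \<le> K * \<bar>\<xi>\<bar> ^ n"
    "\<forall>\<^sub>F \<xi> in nhds 0. \<forall>\<tau>\<in>S. norm (g \<tau> \<xi>) \<le> L * \<bar>\<xi>\<bar> ^ n"
    using assms unfolding unif_O_def by blast
  then have "\<forall>\<^sub>F \<xi> in nhds 0. \<forall>\<tau>\<in>S. norm (f \<tau> \<xi> + g \<tau> \<xi>) \<le> (K + L) * \<bar>\<xi>\<bar> ^ n"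
    by eventually_elim (auto simp: distrib_right intro: norm_triangle_mono)
  then show ?thesis
    unfolding unif_O_def by blast
qed

lemma unif_O_mult_bounded:
  assumes "unif_O n S g" "\<forall>\<^sub>F \<xi> in nhds 0. \<forall>\<tau>\<in>S. norm (h \<tau> \<xi>) \<le> M * norm (g \<tau> \<xi>)" "M \<ge> 0"
  shows "unif_O n S h"
proof -
  obtain K where "\<forall>\<^sub>F \<xi> in nhds 0. \<forall>\<tau>\<in>S. norm (g \<tau> \<xi>) \<le> K * \<bar>\<xi>\<bar> ^ n"
    using assms(1) unfolding unif_O_def by blast
  with assms(2) have "\<forall>\<^sub>F \<xi> in nhds 0. \<forall>\<tau>\<in>S. norm (h \<tau> \<xi>) \<le> (M * K) * \<bar>\<xi>\<bar> ^ n"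
  proof eventually_elim
    case (elim \<xi>)
    show ?case
    proof
      fix \<tau> assume "\<tau> \<in> S"
      then have "norm (h \<tau> \<xi>) \<le> M * norm (g \<tau> \<xi>)" "norm (g \<tau> \<xi>) \<le> K * \<bar>\<xi>\<bar> ^ n"
        using elim by auto
      then show "norm (h \<tau> \<xi>) \<le> (M * K) * \<bar>\<xi>\<bar> ^ n"
        using mult_left_mono[OF _ assms(3), of "norm (g \<tau> \<xi>)" "K * \<bar>\<xi>\<bar> ^ n"] by (simp add: mult.assoc)
    qed
  qed
  then show ?thesis
    unfolding unif_O_def by blast
qed

lemma unif_O_scale: "unif_O n S g \<Longrightarrow> unif_O n S (\<lambda>\<tau> \<xi>. r *\<^sub>R g \<tau> \<xi>)"
  by (erule unif_O_mult_bounded[where M = "\<bar>r\<bar>"]) auto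

lemma unif_O_diff:
  assumes "unif_O n S f" "unif_O n S g"
  shows "unif_O n S (\<lambda>\<tau> \<xi>. f \<tau> \<xi> - g \<tau> \<xi>)"
  using unif_O_add[OF assms(1) unif_O_scale[OF assms(2), of "-1"]] by simp

lemma eventually_abs_less_nhds_0: "e > 0 \<Longrightarrow> \<forall>\<^sub>F \<xi> in nhds (0::real). \<bar>\<xi>\<bar> < e"
  by (auto simp: eventually_nhds_metric dist_real_def)

lemma unif_O_power_scale: "unif_O n S g \<Longrightarrow> unif_O n S (\<lambda>\<tau> \<xi>. \<xi> ^ i *\<^sub>R g \<tau> \<xi>)"
  by (erule unif_O_mult_bounded[where M = 1])
    (auto intro!: eventually_mono[OF eventually_abs_less_nhds_0[of 1]] mult_left_le_one_le
      simp: power_abs power_le_one)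

lemma unif_O_sum:
  assumes "\<And>i. i \<in> I \<Longrightarrow> unif_O n S (g i)"
  shows "unif_O n S (\<lambda>\<tau> \<xi>. \<Sum>i\<in>I. g i \<tau> \<xi>)"
  using assms by (induction I rule: infinite_finite_induct) (auto intro: unif_O_add unif_O_zero)

lemma unif_O_power:
  assumes "bounded (a ` S)" "n \<le> m"
  shows "unif_O n S (\<lambda>\<tau> \<xi>. \<xi> ^ m *\<^sub>R a \<tau>)"
proof -
  obtain B where B: "\<And>\<tau>. \<tau> \<in> S \<Longrightarrow> norm (a \<tau>) \<le> B"
    using assms(1) by (auto simp: bounded_iff)
  have "norm (\<xi> ^ m *\<^sub>R a \<tau>) \<le> B * \<bar>\<xi>\<bar> ^ n" if "\<bar>\<xi>\<bar> < 1" "\<tau> \<in> S" for \<xi> \<tau>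
  proof -
    have "norm (\<xi> ^ m *\<^sub>R a \<tau>) \<le> \<bar>\<xi>\<bar> ^ n * B"
      using that B[of \<tau>] assms(2) by (auto simp: power_abs intro!: mult_mono power_decreasing)
    then show ?thesis by (simp add: mult.commute)
  qed
  then show ?thesis
    unfolding unif_O_def by (intro exI[of _ B] eventually_mono[OF eventually_abs_less_nhds_0[of 1]]) auto
qed

lemma deriv_form_scale_all:
  fixes f :: "'a::real_normed_vector \<Rightarrow> 'b::real_normed_vector"
  assumes "Ck_on k UNIV f" "length xs + length ws \<le> k"
  shows "deriv_form f (xs @ map ((*\<^sub>R) r) ws) x = r ^ length ws *\<^sub>R deriv_form f (xs @ ws) x"
  using assms(2)
proof (induction ws arbitrary: xs)
  case (Cons w ws)
  have "deriv_form f (xs @ map ((*\<^sub>R) r) (w # ws)) x = r *\<^sub>R deriv_form f ((xs @ [w]) @ map ((*\<^sub>R) r) ws) x"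
    using linear_scale[OF deriv_form_linear_slot[OF assms(1), of xs "map ((*\<^sub>R) r) ws"], of r w x] Cons.prems
    by simp
  with Cons.IH[of "xs @ [w]"] Cons.prems show ?case
    by simp
qed simp

text \<open>One-variable Taylor formula with integral remainder along the segment from
  \<open>x\<close> to \<open>x + w\<close>. The weight (1 - t)^(p-1) / (p-1)! is at most 1, so the
  bound on the highest derivative carries over without a factorial; a sharp constant is of no
  interest here.\<close>

lemma deriv_form_taylor_remainder:
  fixes f :: "'a::real_normed_vector \<Rightarrow> 'b::banach"
  assumes "Ck_on p UNIV f" "p > 0"
    and K: "\<And>t. t \<in> {0..1} \<Longrightarrow> norm (deriv_form f (replicate p w) (x + t *\<^sub>R w)) \<le> K"
  shows "norm (f (x + w) - (\<Sum>i<p. (1 / fact i) *\<^sub>R deriv_form f (replicate i w) x)) \<le> K"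
proof -
  have "K \<ge> 0"
    using order_trans[OF norm_ge_zero K[of 0]] by simp
  define Df where "Df m t = deriv_form f (replicate m w) (x + t *\<^sub>R w)" for m and t :: real
  have "(Df m has_vector_derivative Df (Suc m) t) (at t within {0..1})" if "m < p" for m t
  proof -
    have X: "((\<lambda>t. x + t *\<^sub>R w) has_derivative (\<lambda>h. h *\<^sub>R w)) (at t within {0..1})"
      by (auto intro!: derivative_eq_intros)
    have D: "(deriv_form f (replicate m w) has_derivative
        (\<lambda>z. deriv_form f (z # replicate m w) (x + t *\<^sub>R w))) (at (x + t *\<^sub>R w))"
      by (rule deriv_form_has_derivative[OF assms(1)]) (use that in auto)
    have "(Df m has_derivative (\<lambda>h. deriv_form f ((h *\<^sub>R w) # replicate m w) (x + t *\<^sub>R w)))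
        (at t within {0..1})"
      unfolding Df_def by (rule has_derivative_in_compose[OF X has_derivative_at_withinI[OF D]])
    then show ?thesis
      using linear_scale[OF has_derivative_linear[OF D]]
      by (simp add: has_vector_derivative_def Df_def)
  qed
  then have "((\<lambda>t. ((1 - t) ^ (p - 1) / fact (p - 1)) *\<^sub>R Df p t) has_integral
      Df 0 1 - (\<Sum>i<p. ((1 - 0) ^ i / fact i) *\<^sub>R Df i 0)) (cbox 0 1)"
    unfolding cbox_interval by (intro Taylor_has_integral) (use assms(2) in auto)
  then have "norm (Df 0 1 - (\<Sum>i<p. ((1 - 0) ^ i / fact i) *\<^sub>R Df i 0)) \<le> K * measure lborel (cbox 0 (1::real))"
  proof (rule has_integral_bound[OF \<open>K \<ge> 0\<close>])
    fix t :: real assume t: "t \<in> cbox 0 1"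
    have "\<bar>(1 - t) ^ (p - 1) / fact (p - 1)\<bar> * norm (Df p t) \<le> 1 * K"
    proof (rule mult_mono)
      have "(1 - t) ^ (p - 1) \<le> 1"
        using t by (intro power_le_one) auto
      then show "\<bar>(1 - t) ^ (p - 1) / fact (p - 1)\<bar> \<le> 1"
        using t by (auto simp: divide_le_eq intro: order_trans[OF _ fact_ge_1])
    qed (use K t in \<open>auto simp: Df_def\<close>)
    then show "norm (((1 - t) ^ (p - 1) / fact (p - 1)) *\<^sub>R Df p t) \<le> K"
      by simp
  qed
  then show ?thesis
    by (simp add: Df_def)
qed

text \<open>The coefficient of \<open>\<xi>\<^sup>k\<close> in \<open>D\<^sup>l\<^sup>+\<^sup>n f [e\<^sub>1, \<dots>, e\<^sub>l, W, \<dots>, W]\<close> for \<open>W = \<xi> c\<^sub>1 + \<xi>\<^sup>2 c\<^sub>2 + \<dots>\<close>.\<close>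
primrec slot_coeff ::
  "('a::real_normed_vector \<Rightarrow> 'b::real_normed_vector) \<Rightarrow> (nat \<Rightarrow> 'a) \<Rightarrow> nat \<Rightarrow> 'a list \<Rightarrow> nat \<Rightarrow> 'a \<Rightarrow> 'b" where
  "slot_coeff f c 0 es k x = (if k = 0 then deriv_form f es x else 0)"
| "slot_coeff f c (Suc n) es k x = (\<Sum>i=1..k. slot_coeff f c n (es @ [c i]) (k - i) x)"

lemma slot_coeff_continuous_on:
  fixes f :: "'a::euclidean_space \<Rightarrow> 'b::banach" and X :: "'c::topological_space \<Rightarrow> 'a"
  assumes "Ck_on p UNIV f" "length es + n \<le> p" "continuous_on S X" "\<And>i. continuous_on S (c i)"
    and "\<And>e. e \<in> set es \<Longrightarrow> continuous_on S e"
  shows "continuous_on S (\<lambda>s. slot_coeff f (\<lambda>i. c i s) n (map (\<lambda>e. e s) es) k (X s))"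
  using assms(2,5)
proof (induction n arbitrary: es k)
  case 0
  then show ?case
    using deriv_form_continuous_slots[OF assms(1), of es "[]" S X] assms(3)
    by (cases "k = 0") auto
next
  case (Suc n)
  have "continuous_on S (\<lambda>s. slot_coeff f (\<lambda>i. c i s) n (map (\<lambda>e. e s) (es @ [c i])) k (X s))" for i k
    using Suc.prems assms(4) by (intro Suc.IH) auto
  then show ?case
    by (auto intro!: continuous_intros)
qed

text \<open>The left factor has no constant term, hence i starts at 1. Products of degree at most 5
  are regrouped by total degree m = i + k; those of degree at least 6 are kept explicitly, to be
  absorbed into the remainder.\<close>

lemma truncated_cauchy_product:
  fixes a :: "nat \<Rightarrow> nat \<Rightarrow> 'a::real_vector"
  shows "(\<Sum>i=1..5. \<xi> ^ i *\<^sub>R (\<Sum>k<6. \<xi> ^ k *\<^sub>R a i k))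
    = (\<Sum>m<6. \<xi> ^ m *\<^sub>R (\<Sum>i=1..m. a i (m - i)))
      + (\<Sum>i=1..5. \<Sum>k<6. if 6 \<le> i + k then \<xi> ^ (i + k) *\<^sub>R a i k else 0)"
  by (simp add: eval_nat_numeral sum.atLeast_Suc_atMost algebra_simps scaleR_sum_right)

text \<open>Induction on the number of slots still filled with the polynomial. Linearity in the
  first of them replaces it by \<xi>^i c_i, and c_i joins \<open>es\<close>. The entries of
  \<open>es\<close> are functions of the parameter so that the induction hypothesis covers these
  new, varying entries.\<close>

lemma slot_expansion:
  fixes f :: "'a::euclidean_space \<Rightarrow> 'b::banach" and X :: "'c::topological_space \<Rightarrow> 'a"
  assumes "Ck_on p UNIV f" "length es + n \<le> p" "compact S" "continuous_on S X" "\<And>i. continuous_on S (c i)"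
    and "\<And>e. e \<in> set es \<Longrightarrow> continuous_on S e"
  shows "unif_O 6 S (\<lambda>s \<xi>. deriv_form f (map (\<lambda>e. e s) es @ replicate n (\<Sum>i=1..5. \<xi> ^ i *\<^sub>R c i s)) (X s)
      - (\<Sum>k<6. \<xi> ^ k *\<^sub>R slot_coeff f (\<lambda>i. c i s) n (map (\<lambda>e. e s) es) k (X s)))"
  using assms(2,6)
proof (induction n arbitrary: es)
  case 0
  then show ?case
    by (simp add: unif_O_zero sum.If_cases if_distrib[of "\<lambda>x. _ *\<^sub>R x"] cong: if_cong)
next
  case (Suc n)
  define W where "W s \<xi> = (\<Sum>i=1..5. \<xi> ^ i *\<^sub>R c i s)" for s \<xi>
  define G where "G i s \<xi> = deriv_form f (map (\<lambda>e. e s) (es @ [c i]) @ replicate n (W s \<xi>)) (X s)" for i s \<xi>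
  define a where "a i k s = slot_coeff f (\<lambda>i. c i s) n (map (\<lambda>e. e s) (es @ [c i])) k (X s)" for i k s
  have G: "unif_O 6 S (\<lambda>s \<xi>. G i s \<xi> - (\<Sum>k<6. \<xi> ^ k *\<^sub>R a i k s))" for i
    unfolding G_def a_def W_def by (rule Suc.IH) (use Suc.prems assms(5) in auto)
  have a: "bounded (a i k ` S)" for i k
    unfolding a_def
    by (intro compact_imp_bounded compact_continuous_image slot_coeff_continuous_on[OF assms(1)] assms(3-5))
      (use Suc.prems assms(5) in auto)
  have eq: "deriv_form f (map (\<lambda>e. e s) es @ replicate (Suc n) (W s \<xi>)) (X s)
      = (\<Sum>i=1..5. \<xi> ^ i *\<^sub>R G i s \<xi>)" for s \<xi>
  proof -
    have lin: "linear (\<lambda>w. deriv_form f (map (\<lambda>e. e s) es @ w # replicate n (W s \<xi>)) (X s))"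
      by (rule deriv_form_linear_slot[OF assms(1)]) (use Suc.prems in auto)
    have "deriv_form f (map (\<lambda>e. e s) es @ (\<Sum>i=1..5. \<xi> ^ i *\<^sub>R c i s) # replicate n (W s \<xi>)) (X s)
        = (\<Sum>i=1..5. \<xi> ^ i *\<^sub>R deriv_form f (map (\<lambda>e. e s) es @ c i s # replicate n (W s \<xi>)) (X s))"
      by (simp only: linear_sum[OF lin] linear_scale[OF lin])
    then show ?thesis
      by (simp add: G_def W_def)
  qed
  have tail: "unif_O 6 S (\<lambda>s \<xi>. if 6 \<le> i + k then \<xi> ^ (i + k) *\<^sub>R a i k s else 0)" for i k
    by (cases "6 \<le> i + k") (simp_all add: unif_O_power[OF a] unif_O_zero)
  have "unif_O 6 S (\<lambda>s \<xi>. (\<Sum>i=1..5. \<xi> ^ i *\<^sub>R (G i s \<xi> - (\<Sum>k<6. \<xi> ^ k *\<^sub>R a i k s)))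
      + (\<Sum>i=1..5. \<Sum>k<6. if 6 \<le> i + k then \<xi> ^ (i + k) *\<^sub>R a i k s else 0))"
    by (intro unif_O_add unif_O_sum unif_O_power_scale G tail)
  moreover have "(\<Sum>i=1..5. \<xi> ^ i *\<^sub>R (G i s \<xi> - (\<Sum>k<6. \<xi> ^ k *\<^sub>R a i k s)))
      + (\<Sum>i=1..5. \<Sum>k<6. if 6 \<le> i + k then \<xi> ^ (i + k) *\<^sub>R a i k s else 0)
    = deriv_form f (map (\<lambda>e. e s) es @ replicate (Suc n) (W s \<xi>)) (X s)
      - (\<Sum>k<6. \<xi> ^ k *\<^sub>R slot_coeff f (\<lambda>i. c i s) (Suc n) (map (\<lambda>e. e s) es) k (X s))" for s \<xi>
  proof -
    have "(\<Sum>k<6. \<xi> ^ k *\<^sub>R slot_coeff f (\<lambda>i. c i s) (Suc n) (map (\<lambda>e. e s) es) k (X s))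
      = (\<Sum>m<6. \<xi> ^ m *\<^sub>R (\<Sum>i=1..m. a i (m - i) s))"
      by (simp add: a_def)
    then show ?thesis
      using truncated_cauchy_product[of \<xi> "\<lambda>i k. a i k s"] eq[of s \<xi>]
      by (simp only: scaleR_diff_right sum_subtractf) simp
  qed
  ultimately show ?case
    unfolding W_def by simp
qed

text \<open>The coefficient of \<xi>^k in f(x + W), with \<open>W\<close> as for
  \<open>slot_coeff\<close>. A form with n slots contributes only to powers of degree at least n, so
  stopping at n = 5 is exact for k < 6.\<close>

definition comp_coeff ::
  "('a::real_normed_vector \<Rightarrow> 'b::real_normed_vector) \<Rightarrow> (nat \<Rightarrow> 'a) \<Rightarrow> nat \<Rightarrow> 'a \<Rightarrow> 'b" where
  "comp_coeff f c k x = (\<Sum>n<6. (1 / fact n) *\<^sub>R slot_coeff f c n [] k x)"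

lemma comp_coeff_continuous_on:
  fixes f :: "'a::euclidean_space \<Rightarrow> 'b::banach" and X :: "'c::topological_space \<Rightarrow> 'a"
  assumes "Ck_on 6 UNIV f" "continuous_on S X" "\<And>i. continuous_on S (c i)"
  shows "continuous_on S (\<lambda>s. comp_coeff f (\<lambda>i. c i s) k (X s))"
  unfolding comp_coeff_def
  using slot_coeff_continuous_on[OF assms(1), of "[]" _ S X c k] assms(2,3)
  by (auto intro!: continuous_intros)

text \<open>The polynomial \<open>W\<close> is \<xi> times another polynomial \<open>V\<close>.
  Multilinearity therefore pulls \<xi>^6 out of the sixth-order Taylor remainder, and what is left
  is jointly continuous in the parameter, \<xi> and the position on the segment, hence bounded on a
  compact product.\<close>

lemma composition_expansion:
  fixes f :: "'a::euclidean_space \<Rightarrow> 'b::banach" and X :: "'c::t2_space \<Rightarrow> 'a"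
  assumes f: "Ck_on 6 UNIV f" and S: "compact S" "continuous_on S X" and c: "\<And>i. continuous_on S (c i)"
  shows "unif_O 6 S (\<lambda>s \<xi>. f (X s + (\<Sum>i=1..5. \<xi> ^ i *\<^sub>R c i s))
      - (\<Sum>k<6. \<xi> ^ k *\<^sub>R comp_coeff f (\<lambda>i. c i s) k (X s)))"
proof -
  define W where "W s \<xi> = (\<Sum>i=1..5. \<xi> ^ i *\<^sub>R c i s)" for s \<xi>
  define V where "V s \<xi> = (\<Sum>i<5. \<xi> ^ i *\<^sub>R c (Suc i) s)" for s \<xi>
  have WV: "W s \<xi> = \<xi> *\<^sub>R V s \<xi>" for s \<xi>
    by (simp add: W_def V_def eval_nat_numeral sum.atLeast_Suc_atMost scaleR_right_distrib)
  define Q where "Q = S \<times> ({-1..1::real} \<times> {0..1::real})"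
  define g where "g s \<xi> t = deriv_form f (replicate 6 (V s \<xi>)) (X s + t *\<^sub>R W s \<xi>)" for s \<xi> t
  have contS: "continuous_on Q (\<lambda>z. g (fst z))" if "continuous_on S g" for g :: "'c \<Rightarrow> 'a"
    by (rule continuous_on_compose2[OF that]) (auto simp: Q_def intro!: continuous_intros)
  have contV: "continuous_on Q (\<lambda>z. V (fst z) (fst (snd z)))"
    unfolding V_def by (intro continuous_intros contS c)
  have contW: "continuous_on Q (\<lambda>z. X (fst z) + snd (snd z) *\<^sub>R W (fst z) (fst (snd z)))"
    unfolding WV by (intro continuous_intros contS S contV)
  have "continuous_on Q (\<lambda>z. deriv_form f (map (\<lambda>c. c z) (replicate 6 (\<lambda>z. V (fst z) (fst (snd z)))) @ [])
      (X (fst z) + snd (snd z) *\<^sub>R W (fst z) (fst (snd z))))"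
    by (rule deriv_form_continuous_slots[OF f _ contW]) (use contV in auto)
  then have "continuous_on Q (\<lambda>z. g (fst z) (fst (snd z)) (snd (snd z)))"
    by (simp add: g_def del: deriv_form.simps)
  then have "bounded ((\<lambda>z. g (fst z) (fst (snd z)) (snd (snd z))) ` Q)"
    using S by (intro compact_imp_bounded compact_continuous_image)
      (auto simp: Q_def intro!: compact_Times)
  then obtain K where K: "\<And>z. z \<in> Q \<Longrightarrow> norm (g (fst z) (fst (snd z)) (snd (snd z))) \<le> K"
    by (auto simp: bounded_iff)
  have "norm (f (X s + W s \<xi>) - (\<Sum>i<6. (1 / fact i) *\<^sub>R deriv_form f (replicate i (W s \<xi>)) (X s)))
      \<le> K * \<bar>\<xi>\<bar> ^ 6" if "s \<in> S" "\<bar>\<xi>\<bar> < 1" for s \<xi>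
  proof (rule deriv_form_taylor_remainder[OF f])
    fix t :: real assume t: "t \<in> {0..1}"
    have "deriv_form f (replicate 6 (W s \<xi>)) x = \<xi> ^ 6 *\<^sub>R deriv_form f (replicate 6 (V s \<xi>)) x" for x
      using deriv_form_scale_all[OF f, of "[]" "replicate 6 (V s \<xi>)" \<xi> x]
      by (simp add: WV del: deriv_form.simps)
    then show "norm (deriv_form f (replicate 6 (W s \<xi>)) (X s + t *\<^sub>R W s \<xi>)) \<le> K * \<bar>\<xi>\<bar> ^ 6"
      using mult_right_mono[OF K[of "(s, \<xi>, t)"], of "\<bar>\<xi>\<bar> ^ 6"] that t
      by (simp add: g_def Q_def abs_less_iff power_abs mult.commute del: deriv_form.simps)
  qed simp
  then have "unif_O 6 S (\<lambda>s \<xi>. f (X s + W s \<xi>)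
      - (\<Sum>i<6. (1 / fact i) *\<^sub>R deriv_form f (replicate i (W s \<xi>)) (X s)))"
    unfolding unif_O_def
    by (intro exI[of _ K] eventually_mono[OF eventually_abs_less_nhds_0[of 1]]) auto
  moreover have "unif_O 6 S (\<lambda>s \<xi>. \<Sum>i<6. (1 / fact i) *\<^sub>R
      (deriv_form f (replicate i (W s \<xi>)) (X s)
        - (\<Sum>k<6. \<xi> ^ k *\<^sub>R slot_coeff f (\<lambda>i. c i s) i [] k (X s))))"
  proof (intro unif_O_sum unif_O_scale)
    fix i :: nat assume "i \<in> {..<6}"
    then show "unif_O 6 S (\<lambda>s \<xi>. deriv_form f (replicate i (W s \<xi>)) (X s)
        - (\<Sum>k<6. \<xi> ^ k *\<^sub>R slot_coeff f (\<lambda>i. c i s) i [] k (X s)))"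
      unfolding W_def using slot_expansion[OF f, of "[]" i S X c] S c by simp
  qed
  ultimately have "unif_O 6 S (\<lambda>s \<xi>. (f (X s + W s \<xi>)
      - (\<Sum>i<6. (1 / fact i) *\<^sub>R deriv_form f (replicate i (W s \<xi>)) (X s)))
      + (\<Sum>i<6. (1 / fact i) *\<^sub>R (deriv_form f (replicate i (W s \<xi>)) (X s)
        - (\<Sum>k<6. \<xi> ^ k *\<^sub>R slot_coeff f (\<lambda>i. c i s) i [] k (X s)))))"
    by (rule unif_O_add)
  moreover have "(\<Sum>k<6. \<xi> ^ k *\<^sub>R comp_coeff f (\<lambda>i. c i s) k (X s))
      = (\<Sum>i<6. (1 / fact i) *\<^sub>R (\<Sum>k<6. \<xi> ^ k *\<^sub>R slot_coeff f (\<lambda>i. c i s) i [] k (X s)))" for s \<xi>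
    unfolding comp_coeff_def scaleR_sum_right
    by (subst sum.swap) (simp add: mult.commute)
  ultimately show ?thesis
    unfolding W_def by (simp add: scaleR_diff_right sum_subtractf)
qed

text \<open>With the normalisation h_i / i!, the factor in front of each form counts the set
  partitions of k objects with the given block sizes: for example, 15 is the number of ways to split
  five objects into blocks of sizes 1, 2 and 2.\<close>

lemma comp_coeff_eqs:
  fixes f :: "'a::real_normed_vector \<Rightarrow> 'b::banach" and h :: "nat \<Rightarrow> 'a"
  assumes f: "Ck_on 6 UNIV f"
  defines "c \<equiv> \<lambda>i. (1 / fact i) *\<^sub>R h i"
  shows "comp_coeff f c 0 x = f x"
    and "comp_coeff f c 1 x = deriv_form f [h 1] x"
    and "2 *\<^sub>R comp_coeff f c 2 x = deriv_form f [h 2] x + deriv_form f [h 1, h 1] x"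
    and "6 *\<^sub>R comp_coeff f c 3 x = deriv_form f [h 3] x
      + 3 *\<^sub>R deriv_form f [h 1, h 2] x + deriv_form f [h 1, h 1, h 1] x"
    and "24 *\<^sub>R comp_coeff f c 4 x = deriv_form f [h 4] x
      + 4 *\<^sub>R deriv_form f [h 1, h 3] x + 3 *\<^sub>R deriv_form f [h 2, h 2] x
      + 6 *\<^sub>R deriv_form f [h 1, h 1, h 2] x + deriv_form f [h 1, h 1, h 1, h 1] x"
    and "120 *\<^sub>R comp_coeff f c 5 x = deriv_form f [h 5] x
      + 5 *\<^sub>R deriv_form f [h 1, h 4] x + 10 *\<^sub>R deriv_form f [h 2, h 3] x
      + 10 *\<^sub>R deriv_form f [h 1, h 1, h 3] x + 15 *\<^sub>R deriv_form f [h 1, h 2, h 2] x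
      + 10 *\<^sub>R deriv_form f [h 1, h 1, h 1, h 2] x + deriv_form f [h 1, h 1, h 1, h 1, h 1] x"
proof -
  note slot = deriv_form_linear_slot[OF f, THEN linear_scale]
  \<comment> \<open>Scalars are extracted from at most four slots: the only five-slot form of degree
    5 has \<open>c 1 = h 1\<close> in every slot and carries no factor.\<close>
  have s: "deriv_form f [r *\<^sub>R a] x = r *\<^sub>R deriv_form f [a] x"
    "deriv_form f [r *\<^sub>R a, b] x = r *\<^sub>R deriv_form f [a, b] x"
    "deriv_form f [b, r *\<^sub>R a] x = r *\<^sub>R deriv_form f [b, a] x"
    "deriv_form f [r *\<^sub>R a, b, d] x = r *\<^sub>R deriv_form f [a, b, d] x"
    "deriv_form f [b, r *\<^sub>R a, d] x = r *\<^sub>R deriv_form f [b, a, d] x"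
    "deriv_form f [b, d, r *\<^sub>R a] x = r *\<^sub>R deriv_form f [b, d, a] x"
    "deriv_form f [r *\<^sub>R a, b, d, e] x = r *\<^sub>R deriv_form f [a, b, d, e] x"
    "deriv_form f [b, r *\<^sub>R a, d, e] x = r *\<^sub>R deriv_form f [b, a, d, e] x"
    "deriv_form f [b, d, r *\<^sub>R a, e] x = r *\<^sub>R deriv_form f [b, d, a, e] x"
    "deriv_form f [b, d, e, r *\<^sub>R a] x = r *\<^sub>R deriv_form f [b, d, e, a] x" for r a b d e
    using slot[of "[]" "[]" r a x] slot[of "[]" "[b]" r a x] slot[of "[b]" "[]" r a x]
      slot[of "[]" "[b, d]" r a x] slot[of "[b]" "[d]" r a x] slot[of "[b, d]" "[]" r a x]
      slot[of "[]" "[b, d, e]" r a x] slot[of "[b]" "[d, e]" r a x] slot[of "[b, d]" "[e]" r a x]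
      slot[of "[b, d, e]" "[]" r a x]
    by (simp_all del: deriv_form.simps)
  note move = deriv_form_move_front[OF f]
  \<comment> \<open>Symmetry brings the arguments into increasing order of index, so that equal
    forms are recognised and their coefficients add up.\<close>
  have m: "deriv_form f [h 2, h 1] x = deriv_form f [h 1, h 2] x"
    "deriv_form f [h 3, h 1] x = deriv_form f [h 1, h 3] x"
    "deriv_form f [h 4, h 1] x = deriv_form f [h 1, h 4] x"
    "deriv_form f [h 3, h 2] x = deriv_form f [h 2, h 3] x"
    "deriv_form f [h 2, h 1, h 1] x = deriv_form f [h 1, h 1, h 2] x"
    "deriv_form f [h 3, h 1, h 1] x = deriv_form f [h 1, h 1, h 3] x"
    "deriv_form f [h 1, h 2, h 1] x = deriv_form f [h 1, h 1, h 2] x"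
    "deriv_form f [h 1, h 3, h 1] x = deriv_form f [h 1, h 1, h 3] x"
    "deriv_form f [h 2, h 1, h 2] x = deriv_form f [h 1, h 2, h 2] x"
    "deriv_form f [h 2, h 2, h 1] x = deriv_form f [h 1, h 2, h 2] x"
    "deriv_form f [h 2, h 1, h 1, h 1] x = deriv_form f [h 1, h 1, h 1, h 2] x"
    "deriv_form f [h 1, h 2, h 1, h 1] x = deriv_form f [h 1, h 1, h 1, h 2] x"
    "deriv_form f [h 1, h 1, h 2, h 1] x = deriv_form f [h 1, h 1, h 1, h 2] x"
    using move[of "[h 2]" "[]" "h 1"] move[of "[h 3]" "[]" "h 1"] move[of "[h 4]" "[]" "h 1"]
      move[of "[h 3]" "[]" "h 2"] 
      move[of "[h 1, h 1]" "[]" "h 2"] move[of "[h 1, h 1]" "[]" "h 3"]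
      move[of "[h 1]" "[h 1]" "h 2"] move[of "[h 1]" "[h 1]" "h 3"]
      move[of "[h 2]" "[h 2]" "h 1"] move[of "[h 2, h 2]" "[]" "h 1"]
      move[of "[h 1, h 1, h 1]" "[]" "h 2"] move[of "[h 1, h 1]" "[h 1]" "h 2"]
      move[of "[h 1]" "[h 1, h 1]" "h 2"]
    by (simp_all del: deriv_form.simps)
  have c: "c 1 = h 1" "c 2 = (1/2) *\<^sub>R h 2" "c 3 = (1/6) *\<^sub>R h 3"
    "c 4 = (1/24) *\<^sub>R h 4" "c 5 = (1/120) *\<^sub>R h 5"
    by (simp_all add: c_def fact_numeral)
  have S: "(\<Sum>i=1..0. g i) = (0::'b)" "(\<Sum>i=1..1. g i) = g 1" "(\<Sum>i=1..2. g i) = g 1 + g 2"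
    "(\<Sum>i=1..3. g i) = g 1 + g 2 + g 3" "(\<Sum>i=1..4. g i) = g 1 + g 2 + g 3 + g 4"
    "(\<Sum>i=1..5. g i) = g 1 + g 2 + g 3 + g 4 + g 5"
    "(\<Sum>i<6. g i) = g 0 + g 1 + g 2 + g 3 + g 4 + g 5" for g :: "nat \<Rightarrow> 'b"
    by (simp_all add: eval_nat_numeral sum.atLeast_Suc_atMost add.assoc)
  have sc: "slot_coeff f c 1 es k x = (\<Sum>i=1..k. slot_coeff f c 0 (es @ [c i]) (k - i) x)"
    "slot_coeff f c 2 es k x = (\<Sum>i=1..k. slot_coeff f c 1 (es @ [c i]) (k - i) x)"
    "slot_coeff f c 3 es k x = (\<Sum>i=1..k. slot_coeff f c 2 (es @ [c i]) (k - i) x)"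
    "slot_coeff f c 4 es k x = (\<Sum>i=1..k. slot_coeff f c 3 (es @ [c i]) (k - i) x)"
    "slot_coeff f c 5 es k x = (\<Sum>i=1..k. slot_coeff f c 4 (es @ [c i]) (k - i) x)" for es k
    by (simp_all add: eval_nat_numeral)
  \<comment> \<open>The values are tabulated by number of slots, each level being rewritten by the
    previous one, for an arbitrary prefix \<open>es\<close>. The prefix is needed because the
    recursion appends the chosen entry to it.\<close>
  have L0: "slot_coeff f c 0 es 0 x = deriv_form f es x"
    "slot_coeff f c 0 es 1 x = 0" "slot_coeff f c 0 es 2 x = 0" "slot_coeff f c 0 es 3 x = 0"
    "slot_coeff f c 0 es 4 x = 0" "slot_coeff f c 0 es 5 x = 0" for es
    by simp_all
  have d: "1 - 1 = (0::nat)" "2 - 1 = (1::nat)" "2 - 2 = (0::nat)" "3 - 1 = (2::nat)" "3 - 2 = (1::nat)"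
    "3 - 3 = (0::nat)" "4 - 1 = (3::nat)" "4 - 2 = (2::nat)" "4 - 3 = (1::nat)" "4 - 4 = (0::nat)"
    "5 - 1 = (4::nat)" "5 - 2 = (3::nat)" "5 - 3 = (2::nat)" "5 - 4 = (1::nat)" "5 - 5 = (0::nat)"
    by simp_all
  note e = S d append.simps append_assoc add_0_left add_0_right
  have L1: "slot_coeff f c 1 es 0 x = 0"
    "slot_coeff f c 1 es 1 x = deriv_form f (es @ [c 1]) x"
    "slot_coeff f c 1 es 2 x = deriv_form f (es @ [c 2]) x"
    "slot_coeff f c 1 es 3 x = deriv_form f (es @ [c 3]) x"
    "slot_coeff f c 1 es 4 x = deriv_form f (es @ [c 4]) x"
    "slot_coeff f c 1 es 5 x = deriv_form f (es @ [c 5]) x" for es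
    by (simp_all only: sc(1) L0 e)
  have L2: "slot_coeff f c 2 es 0 x = 0" "slot_coeff f c 2 es 1 x = 0"
    "slot_coeff f c 2 es 2 x = deriv_form f (es @ [c 1, c 1]) x"
    "slot_coeff f c 2 es 3 x = deriv_form f (es @ [c 1, c 2]) x + deriv_form f (es @ [c 2, c 1]) x"
    "slot_coeff f c 2 es 4 x = deriv_form f (es @ [c 1, c 3]) x + deriv_form f (es @ [c 2, c 2]) x
      + deriv_form f (es @ [c 3, c 1]) x"
    "slot_coeff f c 2 es 5 x = deriv_form f (es @ [c 1, c 4]) x + deriv_form f (es @ [c 2, c 3]) x
      + deriv_form f (es @ [c 3, c 2]) x + deriv_form f (es @ [c 4, c 1]) x" for es
    by (simp_all only: sc(2) L1 e)
  have L3: "slot_coeff f c 3 es 0 x = 0" "slot_coeff f c 3 es 1 x = 0" "slot_coeff f c 3 es 2 x = 0"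
    "slot_coeff f c 3 es 3 x = deriv_form f (es @ [c 1, c 1, c 1]) x"
    "slot_coeff f c 3 es 4 x = deriv_form f (es @ [c 1, c 1, c 2]) x
      + deriv_form f (es @ [c 1, c 2, c 1]) x + deriv_form f (es @ [c 2, c 1, c 1]) x"
    "slot_coeff f c 3 es 5 x = deriv_form f (es @ [c 1, c 1, c 3]) x
      + deriv_form f (es @ [c 1, c 2, c 2]) x + deriv_form f (es @ [c 1, c 3, c 1]) x
      + (deriv_form f (es @ [c 2, c 1, c 2]) x + deriv_form f (es @ [c 2, c 2, c 1]) x)
      + deriv_form f (es @ [c 3, c 1, c 1]) x" for es
    by (simp_all only: sc(3) L2 e)
  have L4: "slot_coeff f c 4 es 0 x = 0" "slot_coeff f c 4 es 1 x = 0" "slot_coeff f c 4 es 2 x = 0"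
    "slot_coeff f c 4 es 3 x = 0"
    "slot_coeff f c 4 es 4 x = deriv_form f (es @ [c 1, c 1, c 1, c 1]) x"
    "slot_coeff f c 4 es 5 x = deriv_form f (es @ [c 1, c 1, c 1, c 2]) x
      + deriv_form f (es @ [c 1, c 1, c 2, c 1]) x + deriv_form f (es @ [c 1, c 2, c 1, c 1]) x
      + deriv_form f (es @ [c 2, c 1, c 1, c 1]) x" for es
    by (simp_all only: sc(4) L3 e)
  have L5: "slot_coeff f c 5 es 0 x = 0" "slot_coeff f c 5 es 1 x = 0" "slot_coeff f c 5 es 2 x = 0"
    "slot_coeff f c 5 es 3 x = 0" "slot_coeff f c 5 es 4 x = 0"
    "slot_coeff f c 5 es 5 x = deriv_form f (es @ [c 1, c 1, c 1, c 1, c 1]) x" for es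
    by (simp_all only: sc(5) L4 e)
  have F: "comp_coeff f c k x = slot_coeff f c 0 [] k x + slot_coeff f c 1 [] k x
      + (1/2) *\<^sub>R slot_coeff f c 2 [] k x + (1/6) *\<^sub>R slot_coeff f c 3 [] k x
      + (1/24) *\<^sub>R slot_coeff f c 4 [] k x + (1/120) *\<^sub>R slot_coeff f c 5 [] k x" for k
    by (simp add: comp_coeff_def S fact_numeral del: slot_coeff.simps One_nat_def)
  have collect: "r *\<^sub>R y + q *\<^sub>R y = (r + q) *\<^sub>R y" "r *\<^sub>R y + (q *\<^sub>R y + z) = (r + q) *\<^sub>R y + z"
    for r q and y z :: 'b
    by (simp_all add: scaleR_left_distrib)
  note ev = F L0 L1 L2 L3 L4 L5 append.simps c s m
  show "comp_coeff f c 0 x = f x"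
    by (simp add: ev del: slot_coeff.simps One_nat_def)
  show "comp_coeff f c 1 x = deriv_form f [h 1] x"
    by (simp add: ev del: slot_coeff.simps deriv_form.simps One_nat_def)
  show "2 *\<^sub>R comp_coeff f c 2 x = deriv_form f [h 2] x + deriv_form f [h 1, h 1] x"
    by (simp only: ev) (simp add: scaleR_right_distrib collect add_ac del: slot_coeff.simps deriv_form.simps One_nat_def)
  show "6 *\<^sub>R comp_coeff f c 3 x = deriv_form f [h 3] x
      + 3 *\<^sub>R deriv_form f [h 1, h 2] x + deriv_form f [h 1, h 1, h 1] x"
    by (simp only: ev) (simp add: scaleR_right_distrib collect add_ac del: slot_coeff.simps deriv_form.simps One_nat_def)
  show "24 *\<^sub>R comp_coeff f c 4 x = deriv_form f [h 4] x
      + 4 *\<^sub>R deriv_form f [h 1, h 3] x + 3 *\<^sub>R deriv_form f [h 2, h 2] x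
      + 6 *\<^sub>R deriv_form f [h 1, h 1, h 2] x + deriv_form f [h 1, h 1, h 1, h 1] x"
    by (simp only: ev) (simp add: scaleR_right_distrib collect add_ac del: slot_coeff.simps deriv_form.simps One_nat_def)
  show "120 *\<^sub>R comp_coeff f c 5 x = deriv_form f [h 5] x
      + 5 *\<^sub>R deriv_form f [h 1, h 4] x + 10 *\<^sub>R deriv_form f [h 2, h 3] x
      + 10 *\<^sub>R deriv_form f [h 1, h 1, h 3] x + 15 *\<^sub>R deriv_form f [h 1, h 2, h 2] x
      + 10 *\<^sub>R deriv_form f [h 1, h 1, h 1, h 2] x + deriv_form f [h 1, h 1, h 1, h 1, h 1] x"
    by (simp only: ev) (simp add: scaleR_right_distrib collect add_ac del: slot_coeff.simps deriv_form.simps One_nat_def)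
qed

section \<open>Coefficients of expansions\<close>

lemma unif_O_Suc: "unif_O (Suc n) S g \<Longrightarrow> unif_O n S g"
proof -
  assume "unif_O (Suc n) S g"
  then obtain K where "\<forall>\<^sub>F \<xi> in nhds 0. \<forall>\<tau>\<in>S. norm (g \<tau> \<xi>) \<le> K * \<bar>\<xi>\<bar> ^ Suc n"
    unfolding unif_O_def by blast
  with eventually_abs_less_nhds_0[OF zero_less_one]
  have "\<forall>\<^sub>F \<xi> in nhds 0. \<forall>\<tau>\<in>S. norm (g \<tau> \<xi>) \<le> \<bar>K\<bar> * \<bar>\<xi>\<bar> ^ n"
  proof eventually_elim
    case (elim \<xi>)
    have "K * \<bar>\<xi>\<bar> ^ Suc n \<le> \<bar>K\<bar> * \<bar>\<xi>\<bar> ^ n"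
      using elim(1) by (intro mult_mono power_decreasing) auto
    with elim show ?case
      by (auto intro: order_trans)
  qed
  then show ?thesis
    unfolding unif_O_def by blast
qed

lemma filterlim_mult_nhds_0: "filterlim ((*) r) (nhds 0) (nhds (0::real))"
  using tendsto_mult[OF tendsto_const filterlim_ident, of r "0::real"] by simp

text \<open>Used with r = 2 to cancel the top coefficient of an expansion, and with r = -1 for the
  reflection of \<xi> in the symmetry of \<open>u\<close>.\<close>

lemma unif_O_dilate:
  assumes "unif_O n S g"
  shows "unif_O n S (\<lambda>\<tau> \<xi>. g \<tau> (r * \<xi>))"
proof -
  obtain K where "\<forall>\<^sub>F \<xi> in nhds 0. \<forall>\<tau>\<in>S. norm (g \<tau> \<xi>) \<le> K * \<bar>\<xi>\<bar> ^ n"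
    using assms unfolding unif_O_def by blast
  from eventually_compose_filterlim[OF this filterlim_mult_nhds_0]
  have "\<forall>\<^sub>F \<xi> in nhds 0. \<forall>\<tau>\<in>S. norm (g \<tau> (r * \<xi>)) \<le> (K * \<bar>r\<bar> ^ n) * \<bar>\<xi>\<bar> ^ n"
    by (simp add: abs_mult power_mult_distrib mult.assoc)
  then show ?thesis
    unfolding unif_O_def by blast
qed

text \<open>\<open>G \<tau> (2 \<xi>) - 2\<^sup>n G \<tau> \<xi>\<close> has no term in \<open>\<xi>\<^sup>n\<close>, which gives an induction on the order of the
  expansion.\<close>
lemma expansion_coeffs_continuous_on:
  fixes G :: "'s::topological_space \<Rightarrow> real \<Rightarrow> 'a::real_normed_vector"
  assumes "\<forall>\<^sub>F \<xi> in nhds 0. continuous_on S (\<lambda>\<tau>. G \<tau> \<xi>)"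
    and "unif_O n S (\<lambda>\<tau> \<xi>. G \<tau> \<xi> - (\<Sum>k<n. \<xi> ^ k *\<^sub>R c k \<tau>))"
    and "k < n"
  shows "continuous_on S (c k)"
  using assms
proof (induction n arbitrary: G c k)
  case (Suc n)
  define R where "R \<tau> \<xi> = G \<tau> \<xi> - (\<Sum>k<Suc n. \<xi> ^ k *\<^sub>R c k \<tau>)" for \<tau> \<xi>
  have R: "unif_O (Suc n) S R"
    using Suc.prems(2) unfolding R_def .
  have lower: "continuous_on S (c k)" if "k < n" for k
  proof -
    have "continuous_on S (\<lambda>\<tau>. (2 ^ k - 2 ^ n) *\<^sub>R c k \<tau>)"
    proof (rule Suc.IH[OF _ _ that])
      from eventually_compose_filterlim[OF Suc.prems(1) filterlim_mult_nhds_0[of 2]] Suc.prems(1)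
      show "\<forall>\<^sub>F \<xi> in nhds 0. continuous_on S (\<lambda>\<tau>. G \<tau> (2 * \<xi>) - 2 ^ n *\<^sub>R G \<tau> \<xi>)"
        by eventually_elim (intro continuous_intros)
      have "unif_O n S (\<lambda>\<tau> \<xi>. R \<tau> (2 * \<xi>) - 2 ^ n *\<^sub>R R \<tau> \<xi>)"
        by (rule unif_O_Suc) (intro unif_O_diff unif_O_scale unif_O_dilate R)
      moreover have "R \<tau> (2 * \<xi>) - 2 ^ n *\<^sub>R R \<tau> \<xi>
          = (G \<tau> (2 * \<xi>) - 2 ^ n *\<^sub>R G \<tau> \<xi>) - (\<Sum>k<n. \<xi> ^ k *\<^sub>R (2 ^ k - 2 ^ n) *\<^sub>R c k \<tau>)" for \<tau> \<xi>
      proof -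
        have "\<xi> ^ k *\<^sub>R (2 ^ k - 2 ^ n) *\<^sub>R c k \<tau>
            = (2 * \<xi>) ^ k *\<^sub>R c k \<tau> - 2 ^ n *\<^sub>R \<xi> ^ k *\<^sub>R c k \<tau>" for k
          by (simp add: power_mult_distrib scaleR_diff_right scaleR_diff_left mult.commute)
        then have "(\<Sum>k<n. \<xi> ^ k *\<^sub>R (2 ^ k - 2 ^ n) *\<^sub>R c k \<tau>)
            = (\<Sum>k<n. (2 * \<xi>) ^ k *\<^sub>R c k \<tau>) - 2 ^ n *\<^sub>R (\<Sum>k<n. \<xi> ^ k *\<^sub>R c k \<tau>)"
          by (simp only: sum_subtractf scaleR_sum_right)
        then show ?thesis
          by (simp add: R_def power_mult_distrib scaleR_diff_right scaleR_right_distrib)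
      qed
      ultimately show "unif_O n S (\<lambda>\<tau> \<xi>. (G \<tau> (2 * \<xi>) - 2 ^ n *\<^sub>R G \<tau> \<xi>)
          - (\<Sum>k<n. \<xi> ^ k *\<^sub>R (2 ^ k - 2 ^ n) *\<^sub>R c k \<tau>))"
        by simp
    qed
    then have "continuous_on S (\<lambda>\<tau>. inverse (2 ^ k - 2 ^ n) *\<^sub>R (2 ^ k - 2 ^ n) *\<^sub>R c k \<tau>)"
      by (rule continuous_on_scaleR[OF continuous_on_const])
    moreover have "(2::real) ^ k \<noteq> 2 ^ n"
      using that by simp
    ultimately show ?thesis
      by (simp only: scaleR_scaleR left_inverse right_minus_eq not_False_eq_True scaleR_one)
  qed
  \<comment> \<open>With the lower coefficients known to be continuous, the top one is the limit,
    uniform in \<tau>, of continuous quotients as \<xi> decreases to 0; the error is at most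
    \<open>\<bar>K\<bar> * \<xi>\<close>.\<close>
  moreover have "continuous_on S (c n)"
  proof -
    define g where "g \<xi> \<tau> = inverse (\<xi> ^ n) *\<^sub>R (G \<tau> \<xi> - (\<Sum>k<n. \<xi> ^ k *\<^sub>R c k \<tau>))" for \<xi> \<tau>
    obtain K where K: "\<forall>\<^sub>F \<xi> in nhds 0. \<forall>\<tau>\<in>S. norm (R \<tau> \<xi>) \<le> K * \<bar>\<xi>\<bar> ^ Suc n"
      using R unfolding unif_O_def by blast
    have le: "\<forall>\<^sub>F \<xi> in at_right 0. \<forall>\<tau>\<in>S. dist (g \<xi> \<tau>) (c n \<tau>) \<le> \<bar>K\<bar> * \<xi>"
      using filter_leD[OF at_within_le_nhds K] eventually_at_right_less
    proof eventually_elim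
      case (elim \<xi>)
      show ?case
      proof
        fix \<tau> assume "\<tau> \<in> S"
        have "g \<xi> \<tau> - c n \<tau> = inverse (\<xi> ^ n) *\<^sub>R R \<tau> \<xi>"
          using elim(2) by (simp add: g_def R_def algebra_simps)
        then have "dist (g \<xi> \<tau>) (c n \<tau>) = inverse (\<xi> ^ n) * norm (R \<tau> \<xi>)"
          using elim(2) by (simp add: dist_norm)
        also have "\<dots> \<le> inverse (\<xi> ^ n) * (K * \<bar>\<xi>\<bar> ^ Suc n)"
          using elim \<open>\<tau> \<in> S\<close> by (intro mult_left_mono) auto
        also have "\<dots> \<le> \<bar>K\<bar> * \<xi>"
          using elim(2) by (simp add: field_simps mult_right_mono)
        finally show "dist (g \<xi> \<tau>) (c n \<tau>) \<le> \<bar>K\<bar> * \<xi>" .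
      qed
    qed
    have "uniform_limit S g (c n) (at_right 0)"
    proof (rule uniform_limitI)
      fix e :: real assume "e > 0"
      have "((\<lambda>\<xi>. \<bar>K\<bar> * \<xi>) \<longlongrightarrow> 0) (at_right 0)"
        by (auto intro!: tendsto_eq_intros)
      from order_tendstoD(2)[OF this \<open>e > 0\<close>] le
      show "\<forall>\<^sub>F \<xi> in at_right 0. \<forall>\<tau>\<in>S. dist (g \<xi> \<tau>) (c n \<tau>) < e"
        by eventually_elim (auto intro: le_less_trans)
    qed
    moreover have "\<forall>\<^sub>F \<xi> in at_right 0. continuous_on S (g \<xi>)"
      using filter_leD[OF at_within_le_nhds Suc.prems(1)]
      by eventually_elim (unfold g_def, intro continuous_intros lower, auto)
    ultimately show ?thesis
      by (intro uniform_limit_theorem[where F = "at_right 0"]) auto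
  qed
  ultimately show ?case
    using Suc.prems(3) by (auto simp: less_Suc_eq)
qed simp

text \<open>A polynomial that is o(\<xi>^n) tends to 0, so its constant term vanishes; division by
  \<xi> lowers the degree by one. The hypothesis is a little-o statement because one error term in
  the integrated equation is controlled by mere continuity, without a rate.\<close>

lemma polynomial_coeffs_zero:
  fixes a :: "nat \<Rightarrow> 'a::real_normed_vector"
  assumes "((\<lambda>\<xi>. inverse (\<xi> ^ n) *\<^sub>R (\<Sum>k<Suc n. \<xi> ^ k *\<^sub>R a k)) \<longlongrightarrow> 0) (at_right 0)" "k \<le> n"
  shows "a k = 0"
  using assms
proof (induction n arbitrary: a k)
  case 0
  then show ?case
    by (simp add: tendsto_const_iff)
next
  case (Suc n)
  let ?p = "\<lambda>\<xi>. \<Sum>k<Suc (Suc n). \<xi> ^ k *\<^sub>R a k"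
  have p: "?p \<xi> = a 0 + \<xi> *\<^sub>R (\<Sum>k<Suc n. \<xi> ^ k *\<^sub>R a (Suc k))" for \<xi>
    by (subst sum.lessThan_Suc_shift) (simp add: scaleR_sum_right scaleR_right_distrib)
  have "(\<lambda>\<xi>. \<xi> ^ Suc n) \<midarrow>0\<rightarrow> (0::real)"
    by (auto intro!: tendsto_eq_intros)
  then have "((\<lambda>\<xi>. \<xi> ^ Suc n) \<longlongrightarrow> (0::real)) (at_right 0)"
    by (rule filterlim_mono) (auto simp: at_le)
  from tendsto_scaleR[OF this Suc.prems(1)]
  have "((\<lambda>\<xi>. \<xi> ^ Suc n *\<^sub>R inverse (\<xi> ^ Suc n) *\<^sub>R ?p \<xi>) \<longlongrightarrow> 0) (at_right 0)"
    by simp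
  moreover have "\<forall>\<^sub>F \<xi> in at_right 0. \<xi> ^ Suc n *\<^sub>R inverse (\<xi> ^ Suc n) *\<^sub>R ?p \<xi> = ?p \<xi>"
    using eventually_at_right_less by eventually_elim (simp del: power_Suc sum.lessThan_Suc)
  ultimately have "(?p \<longlongrightarrow> 0) (at_right 0)"
    by (rule Lim_transform_eventually)
  moreover have "(?p \<longlongrightarrow> a 0) (at_right 0)"
    unfolding p by (auto intro!: tendsto_eq_intros)
  ultimately have a0: "a 0 = 0"
    using tendsto_unique trivial_limit_at_right_real by blast
  have "\<forall>\<^sub>F \<xi> in at_right 0. inverse (\<xi> ^ Suc n) *\<^sub>R ?p \<xi>
      = inverse (\<xi> ^ n) *\<^sub>R (\<Sum>k<Suc n. \<xi> ^ k *\<^sub>R a (Suc k))"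
    using eventually_at_right_less by eventually_elim (simp add: p a0 del: sum.lessThan_Suc)
  from Suc.IH[OF Lim_transform_eventually[OF Suc.prems(1) this]]
  have "a (Suc k) = 0" if "k \<le> n" for k
    using that by blast
  with a0 Suc.prems(2) show ?case
    by (cases k) auto
qed

lemma unif_O_imp_tendsto_0:
  assumes "unif_O (Suc n) S g" "s \<in> S"
  shows "((\<lambda>\<xi>. inverse (\<xi> ^ n) *\<^sub>R g s \<xi>) \<longlongrightarrow> 0) (at_right 0)"
proof -
  obtain K where K: "\<forall>\<^sub>F \<xi> in nhds 0. \<forall>\<tau>\<in>S. norm (g \<tau> \<xi>) \<le> K * \<bar>\<xi>\<bar> ^ Suc n"
    using assms unfolding unif_O_def by blast
  have "\<forall>\<^sub>F \<xi> in at_right 0. norm (inverse (\<xi> ^ n) *\<^sub>R g s \<xi>) \<le> K * \<xi>"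
    using filter_leD[OF at_within_le_nhds K] eventually_at_right_less
  proof eventually_elim
    case (elim \<xi>)
    have "inverse (\<xi> ^ n) * norm (g s \<xi>) \<le> inverse (\<xi> ^ n) * (K * \<bar>\<xi>\<bar> ^ Suc n)"
      using elim assms(2) by (intro mult_left_mono) auto
    also have "\<dots> = K * \<xi>"
      using elim(2) by simp
    finally show ?case
      using elim(2) by simp
  qed
  moreover have "((\<lambda>\<xi>. K * \<xi>) \<longlongrightarrow> 0) (at_right 0)"
    by (auto intro!: tendsto_eq_intros)
  ultimately show ?thesis
    by (rule Lim_null_comparison)
qed

section \<open>Local solutions of autonomous systems\<close>

text \<open>The values on the finitely many basis vectors control the operator norm. This converts
  continuity of a derivative in each fixed direction into a Lipschitz constant, and continuity of
  the matrix \<open>A\<close> along the cycle into a bound.\<close>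

lemma linear_family_bounded:
  fixes L :: "'s \<Rightarrow> 'a::euclidean_space \<Rightarrow> 'b::real_normed_vector"
  assumes lin: "\<And>s. s \<in> S \<Longrightarrow> linear (L s)" and bdd: "\<And>w. bounded ((\<lambda>s. L s w) ` S)"
  obtains K where "K \<ge> 0" "\<And>s w. s \<in> S \<Longrightarrow> norm (L s w) \<le> K * norm w"
proof -
  have "\<exists>M. \<forall>s\<in>S. norm (L s w) \<le> M" for w
    using bdd[of w] by (auto simp: bounded_iff)
  then obtain M where M: "\<And>s w. s \<in> S \<Longrightarrow> norm (L s w) \<le> M w"
    by metis
  have "norm (L s w) \<le> (\<Sum>b\<in>Basis. \<bar>M b\<bar>) * norm w" if s: "s \<in> S" for s w
  proof -
    have "L s w = L s (\<Sum>b\<in>Basis. (w \<bullet> b) *\<^sub>R b)"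
      by (simp add: euclidean_representation)
    also have "\<dots> = (\<Sum>b\<in>Basis. (w \<bullet> b) *\<^sub>R L s b)"
      by (simp only: linear_sum[OF lin[OF s]] linear_scale[OF lin[OF s]])
    also have "norm \<dots> \<le> (\<Sum>b\<in>Basis. norm w * \<bar>M b\<bar>)"
    proof (rule order_trans[OF norm_sum sum_mono])
      fix b :: 'a assume "b \<in> Basis"
      have "norm (L s b) \<le> \<bar>M b\<bar>"
        using M[OF s, of b] by linarith
      then show "norm ((w \<bullet> b) *\<^sub>R L s b) \<le> norm w * \<bar>M b\<bar>"
        using Basis_le_norm[OF \<open>b \<in> Basis\<close>, of w] by (auto intro: mult_mono)
    qed
    finally show ?thesis
      by (simp add: sum_distrib_left mult.commute)
  qed
  then show ?thesis
    by (intro that[of "\<Sum>b\<in>Basis. \<bar>M b\<bar>"]) (auto intro: sum_nonneg)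
qed

lemma C1_imp_lipschitz_on_compact:
  fixes g :: "'a::euclidean_space \<Rightarrow> 'b::real_normed_vector"
  assumes D: "\<And>x. x \<in> S \<Longrightarrow> (g has_derivative g' x) (at x)"
    and cont: "\<And>w. continuous_on S (\<lambda>x. g' x w)"
    and K: "compact K" "convex K" "K \<subseteq> S"
  obtains L where "L \<ge> 0" "\<And>x y. x \<in> K \<Longrightarrow> y \<in> K \<Longrightarrow> norm (g x - g y) \<le> L * norm (x - y)"
proof -
  have "bounded ((\<lambda>x. g' x w) ` K)" for w
    by (rule compact_imp_bounded[OF compact_continuous_image[OF continuous_on_subset[OF cont K(3)] K(1)]])
  moreover have "linear (g' x)" if "x \<in> K" for x
    using has_derivative_linear[OF D] that K(3) by blast
  ultimately obtain M where M: "M \<ge> 0" "\<And>x w. x \<in> K \<Longrightarrow> norm (g' x w) \<le> M * norm w"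
    using linear_family_bounded[of K g'] by blast
  have "norm (g x - g y) \<le> M * norm (x - y)" if "x \<in> K" "y \<in> K" for x y
  proof (rule differentiable_bound[OF K(2) _ _ that(1,2)])
    fix z assume z: "z \<in> K"
    then show "(g has_derivative g' z) (at z within K)"
      using D K(3) by (blast intro: has_derivative_at_withinI)
    show "onorm (g' z) \<le> M"
      by (rule onorm_le) (rule M(2)[OF z])
  qed
  with M(1) show ?thesis
    by (rule that)
qed

text \<open>Banach fixed point of the integral operator on curves staying in the ball. A forward
  solution is enough, since its initial point is later reached as a limit from t > 0.\<close>

lemma picard_local_solution:
  fixes f :: "'a::banach \<Rightarrow> 'a"
  assumes r: "r > 0" and L: "L \<ge> 0"
    and lip: "\<And>x y. x \<in> cball x0 r \<Longrightarrow> y \<in> cball x0 r \<Longrightarrow> norm (f x - f y) \<le> L * norm (x - y)"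
  obtains \<epsilon> x where "\<epsilon> > 0" "continuous_on {0..\<epsilon>} x" "x 0 = x0" "\<And>t. x t \<in> cball x0 r"
    "\<And>t. t \<in> {0<..<\<epsilon>} \<Longrightarrow> (x has_vector_derivative f (x t)) (at t)"
proof -
  define M where "M = norm (f x0) + L * r"
  \<comment> \<open>The first entry keeps the image of the integral operator inside the ball, the
    second makes the operator a contraction with factor 1/2. Adding 1 guards against division by
    zero.\<close>
  define \<epsilon> where "\<epsilon> = min (r / (M + 1)) (1 / (2 * (L + 1)))"
  have "M \<ge> 0"
    using r L by (simp add: M_def)
  then have \<epsilon>: "\<epsilon> > 0" "\<epsilon> * M \<le> r" "\<epsilon> * L \<le> 1/2"
  proof -
    show "\<epsilon> > 0"
      using r L \<open>M \<ge> 0\<close> by (auto simp: \<epsilon>_def)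
    have "\<epsilon> * M \<le> r / (M + 1) * M"
      by (intro mult_right_mono) (auto simp: \<epsilon>_def \<open>M \<ge> 0\<close>)
    also have "\<dots> \<le> r"
      using r \<open>M \<ge> 0\<close> by (simp add: field_simps)
    finally show "\<epsilon> * M \<le> r" .
    have "\<epsilon> * L \<le> 1 / (2 * (L + 1)) * L"
      by (intro mult_right_mono) (auto simp: \<epsilon>_def L)
    also have "\<dots> \<le> 1/2"
      using L by (simp add: field_simps)
    finally show "\<epsilon> * L \<le> 1/2" .
  qed
  have bound: "norm (f x) \<le> M" if "x \<in> cball x0 r" for x
  proof -
    have "norm (f x - f x0) \<le> L * r"
      using lip[OF that, of x0] mult_left_mono[of "norm (x - x0)" r L] that r L
      by (simp add: dist_norm norm_minus_commute)
    then show ?thesis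
      unfolding M_def using norm_triangle_ineq2[of "f x" "f x0"] by linarith
  qed
  have "L-lipschitz_on (cball x0 r) f"
    using lip L by (intro lipschitz_onI) (auto simp: dist_norm)
  then have contf: "continuous_on (cball x0 r) f"
    by (rule lipschitz_on_continuous_on)
  define X :: "(real \<Rightarrow>\<^sub>C 'a) set" where "X = PiC UNIV (\<lambda>_. cball x0 r)"
  have X: "g \<in> X \<longleftrightarrow> (\<forall>t. g t \<in> cball x0 r)" for g
    by (auto simp: X_def mem_PiC_iff)
  \<comment> \<open>Time is clamped to \<open>{0..\<epsilon>}\<close>: the fixed point is sought
    among bounded continuous functions on the whole line, made constant outside that
    interval.\<close>
  define cl where "cl t = max 0 (min t \<epsilon>)" for t
  have cl: "cl t \<in> {0..\<epsilon>}" for t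
    using \<epsilon> by (auto simp: cl_def)
  have contfg: "continuous_on R (\<lambda>s. f (g s))" if "g \<in> X" for g :: "real \<Rightarrow>\<^sub>C 'a" and R
    by (rule continuous_on_compose2[OF contf]) (use that X in auto)
  then have int: "(\<lambda>s. f (g s)) integrable_on {a..b}" if "g \<in> X" for g :: "real \<Rightarrow>\<^sub>C 'a" and a b
    using that by (intro integrable_continuous_real)
  define P where "P g t = x0 + integral {0..cl t} (\<lambda>s. f (g s))" for g :: "real \<Rightarrow>\<^sub>C 'a" and t
  have P_ball: "P g t \<in> cball x0 r" if "g \<in> X" for g t
  proof -
    have "norm (integral {0..cl t} (\<lambda>s. f (g s))) \<le> M * (cl t - 0)"
      using that X bound cl[of t] by (intro integral_bound contfg) auto
    also have "\<dots> \<le> M * \<epsilon>"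
      using cl[of t] \<open>M \<ge> 0\<close> by (intro mult_left_mono) auto
    finally show ?thesis
      using \<epsilon> by (simp add: P_def dist_norm mult.commute)
  qed
  have P_bcontfun: "P g \<in> bcontfun" if "g \<in> X" for g
  proof -
    have "continuous_on {0..\<epsilon>} (\<lambda>t. integral {0..t} (\<lambda>s. f (g s)))"
      by (intro indefinite_integral_continuous_1 int that)
    moreover have "continuous_on UNIV cl"
      unfolding cl_def by (intro continuous_intros)
    ultimately have "continuous_on UNIV (\<lambda>t. integral {0..cl t} (\<lambda>s. f (g s)))"
      by (rule continuous_on_compose2) (use cl in auto)
    then have "continuous_on UNIV (P g)"
      unfolding P_def by (intro continuous_intros)
    moreover have "bounded (range (P g))"
      using P_ball[OF that] by (intro bounded_subset[OF bounded_cball]) auto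
    ultimately show ?thesis
      by (simp add: bcontfun_def)
  qed
  define \<Phi> where "\<Phi> g = Bcontfun (P g)" for g
  have \<Phi>: "apply_bcontfun (\<Phi> g) = P g" if "g \<in> X" for g
    unfolding \<Phi>_def by (rule Bcontfun_inverse[OF P_bcontfun[OF that]])
  have "\<exists>!g\<in>X. \<Phi> g = g"
  proof (rule Banach_fix[of X "1/2"])
    show "complete X"
      unfolding X_def complete_eq_closed by (rule closed_PiC) auto
    have "const_bcontfun x0 \<in> X"
      using r by (simp add: X const_bcontfun.rep_eq)
    then show "X \<noteq> {}"
      by auto
    show "\<Phi> ` X \<subseteq> X"
      using P_ball by (auto simp: X \<Phi>)
    fix g h assume gh: "g \<in> X" "h \<in> X"
    show "dist (\<Phi> g) (\<Phi> h) \<le> 1/2 * dist g h"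
    proof (rule dist_bound)
      fix t
      have "dist (\<Phi> g t) (\<Phi> h t) = norm (integral {0..cl t} (\<lambda>s. f (g s) - f (h s)))"
        using gh by (simp add: \<Phi> P_def dist_norm integral_diff int)
      also have "\<dots> \<le> (L * dist g h) * (cl t - 0)"
      proof (rule integral_bound)
        show "continuous_on {0..cl t} (\<lambda>s. f (g s) - f (h s))"
          using gh by (intro continuous_intros contfg)
        show "norm (f (g s) - f (h s)) \<le> L * dist g h" for s
          using lip[of "g s" "h s"] gh mult_left_mono[OF dist_bounded[of g s h] L]
          by (simp add: X dist_norm)
      qed (use cl in auto)
      also have "\<dots> \<le> (L * dist g h) * \<epsilon>"
        using cl[of t] L by (intro mult_left_mono) auto
      also have "\<dots> = (\<epsilon> * L) * dist g h"
        by simp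
      also have "\<dots> \<le> 1/2 * dist g h"
        by (intro mult_right_mono \<epsilon>) auto
      finally show "dist (\<Phi> g t) (\<Phi> h t) \<le> 1/2 * dist g h" .
    qed
  qed auto
  then obtain g where g: "g \<in> X" "\<Phi> g = g"
    by auto
  have gP: "g t = P g t" for t
    using \<Phi>[OF g(1)] g(2) by simp
  show ?thesis
  proof (rule that[of \<epsilon> "apply_bcontfun g"])
    show "g 0 = x0"
      using \<epsilon>(1) by (simp add: gP[of 0] P_def cl_def)
    show "g t \<in> cball x0 r" for t
      using g(1) by (simp only: X)
    fix t assume t: "t \<in> {0<..<\<epsilon>}"
    have "((\<lambda>t. x0 + integral {0..t} (\<lambda>s. f (g s))) has_vector_derivative 0 + f (g t)) (at t within {0..\<epsilon>})"
      using t by (intro has_vector_derivative_add has_vector_derivative_const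
          integral_has_vector_derivative contfg g) auto
    moreover have "g s = x0 + integral {0..s} (\<lambda>s. f (g s))" if "s \<in> {0..\<epsilon>}" for s
      using that by (simp add: gP[of s] P_def cl_def)
    ultimately have "(g has_vector_derivative 0 + f (g t)) (at t within {0..\<epsilon>})"
      using t by (intro has_vector_derivative_transform[of t "{0..\<epsilon>}" g]) auto
    then show "(g has_vector_derivative f (g t)) (at t)"
      using t at_within_Icc_at[of 0 t \<epsilon>] by simp
  qed (use \<epsilon> in auto)
qed

section \<open>Simple eigenvalues\<close>

lemma poly_det:
  fixes M :: "'a::comm_ring_1 poly^'n^'n"
  shows "poly (det M) x = det (\<chi> i j. poly (M $ i $ j) x)"
  by (simp add: det_def poly_sum poly_prod)

lemma det_column_mult:
  fixes N :: "'a::comm_ring_1^'n^'n"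
  shows "det (\<chi> i j. if j = k then c * a i else N $ i $ j) = c * det (\<chi> i j. if j = k then a i else N $ i $ j)"
proof -
  have tr: "(\<chi> i j. if j = k then d i else N $ i $ j)
      = transpose (\<chi> j. if j = k then (\<chi> i. d i) else column j N)" for d
    by (auto simp: vec_eq_iff transpose_def column_def)
  have "c *s (\<chi> i. a i) = ((\<chi> i. c * a i) :: 'a^'n)"
    by (simp add: vec_eq_iff)
  then have "det (\<chi> j. if j = k then (\<chi> i. c * a i) else column j N)
      = c * det (\<chi> j. if j = k then (\<chi> i. a i) else column j N)"
    using det_row_mul[of k c "\<lambda>_. (\<chi> i. a i)" "\<lambda>j. column j N"] by (simp only:)
  then show ?thesis
    by (simp add: tr det_transpose)
qed

text \<open>The reversed polynomial \<open>det (I - y M)\<close> takes the value 1 at 0.\<close>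
lemma charpoly_nonzero: "charpoly M \<noteq> 0"
proof
  assume 0: "charpoly M = 0"
  define R where "R = det (\<chi> i j. [:if i = j then 1 else 0, - complex_of_real (M $ i $ j):])"
  have "poly R 0 = det (mat 1 :: complex^'a^'a)"
    unfolding R_def poly_det by (intro arg_cong[of _ _ det]) (auto simp: vec_eq_iff mat_def)
  then have "R \<noteq> 0"
    by auto
  then have "finite (insert 0 {y. poly R y = 0})"
    by (simp add: poly_roots_finite)
  then obtain y where y: "y \<noteq> 0" "poly R y \<noteq> 0"
    using ex_new_if_finite[OF infinite_UNIV_char_0] by blast
  \<comment> \<open>This is I/y - M. Multiplying each of its rows by \<open>y\<close> gives I - y M,
    so \<open>R\<close> at \<open>y\<close> is a power of \<open>y\<close> times the characteristic
    polynomial at 1/y.\<close>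
  define N where "N = (\<chi> i j. (if i = j then 1 / y else 0) - complex_of_real (M $ i $ j))"
  have "det N = poly (charpoly M) (1 / y)"
    unfolding charpoly_def poly_det N_def by (intro arg_cong[of _ _ det]) (auto simp: vec_eq_iff)
  moreover have "poly R y = det (\<chi> i. y *s (N $ i))"
    unfolding R_def poly_det N_def using y
    by (intro arg_cong[of _ _ det]) (auto simp: vec_eq_iff field_simps)
  moreover have "det (\<chi> i. y *s (N $ i)) = (\<Prod>i\<in>(UNIV :: 'a set). y) * det (\<chi> i. N $ i)"
    by (rule det_rows_mul)
  ultimately show False
    using 0 y by simp
qed

text \<open>Replacing two columns of \<open>x I - M\<close> by its images of two independent eigenvectors, Cramer's rule
  exhibits \<open>(x - z)\<^sup>2\<close> as a factor of the characteristic polynomial.\<close>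
lemma eigenvectors_of_simple_eigenvalue:
  fixes M :: "real^'n^'n"
  assumes simple: "simple_eigenvalue_of M (complex_of_real z)"
    and a: "M *v a = z *\<^sub>R a" "a \<noteq> 0" and b: "M *v b = z *\<^sub>R b"
  shows "\<exists>c. b = c *\<^sub>R a"
proof -
  obtain k where k: "a $ k \<noteq> 0"
    using a(2) by (auto simp: vec_eq_iff)
  \<comment> \<open>Subtracting the right multiple of \<open>a\<close> cancels entry
    \<open>k\<close>. The aim is d = 0; a nonzero \<open>d\<close> would be an eigenvector
    independent of \<open>a\<close>.\<close>
  define d where "d = b - (b $ k / a $ k) *\<^sub>R a"
  have Md: "M *v d = z *\<^sub>R d"
    by (simp add: d_def matrix_vector_mult_diff_distrib matrix_vector_mult_scaleR a b scaleR_diff_right)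
  have dk: "d $ k = 0"
    using k by (simp add: d_def)
  have "d = 0"
  proof (rule ccontr)
    assume "d \<noteq> 0"
    then obtain l where l: "d $ l \<noteq> 0"
      by (auto simp: vec_eq_iff)
    then have lk: "l \<noteq> k"
      using dk by auto
    define N where "N x = (\<chi> i j. (if i = j then x else 0) - complex_of_real (M $ i $ j))" for x
    define av where "av = (\<chi> i. complex_of_real (a $ i))"
    define dv where "dv = (\<chi> i. complex_of_real (d $ i))"
    have Nv: "(N x *v (\<chi> i. complex_of_real (w $ i))) $ i = (x - z) * complex_of_real (w $ i)"
      if "M *v w = z *\<^sub>R w" for x w i
    proof -
      have "(N x *v (\<chi> i. complex_of_real (w $ i))) $ i
          = x * complex_of_real (w $ i) - complex_of_real ((M *v w) $ i)"
        by (simp add: N_def matrix_vector_mult_def left_diff_distrib sum_subtractf if_distrib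
            [of "\<lambda>y. y * _"] cong: if_cong)
      then show ?thesis
        using that by (simp add: left_diff_distrib)
    qed
    define Q :: "complex poly^'n^'n" where
      "Q = (\<chi> i j. if j = l then [:complex_of_real (d $ i):] else if j = k then [:complex_of_real (a $ i):]
        else (if i = j then [:0, 1:] else 0) - [:complex_of_real (M $ i $ j):])"
    have "complex_of_real (d $ l * a $ k) * poly (charpoly M) x = (x - z)^2 * poly (det Q) x" for x
    proof -
      \<comment> \<open>Column \<open>k\<close> becomes the image of \<open>a\<close>, which by
        Cramer's rule multiplies the determinant by \<open>a $ k\<close>. As
        \<open>d $ k = 0\<close>, the changed column does not affect the image of \<open>d\<close>,
        so a second replacement at column \<open>l\<close> contributes \<open>d $ l\<close>; each
        replaced column then releases one factor x - z.\<close>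
      define N1 where "N1 = (\<chi> i j. if j = k then (N x *v av) $ i else N x $ i $ j)"
      have N1d: "(N1 *v dv) $ i = (x - z) * complex_of_real (d $ i)" for i
      proof -
        have "(N1 *v dv) $ i = (N x *v dv) $ i"
          using dk by (auto simp: matrix_vector_mult_def N1_def dv_def intro!: sum.cong)
        then show ?thesis
          using Nv[OF Md] by (simp add: dv_def)
      qed
      have "poly (charpoly M) x = det (N x)"
        unfolding charpoly_def poly_det N_def by (intro arg_cong[of _ _ det]) (auto simp: vec_eq_iff)
      then have "complex_of_real (d $ l * a $ k) * poly (charpoly M) x = dv $ l * det N1"
        unfolding N1_def cramer_lemma by (simp add: av_def dv_def)
      also have "\<dots> = det (\<chi> i j. if j = l then (N1 *v dv) $ i else N1 $ i $ j)"
        by (rule cramer_lemma[symmetric])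
      also have "\<dots> = det (\<chi> i j. if j = l then (x - z) * complex_of_real (d $ i) else N1 $ i $ j)"
        by (simp only: N1d)
      also have "\<dots>
          = (x - z) * det (\<chi> i j. if j = l then complex_of_real (d $ i) else N1 $ i $ j)"
        by (rule det_column_mult)
      also have "(\<chi> i j. if j = l then complex_of_real (d $ i) else N1 $ i $ j)
          = (\<chi> i j. if j = k then (x - z) * complex_of_real (a $ i) else
              (\<chi> i j. if j = l then complex_of_real (d $ i) else N x $ i $ j) $ i $ j)"
        using lk Nv[OF a(1)] by (auto simp: vec_eq_iff N1_def av_def)
      also have "det \<dots> = (x - z) * det (\<chi> i j. if j = k then complex_of_real (a $ i) else
              (\<chi> i j. if j = l then complex_of_real (d $ i) else N x $ i $ j) $ i $ j)"
        by (rule det_column_mult)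
      also have "(\<chi> i j. if j = k then complex_of_real (a $ i) else
              (\<chi> i j. if j = l then complex_of_real (d $ i) else N x $ i $ j) $ i $ j)
          = (\<chi> i j. poly (Q $ i $ j) x)"
        using lk by (auto simp: vec_eq_iff Q_def N_def)
      finally show ?thesis
        by (simp add: poly_det power2_eq_square mult.assoc)
    qed
    then have "poly (smult (complex_of_real (d $ l * a $ k)) (charpoly M)) = poly ([:- z, 1:]^2 * det Q)"
      by (auto simp: fun_eq_iff)
    then have "[:- complex_of_real z, 1:]^2 dvd smult (complex_of_real (d $ l * a $ k)) (charpoly M)"
      by (simp add: poly_eq_poly_eq_iff)
    then have "[:- complex_of_real z, 1:]^2 dvd charpoly M"
      using k l by (simp add: dvd_smult_iff)
    moreover have "order (complex_of_real z) (charpoly M) = 1"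
      using simple by (simp add: simple_eigenvalue_of_def)
    ultimately show False
      using charpoly_nonzero[of M] by (simp add: order_divides)
  qed
  then show ?thesis
    by (auto simp: d_def)
qed

section \<open>Linear periodic boundary value problems\<close>

text \<open>Gronwall argument in differential form: exp(-2 K \<tau>) times the squared norm has
  nonpositive derivative and starts at 0.\<close>

lemma linear_ode_zero:
  fixes w :: "real \<Rightarrow> 'a::real_inner"
  assumes w: "\<And>\<tau>. \<tau> \<in> {0..T} \<Longrightarrow> (w has_vector_derivative L \<tau> (w \<tau>)) (at \<tau> within {0..T})"
    and K: "\<And>\<tau> x. \<tau> \<in> {0..T} \<Longrightarrow> norm (L \<tau> x) \<le> K * norm x"
    and "w 0 = 0" "s \<in> {0..T}"
  shows "w s = 0"
proof (cases "s = 0")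
  case False
  then have s: "0 < s" "s \<le> T"
    using assms(4) by auto
  define g where "g \<tau> = exp (- (2 * K) * \<tau>) * (w \<tau> \<bullet> w \<tau>)" for \<tau>
  have "(g has_derivative (\<lambda>h. h * (exp (- (2 * K) * \<tau>) * (2 * (w \<tau> \<bullet> L \<tau> (w \<tau>)) - 2 * K * (w \<tau> \<bullet> w \<tau>)))))
      (at \<tau> within {0..s})" if "0 \<le> \<tau>" "\<tau> \<le> s" for \<tau>
  proof -
    have "(w has_vector_derivative L \<tau> (w \<tau>)) (at \<tau> within {0..s})"
      by (rule has_vector_derivative_within_subset[OF w]) (use that s in auto)
    from bounded_bilinear.has_vector_derivative[OF bounded_bilinear_inner this this]
    have "((\<lambda>\<tau>. w \<tau> \<bullet> w \<tau>) has_real_derivative 2 * (w \<tau> \<bullet> L \<tau> (w \<tau>))) (at \<tau> within {0..s})"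
      by (simp add: has_real_derivative_iff_has_vector_derivative inner_commute)
    moreover have "((\<lambda>\<tau>. exp (- (2 * K) * \<tau>)) has_real_derivative exp (- (2 * K) * \<tau>) * - (2 * K))
        (at \<tau> within {0..s})"
      by (auto intro!: derivative_eq_intros)
    ultimately have "(g has_real_derivative exp (- (2 * K) * \<tau>) * - (2 * K) * (w \<tau> \<bullet> w \<tau>)
        + 2 * (w \<tau> \<bullet> L \<tau> (w \<tau>)) * exp (- (2 * K) * \<tau>)) (at \<tau> within {0..s})"
      unfolding g_def by (intro DERIV_mult)
    also have "exp (- (2 * K) * \<tau>) * - (2 * K) * (w \<tau> \<bullet> w \<tau>) + 2 * (w \<tau> \<bullet> L \<tau> (w \<tau>)) * exp (- (2 * K) * \<tau>)
        = exp (- (2 * K) * \<tau>) * (2 * (w \<tau> \<bullet> L \<tau> (w \<tau>)) - 2 * K * (w \<tau> \<bullet> w \<tau>))"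
      by (simp add: algebra_simps)
    finally show ?thesis
      by (simp only: has_field_derivative_def mult_commute_abs)
  qed
  from mvt_simple[OF s(1) this] obtain x where x: "x \<in> {0<..<s}" and
    eq: "g s - g 0 = (s - 0) * (exp (- (2 * K) * x) * (2 * (w x \<bullet> L x (w x)) - 2 * K * (w x \<bullet> w x)))"
    by blast
  have "w x \<bullet> L x (w x) \<le> norm (w x) * norm (L x (w x))"
    by (rule norm_cauchy_schwarz)
  also have "\<dots> \<le> norm (w x) * (K * norm (w x))"
    using K[of x "w x"] x s by (intro mult_left_mono) auto
  also have "\<dots> = K * (w x \<bullet> w x)"
    by (simp add: dot_square_norm power2_eq_square)
  finally have "g s - g 0 \<le> 0"
    unfolding eq using s by (intro mult_nonneg_nonpos) auto
  then have "w s \<bullet> w s \<le> 0"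
    using assms(3) by (simp add: g_def mult_le_0_iff)
  then show ?thesis
    using inner_eq_zero_iff inner_ge_zero order_antisym by blast
qed (use assms in simp)

lemma linear_ode_eq_fundamental:
  fixes A Y :: "real \<Rightarrow> real^'n^'n"
  assumes w: "\<And>\<tau>. \<tau> \<in> {0..T} \<Longrightarrow> (w has_vector_derivative A \<tau> *v w \<tau>) (at \<tau> within {0..T})"
    and K: "\<And>\<tau> x. \<tau> \<in> {0..T} \<Longrightarrow> norm (A \<tau> *v x) \<le> K * norm x"
    and Y: "\<And>\<tau>. (Y has_vector_derivative A \<tau> ** Y \<tau>) (at \<tau>)" "Y 0 = mat 1"
    and "s \<in> {0..T}"
  shows "w s = Y s *v w 0"
proof -
  have "linear (\<lambda>M::real^'n^'n. M *v w 0)"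
    by (rule linearI) (simp_all add: matrix_vector_mult_add_rdistrib scaleR_matrix_vector_assoc)
  then have bl: "bounded_linear (\<lambda>M::real^'n^'n. M *v w 0)"
    by (simp add: linear_conv_bounded_linear)
  have "w s - Y s *v w 0 = 0"
  proof (rule linear_ode_zero[where w = "\<lambda>\<tau>. w \<tau> - Y \<tau> *v w 0" and L = "\<lambda>\<tau> x. A \<tau> *v x" and T = T])
    fix \<tau> assume "\<tau> \<in> {0..T}"
    then have "((\<lambda>\<tau>. w \<tau> - Y \<tau> *v w 0) has_vector_derivative A \<tau> *v w \<tau> - (A \<tau> ** Y \<tau>) *v w 0)
        (at \<tau> within {0..T})"
      by (intro has_vector_derivative_diff w bounded_linear.has_vector_derivative[OF bl]
          has_vector_derivative_at_within[OF Y(1)])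
    then show "((\<lambda>\<tau>. w \<tau> - Y \<tau> *v w 0) has_vector_derivative A \<tau> *v (w \<tau> - Y \<tau> *v w 0))
        (at \<tau> within {0..T})"
      by (simp add: matrix_vector_mult_diff_distrib matrix_vector_mul_assoc)
  qed (use assms in auto)
  then show ?thesis
    by simp
qed

text \<open>One statement serves both signs: \<sigma> = 1 with the velocity F(u0) as
  \<open>e\<close>, and \<sigma> = -1 with \<open>v\<close>. Existence enters through the given
  solution \<open>h\<close>, which the coefficients of the manifold supply. Normalised pairing with
  \<psi> both forces \<open>e 0\<close> to be nonzero and determines the multiple of
  \<open>e\<close> in a difference of solutions.\<close>

lemma bvp_solution_unique:
  fixes A Y :: "real \<Rightarrow> real^'n^'n"
  assumes "T > 0"
    and K: "\<And>\<tau> x. \<tau> \<in> {0..T} \<Longrightarrow> norm (A \<tau> *v x) \<le> K * norm x"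
    and Y: "\<And>\<tau>. (Y has_vector_derivative A \<tau> ** Y \<tau>) (at \<tau>)" "Y 0 = mat 1"
    and simple: "simple_eigenvalue_of (Y T) (complex_of_real \<sigma>)"
    and e: "\<And>\<tau>. \<tau> \<in> {0..T} \<Longrightarrow> (e has_vector_derivative A \<tau> *v e \<tau>) (at \<tau> within {0..T})"
      "e T = \<sigma> *\<^sub>R e 0"
    and \<psi>: "continuous_on {0..T} \<psi>" "integral {0..T} (\<lambda>\<tau>. \<psi> \<tau> \<bullet> e \<tau>) = 1"
    and h: "solves_bvp T A r \<sigma> \<psi> h"
  shows "unique_bvp_solution T A r \<sigma> \<psi> h"
  unfolding unique_bvp_solution_def
proof (intro conjI h allI impI ballI)
  fix g \<tau> assume g: "solves_bvp T A r \<sigma> \<psi> g" and \<tau>: "\<tau> \<in> {0..T}"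
  have bc: "k T = \<sigma> *\<^sub>R k 0" and int: "integral {0..T} (\<lambda>\<tau>. \<psi> \<tau> \<bullet> k \<tau>) = 0"
    if "solves_bvp T A r \<sigma> \<psi> k" for k
    using that unfolding solves_bvp_def by blast+
  have der: "(k has_vector_derivative A \<tau> *v k \<tau> - r \<tau>) (at \<tau> within {0..T})"
    if k: "solves_bvp T A r \<sigma> \<psi> k" and \<tau>: "\<tau> \<in> {0..T}" for k \<tau>
  proof -
    obtain h' where h': "(k has_vector_derivative h') (at \<tau> within {0..T})" "h' - A \<tau> *v k \<tau> + r \<tau> = 0"
      using k \<tau> unfolding solves_bvp_def by blast
    from h'(2) have "h' = A \<tau> *v k \<tau> - r \<tau>"
      by (simp add: eq_neg_iff_add_eq_0 add.commute algebra_simps)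
    with h'(1) show ?thesis
      by simp
  qed
  have cont: "continuous_on {0..T} k" if "solves_bvp T A r \<sigma> \<psi> k" for k
    using has_vector_derivative_continuous[OF der[OF that]]
    by (simp add: continuous_on_eq_continuous_within)
  define d where "d \<tau> = g \<tau> - h \<tau>" for \<tau>
  have "(d has_vector_derivative (A \<tau> *v g \<tau> - r \<tau>) - (A \<tau> *v h \<tau> - r \<tau>)) (at \<tau> within {0..T})"
    if "\<tau> \<in> {0..T}" for \<tau>
    unfolding d_def by (intro has_vector_derivative_diff der g h that)
  then have "(d has_vector_derivative A \<tau> *v d \<tau>) (at \<tau> within {0..T})" if "\<tau> \<in> {0..T}" for \<tau>
    using that by (simp add: d_def matrix_vector_mult_diff_distrib)
  from linear_ode_eq_fundamental[OF this K Y]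
  have d: "d \<tau> = Y \<tau> *v d 0" if "\<tau> \<in> {0..T}" for \<tau>
    using that by blast
  from linear_ode_eq_fundamental[OF e(1) K Y]
  have eY: "e \<tau> = Y \<tau> *v e 0" if "\<tau> \<in> {0..T}" for \<tau>
    using that by blast
  have "e 0 \<noteq> 0"
  proof
    assume "e 0 = 0"
    then have "integral {0..T} (\<lambda>\<tau>. \<psi> \<tau> \<bullet> e \<tau>) = integral {0..T} (\<lambda>\<tau>. 0)"
      using eY by (intro integral_cong) (metis inner_zero_right matrix_vector_mult_0_right)
    then show False
      using \<psi>(2) by simp
  qed
  moreover have "Y T *v e 0 = \<sigma> *\<^sub>R e 0" "Y T *v d 0 = \<sigma> *\<^sub>R d 0"
    using eY[of T] d[of T] e(2) bc[OF g] bc[OF h] assms(1) by (simp_all add: d_def scaleR_diff_right)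
  ultimately obtain c where c: "d 0 = c *\<^sub>R e 0"
    using eigenvectors_of_simple_eigenvalue[OF simple] by blast
  have dc: "d \<tau> = c *\<^sub>R e \<tau>" if "\<tau> \<in> {0..T}" for \<tau>
    using d[OF that] eY[OF that] by (simp only: c matrix_vector_mult_scaleR)
  have "0 = integral {0..T} (\<lambda>\<tau>. \<psi> \<tau> \<bullet> g \<tau>) - integral {0..T} (\<lambda>\<tau>. \<psi> \<tau> \<bullet> h \<tau>)"
    using int g h by simp
  also have "\<dots> = integral {0..T} (\<lambda>\<tau>. \<psi> \<tau> \<bullet> g \<tau> - \<psi> \<tau> \<bullet> h \<tau>)"
    by (intro integral_diff[symmetric] integrable_continuous_real continuous_intros \<psi> cont g h)
  also have "\<dots> = integral {0..T} (\<lambda>\<tau>. c *\<^sub>R (\<psi> \<tau> \<bullet> e \<tau>))"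
    by (intro integral_cong) (simp add: inner_diff_right[symmetric] d_def[symmetric] dc)
  also have "\<dots> = c"
    by (simp only: integral_cmul \<psi>(2)) simp
  finally show "g \<tau> = h \<tau>"
    using dc[OF \<tau>] by (simp add: d_def)
qed

text \<open>The necessary half of the Fredholm alternative: in the derivative of the pairing of
  \<psi> and \<open>h\<close> the two terms with \<open>A\<close> cancel by adjointness, and the
  boundary values agree because \<sigma> squared is 1.\<close>

lemma solvability_condition:
  fixes A :: "real \<Rightarrow> real^'n^'n"
  assumes "T \<ge> 0"
    and \<psi>: "\<And>\<tau>. \<tau> \<in> {0..T} \<Longrightarrow> (\<psi> has_vector_derivative - (transpose (A \<tau>) *v \<psi> \<tau>)) (at \<tau> within {0..T})"
      "\<psi> T = \<sigma> *\<^sub>R \<psi> 0"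
    and h: "\<And>\<tau>. \<tau> \<in> {0..T} \<Longrightarrow> (h has_vector_derivative A \<tau> *v h \<tau> + r \<tau>) (at \<tau> within {0..T})"
      "h T = \<sigma> *\<^sub>R h 0"
    and "\<sigma> * \<sigma> = 1"
  shows "((\<lambda>\<tau>. \<psi> \<tau> \<bullet> r \<tau>) has_integral 0) {0..T}"
proof -
  have "((\<lambda>\<tau>. \<psi> \<tau> \<bullet> h \<tau>) has_vector_derivative \<psi> \<tau> \<bullet> r \<tau>) (at \<tau> within {0..T})" if "\<tau> \<in> {0..T}" for \<tau>
  proof -
    have "((\<lambda>\<tau>. \<psi> \<tau> \<bullet> h \<tau>) has_vector_derivative
        \<psi> \<tau> \<bullet> (A \<tau> *v h \<tau> + r \<tau>) + (- (transpose (A \<tau>) *v \<psi> \<tau>)) \<bullet> h \<tau>) (at \<tau> within {0..T})"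
      by (rule bounded_bilinear.has_vector_derivative[OF bounded_bilinear_inner \<psi>(1)[OF that] h(1)[OF that]])
    then show ?thesis
      by (simp add: inner_add_right dot_lmul_matrix transpose_matrix_vector)
  qed
  from fundamental_theorem_of_calculus[OF assms(1) this]
  have "((\<lambda>\<tau>. \<psi> \<tau> \<bullet> r \<tau>) has_integral \<psi> T \<bullet> h T - \<psi> 0 \<bullet> h 0) {0..T}"
    by blast
  then show ?thesis
    by (simp add: \<psi>(2) h(2) assms(6) mult.assoc[symmetric])
qed

section \<open>The invariance equation\<close>

text \<open>Along a local solution starting at \<open>z\<close> the chain rule and the flow
  hypothesis give two derivatives of the same curve. They can be compared only for t > 0, and
  continuity of the defect \<phi> brings the identity back to t = 0.\<close>

lemma invariance_equation:
  fixes U :: "'b::euclidean_space \<Rightarrow> 'a::real_normed_vector" and f :: "'b \<Rightarrow> 'b"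
  assumes S: "open S" "z \<in> S"
    and f: "\<And>z. z \<in> S \<Longrightarrow> (f has_derivative f' z) (at z)" "\<And>w. continuous_on S (\<lambda>z. f' z w)"
    and U: "\<And>z. z \<in> S \<Longrightarrow> (U has_derivative DU z) (at z)" "\<And>w. continuous_on S (\<lambda>z. DU z w)"
    and G: "continuous_on S G"
    and flow: "\<And>c a b t. (\<And>t. t \<in> {a<..<b} \<Longrightarrow> c t \<in> S \<and> (c has_vector_derivative f (c t)) (at t)) \<Longrightarrow>
      t \<in> {a<..<b} \<Longrightarrow> ((\<lambda>s. U (c s)) has_vector_derivative G (c t)) (at t)"
  shows "DU z (f z) = G z"
proof -
  obtain r where r: "r > 0" "cball z r \<subseteq> S"
    using S open_contains_cball by blast
  obtain L where L: "L \<ge> 0"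
    "\<And>x y. x \<in> cball z r \<Longrightarrow> y \<in> cball z r \<Longrightarrow> norm (f x - f y) \<le> L * norm (x - y)"
    using C1_imp_lipschitz_on_compact[OF f compact_cball convex_cball r(2)] by blast
  obtain \<epsilon> c where \<epsilon>: "\<epsilon> > 0" and contc: "continuous_on {0..\<epsilon>} c" and c0: "c 0 = z"
    and c_ball: "\<And>t. c t \<in> cball z r"
    and c: "\<And>t. t \<in> {0<..<\<epsilon>} \<Longrightarrow> (c has_vector_derivative f (c t)) (at t)"
    using picard_local_solution[OF r(1) L] by blast
  have cS: "c t \<in> S" for t
    using c_ball r(2) by blast
  define \<phi> where "\<phi> t = DU (c t) (f (c t)) - G (c t)" for t
  have "\<phi> t = 0" if t: "t \<in> {0<..<\<epsilon>}" for t
  proof -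
    have "((\<lambda>s. U (c s)) has_vector_derivative G (c t)) (at t)"
      by (rule flow[OF _ t]) (use c cS in blast)
    moreover have "((\<lambda>s. U (c s)) has_derivative (\<lambda>h. DU (c t) (h *\<^sub>R f (c t)))) (at t)"
      by (rule has_derivative_compose[OF c[OF t, unfolded has_vector_derivative_def] U(1)[OF cS]])
    then have "((\<lambda>s. U (c s)) has_vector_derivative DU (c t) (f (c t))) (at t)"
      using linear_scale[OF has_derivative_linear[OF U(1)[OF cS[of t]]]]
      by (simp add: has_vector_derivative_def)
    ultimately show ?thesis
      unfolding \<phi>_def using vector_derivative_unique_at by fastforce
  qed
  moreover have "continuous_on {0..\<epsilon>} \<phi>"
  proof -
    have "continuous_on S f"
      using f(1) by (intro continuous_at_imp_continuous_on) (blast intro: has_derivative_continuous)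
    \<comment> \<open>The derivative of \<open>U\<close> is continuous only for fixed directions,
      while here the direction f(z) moves with z; hence the expansion in basis vectors.\<close>
    then have "continuous_on S (\<lambda>z. (\<Sum>b\<in>Basis. (f z \<bullet> b) *\<^sub>R DU z b) - G z)"
      by (intro continuous_intros U G)
    moreover have "(\<Sum>b\<in>Basis. (f z \<bullet> b) *\<^sub>R DU z b) = DU z (f z)" if "z \<in> S" for z
    proof -
      have lin: "linear (DU z)"
        using has_derivative_linear[OF U(1)[OF that]] .
      have "DU z (\<Sum>b\<in>Basis. (f z \<bullet> b) *\<^sub>R b) = (\<Sum>b\<in>Basis. (f z \<bullet> b) *\<^sub>R DU z b)"
        by (simp only: linear_sum[OF lin] linear_scale[OF lin])
      then show ?thesis
        by (simp add: euclidean_representation)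
    qed
    ultimately have "continuous_on S (\<lambda>z. DU z (f z) - G z)"
      by (simp cong: continuous_on_cong)
    then show ?thesis
      unfolding \<phi>_def by (rule continuous_on_compose2[OF _ contc]) (use cS in blast)
  qed
  ultimately have "\<phi> 0 = 0"
    using continuous_constant_on_closure[of "{0<..<\<epsilon>}" \<phi> 0 0] \<epsilon>
    by (simp add: closure_greaterThanLessThan)
  then show ?thesis
    by (simp add: \<phi>_def c0)
qed

lemma unif_O_integral:
  fixes g :: "real \<Rightarrow> real \<Rightarrow> 'a::banach"
  assumes "unif_O n {0..T} g" "\<forall>\<^sub>F \<xi> in nhds 0. continuous_on {0..T} (\<lambda>\<tau>. g \<tau> \<xi>)"
  shows "unif_O n {0..T} (\<lambda>s \<xi>. integral {0..s} (\<lambda>\<tau>. g \<tau> \<xi>))"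
proof -
  obtain K where "\<forall>\<^sub>F \<xi> in nhds 0. \<forall>\<tau>\<in>{0..T}. norm (g \<tau> \<xi>) \<le> K * \<bar>\<xi>\<bar> ^ n"
    using assms(1) unfolding unif_O_def by blast
  with assms(2)
  have "\<forall>\<^sub>F \<xi> in nhds 0. \<forall>s\<in>{0..T}. norm (integral {0..s} (\<lambda>\<tau>. g \<tau> \<xi>)) \<le> (\<bar>K\<bar> * T) * \<bar>\<xi>\<bar> ^ n"
  proof eventually_elim
    case (elim \<xi>)
    show ?case
    proof
      fix s assume s: "s \<in> {0..T}"
      have K: "K * \<bar>\<xi>\<bar> ^ n \<le> \<bar>K\<bar> * \<bar>\<xi>\<bar> ^ n"
        by (intro mult_right_mono) auto
      have "norm (integral {0..s} (\<lambda>\<tau>. g \<tau> \<xi>)) \<le> (\<bar>K\<bar> * \<bar>\<xi>\<bar> ^ n) * (s - 0)"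
      proof (rule integral_bound)
        show "continuous_on {0..s} (\<lambda>\<tau>. g \<tau> \<xi>)"
          using elim(1) s by (auto intro: continuous_on_subset)
        show "norm (g \<tau> \<xi>) \<le> \<bar>K\<bar> * \<bar>\<xi>\<bar> ^ n" if "\<tau> \<in> {0..s}" for \<tau>
          using elim(2) that s K by (meson atLeastAtMost_iff order_trans)
      qed (use s in auto)
      also have "\<dots> \<le> (\<bar>K\<bar> * \<bar>\<xi>\<bar> ^ n) * T"
        using s by (intro mult_left_mono) auto
      finally show "norm (integral {0..s} (\<lambda>\<tau>. g \<tau> \<xi>)) \<le> (\<bar>K\<bar> * T) * \<bar>\<xi>\<bar> ^ n"
        by (simp add: ac_simps)
    qed
  qed
  then show ?thesis
    unfolding unif_O_def by blast
qed

lemma unif_O_scaleR_bounded: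
  assumes "unif_O n S p" "\<forall>\<^sub>F \<xi> in nhds 0. \<forall>\<tau>\<in>S. norm (g \<tau> \<xi>) \<le> M" "M \<ge> 0"
  shows "unif_O n S (\<lambda>\<tau> \<xi>. p \<tau> \<xi> *\<^sub>R g \<tau> \<xi>)"
proof (rule unif_O_mult_bounded[OF assms(1) _ assms(3)])
  from assms(2) show "\<forall>\<^sub>F \<xi> in nhds 0. \<forall>\<tau>\<in>S. norm (p \<tau> \<xi> *\<^sub>R g \<tau> \<xi>) \<le> M * norm (p \<tau> \<xi>)"
    by eventually_elim (auto simp: mult.commute[of M] intro: mult_left_mono)
qed

text \<open>Only small \<xi> matter, so the open strip may be shrunk to the closed one of half its
  width, which is compact.\<close>

lemma compact_strip_bounded:
  fixes g :: "'s::topological_space \<Rightarrow> real \<Rightarrow> 'a::real_normed_vector"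
  assumes "compact S" "continuous_on (S \<times> {-\<delta><..<\<delta>}) (\<lambda>(\<tau>, \<xi>). g \<tau> \<xi>)" "\<delta> > 0"
  obtains M where "M \<ge> 0" "\<forall>\<^sub>F \<xi> in nhds 0. \<forall>\<tau>\<in>S. norm (g \<tau> \<xi>) \<le> M"
proof -
  have "continuous_on (S \<times> {-\<delta>/2..\<delta>/2}) (\<lambda>(\<tau>, \<xi>). g \<tau> \<xi>)"
    by (rule continuous_on_subset[OF assms(2)]) (use assms(3) in auto)
  then have "bounded ((\<lambda>(\<tau>, \<xi>). g \<tau> \<xi>) ` (S \<times> {-\<delta>/2..\<delta>/2}))"
    using assms(1) by (intro compact_imp_bounded compact_continuous_image compact_Times) auto
  then obtain M where M: "\<forall>y\<in>(\<lambda>(\<tau>, \<xi>). g \<tau> \<xi>) ` (S \<times> {-\<delta>/2..\<delta>/2}). norm y \<le> M"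
    unfolding bounded_iff by blast
  have "norm (g \<tau> \<xi>) \<le> \<bar>M\<bar>" if "\<tau> \<in> S" "\<bar>\<xi>\<bar> < \<delta>/2" for \<tau> \<xi>
  proof -
    have "(\<tau>, \<xi>) \<in> S \<times> {-\<delta>/2..\<delta>/2}"
      using that by auto
    from M[rule_format, OF imageI[OF this]] show ?thesis
      by simp
  qed
  then have "\<forall>\<^sub>F \<xi> in nhds 0. \<forall>\<tau>\<in>S. norm (g \<tau> \<xi>) \<le> \<bar>M\<bar>"
    by (intro eventually_mono[OF eventually_abs_less_nhds_0[of "\<delta>/2"]]) (use assms(3) in auto)
  then show ?thesis
    using that[of "\<bar>M\<bar>"] by simp
qed

text \<open>Replacing \<open>u\<close> by its Taylor polynomial changes \<open>f\<close> by at most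
  a Lipschitz constant times the remainder, which keeps order 6.\<close>

lemma perturbed_composition_expansion:
  fixes f :: "'a::euclidean_space \<Rightarrow> 'a" and c :: "nat \<Rightarrow> 's::t2_space \<Rightarrow> 'a"
  assumes f: "Ck_on 6 UNIV f" and S: "compact S" and c: "\<And>i. continuous_on S (c i)"
    and u: "unif_O 6 S (\<lambda>\<tau> \<xi>. u \<tau> \<xi> - (\<Sum>i<6. \<xi> ^ i *\<^sub>R c i \<tau>))"
  shows "unif_O 6 S (\<lambda>\<tau> \<xi>. f (u \<tau> \<xi>) - (\<Sum>k<6. \<xi> ^ k *\<^sub>R comp_coeff f (\<lambda>i. c i \<tau>) k (c 0 \<tau>)))"
proof -
  define w where "w \<tau> \<xi> = (\<Sum>i<6. \<xi> ^ i *\<^sub>R c i \<tau>)" for \<tau> \<xi>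
  have "\<exists>M. \<forall>\<tau>\<in>S. norm (c i \<tau>) \<le> M" for i
    using compact_imp_bounded[OF compact_continuous_image[OF c S]] by (auto simp: bounded_iff)
  then obtain M where M: "\<And>i \<tau>. \<tau> \<in> S \<Longrightarrow> norm (c i \<tau>) \<le> M i"
    by metis
  obtain K where K: "\<forall>\<^sub>F \<xi> in nhds 0. \<forall>\<tau>\<in>S. norm (u \<tau> \<xi> - w \<tau> \<xi>) \<le> K * \<bar>\<xi>\<bar> ^ 6"
    using u unfolding unif_O_def w_def by blast
  \<comment> \<open>For |\<xi>| < 1 the sum bounds the polynomial and |K| bounds the remainder, so
    both arguments of \<open>f\<close> lie in the ball of radius \<rho>.\<close>
  define \<rho> where "\<rho> = (\<Sum>i<6. \<bar>M i\<bar>) + \<bar>K\<bar>"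
  have f1: "(f has_derivative (\<lambda>w. deriv_form f [w] x)) (at x)" for x
    using deriv_form_has_derivative[OF f, of "[]"] by simp
  have f2: "continuous_on UNIV (\<lambda>x. deriv_form f [w] x)" for w
    by (rule deriv_form_continuous_on[OF f]) simp
  obtain L where L: "L \<ge> 0"
    "\<And>x y. x \<in> cball 0 \<rho> \<Longrightarrow> y \<in> cball 0 \<rho> \<Longrightarrow> norm (f x - f y) \<le> L * norm (x - y)"
    using C1_imp_lipschitz_on_compact[OF f1 f2 compact_cball convex_cball subset_UNIV] by blast
  have "\<forall>\<^sub>F \<xi> in nhds 0. \<forall>\<tau>\<in>S. norm (f (u \<tau> \<xi>) - f (w \<tau> \<xi>)) \<le> L * norm (u \<tau> \<xi> - w \<tau> \<xi>)"
    using K eventually_abs_less_nhds_0[OF zero_less_one]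
  proof eventually_elim
    case (elim \<xi>)
    show ?case
    proof
      fix \<tau> assume \<tau>: "\<tau> \<in> S"
      have w: "norm (w \<tau> \<xi>) \<le> (\<Sum>i<6. \<bar>M i\<bar>)"
        unfolding w_def
      proof (rule order_trans[OF norm_sum sum_mono])
        fix i :: nat
        have "\<bar>\<xi>\<bar> ^ i * norm (c i \<tau>) \<le> 1 * \<bar>M i\<bar>"
          using elim(2) M[OF \<tau>, of i] by (intro mult_mono power_le_one) auto
        then show "norm (\<xi> ^ i *\<^sub>R c i \<tau>) \<le> \<bar>M i\<bar>"
          by (simp add: power_abs)
      qed
      have "norm (u \<tau> \<xi> - w \<tau> \<xi>) \<le> K * \<bar>\<xi>\<bar> ^ 6"
        using elim(1) \<tau> by blast
      also have "\<dots> \<le> \<bar>K\<bar> * 1"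
        using elim(2) by (intro mult_mono power_le_one) auto
      finally have "norm (u \<tau> \<xi>) \<le> \<rho>"
        unfolding \<rho>_def using w norm_triangle_ineq2[of "u \<tau> \<xi>" "w \<tau> \<xi>"] by linarith
      moreover have "norm (w \<tau> \<xi>) \<le> \<rho>"
        unfolding \<rho>_def using w by linarith
      ultimately show "norm (f (u \<tau> \<xi>) - f (w \<tau> \<xi>)) \<le> L * norm (u \<tau> \<xi> - w \<tau> \<xi>)"
        by (intro L) auto
    qed
  qed
  then have 1: "unif_O 6 S (\<lambda>\<tau> \<xi>. f (u \<tau> \<xi>) - f (w \<tau> \<xi>))"
    by (rule unif_O_mult_bounded[OF u[folded w_def] _ L(1)])
  have "w \<tau> \<xi> = c 0 \<tau> + (\<Sum>i=1..5. \<xi> ^ i *\<^sub>R c i \<tau>)" for \<tau> \<xi>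
    by (simp add: w_def eval_nat_numeral sum.atLeast_Suc_atMost)
  then have 2: "unif_O 6 S (\<lambda>\<tau> \<xi>. f (w \<tau> \<xi>)
      - (\<Sum>k<6. \<xi> ^ k *\<^sub>R comp_coeff f (\<lambda>i. c i \<tau>) k (c 0 \<tau>)))"
    using composition_expansion[OF f S c[of 0] c] by simp
  from unif_O_add[OF 1 2] show ?thesis
    by simp
qed

lemma normal_form_cauchy_product:
  fixes d :: "nat \<Rightarrow> 'a::real_vector"
  shows "(1 + \<alpha>1 * \<xi>^2 + \<alpha>2 * \<xi>^4) *\<^sub>R (\<Sum>i<6. \<xi> ^ i *\<^sub>R d i)
    = (\<Sum>k<6. \<xi> ^ k *\<^sub>R (d k + (if 2 \<le> k then \<alpha>1 *\<^sub>R d (k - 2) else 0)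
        + (if 4 \<le> k then \<alpha>2 *\<^sub>R d (k - 4) else 0)))
      + \<xi> ^ 6 *\<^sub>R (\<alpha>1 *\<^sub>R d 4 + \<alpha>2 *\<^sub>R d 2) + \<xi> ^ 7 *\<^sub>R (\<alpha>1 *\<^sub>R d 5 + \<alpha>2 *\<^sub>R d 3)
      + \<xi> ^ 8 *\<^sub>R \<alpha>2 *\<^sub>R d 4 + \<xi> ^ 9 *\<^sub>R \<alpha>2 *\<^sub>R d 5"
proof -
  have s: "(\<Sum>i<6. g i) = g 0 + g 1 + g 2 + g 3 + g 4 + g 5" for g :: "nat \<Rightarrow> 'a"
    by (simp add: eval_nat_numeral)
  show ?thesis
    unfolding s by (simp add: eval_nat_numeral algebra_simps)
qed

text \<open>The invariance equation is integrated over \<open>\<tau>\<close> before the coefficients of \<open>\<xi>\<^sup>k\<close> are compared,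
  so that no expansion of the \<open>\<tau>\<close>-derivative of \<open>u\<close> is needed.\<close>
lemma integrated_coefficient_equations:
  fixes F :: "'a::euclidean_space \<Rightarrow> 'a" and c :: "nat \<Rightarrow> real \<Rightarrow> 'a" and u ut ux :: "real \<Rightarrow> real \<Rightarrow> 'a"
  assumes F: "Ck_on 6 UNIV F" and \<delta>: "\<delta> > 0" and c: "\<And>i. continuous_on {0..T} (c i)"
    and u: "unif_O 6 {0..T} (\<lambda>\<tau> \<xi>. u \<tau> \<xi> - (\<Sum>i<6. \<xi> ^ i *\<^sub>R c i \<tau>))"
    and ut: "\<And>\<tau> \<xi>. \<tau> \<in> {0..T} \<Longrightarrow> \<bar>\<xi>\<bar> < \<delta> \<Longrightarrow>
      ((\<lambda>\<tau>. u \<tau> \<xi>) has_vector_derivative ut \<tau> \<xi>) (at \<tau> within {0..T})"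
    and cont: "continuous_on ({0..T} \<times> {-\<delta><..<\<delta>}) (\<lambda>(\<tau>, \<xi>). ut \<tau> \<xi>)"
      "continuous_on ({0..T} \<times> {-\<delta><..<\<delta>}) (\<lambda>(\<tau>, \<xi>). ux \<tau> \<xi>)"
    and ux0: "\<And>\<tau>. \<tau> \<in> {0..T} \<Longrightarrow> ux \<tau> 0 = c 1 \<tau>"
    and pq: "unif_O 6 {0..T} p" "unif_O 6 {0..T} q"
    and inv: "\<And>\<tau> \<xi>. \<tau> \<in> {0..T} \<Longrightarrow> \<bar>\<xi>\<bar> < \<delta> \<Longrightarrow>
      (1 + \<alpha>1 * \<xi>^2 + \<alpha>2 * \<xi>^4 + p \<tau> \<xi>) *\<^sub>R ut \<tau> \<xi> + (e * \<xi>^5 + q \<tau> \<xi>) *\<^sub>R ux \<tau> \<xi> = F (u \<tau> \<xi>)"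
    and s: "s \<in> {0..T}" and k: "k \<le> 5"
  defines "f \<equiv> \<lambda>k \<tau>. comp_coeff F (\<lambda>i. c i \<tau>) k (c 0 \<tau>)"
    and "d \<equiv> \<lambda>k. c k s - c k 0"
  shows "d k + (if 2 \<le> k then \<alpha>1 *\<^sub>R d (k - 2) else 0) + (if 4 \<le> k then \<alpha>2 *\<^sub>R d (k - 4) else 0)
    = integral {0..s} (\<lambda>\<tau>. f k \<tau> - (if k = 5 then e *\<^sub>R c 1 \<tau> else 0))"
proof -
  define P where "P \<xi> = 1 + \<alpha>1 * \<xi>^2 + \<alpha>2 * \<xi>^4" for \<xi>
  define R where "R \<tau> \<xi> = u \<tau> \<xi> - (\<Sum>i<6. \<xi> ^ i *\<^sub>R c i \<tau>)" for \<tau> \<xi>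
  define RF where "RF \<tau> \<xi> = F (u \<tau> \<xi>) - (\<Sum>k<6. \<xi> ^ k *\<^sub>R f k \<tau>)" for \<tau> \<xi>
  define N where "N \<tau> \<xi> = p \<tau> \<xi> *\<^sub>R ut \<tau> \<xi> + q \<tau> \<xi> *\<^sub>R ux \<tau> \<xi>" for \<tau> \<xi>
  define I where "I \<xi> = integral {0..s} (\<lambda>\<tau>. ux \<tau> \<xi>)" for \<xi>
  \<comment> \<open>The coefficient of \<xi>^k in the integrated equation, with everything moved to
    one side. The integral of \<open>ux\<close> is frozen at \<xi> = 0; its variation
    \<open>I \<xi> - I 0\<close> is treated as an error.\<close>
  define a where "a k = d k + (if 2 \<le> k then \<alpha>1 *\<^sub>R d (k - 2) else 0)
    + (if 4 \<le> k then \<alpha>2 *\<^sub>R d (k - 4) else 0)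
    - integral {0..s} (f k) + (if k = 5 then e *\<^sub>R I 0 else 0)" for k
  have sT: "{0..s} \<subseteq> {0..T}"
    using s by auto
  have contf: "continuous_on {0..T} (f k)" for k
    unfolding f_def by (rule comp_coeff_continuous_on[OF F c c])
  have cont_slice: "continuous_on {0..T} (\<lambda>\<tau>. g \<tau> \<xi>)"
    if "continuous_on ({0..T} \<times> {-\<delta><..<\<delta>}) (\<lambda>(\<tau>, \<xi>). g \<tau> \<xi>)" "\<bar>\<xi>\<bar> < \<delta>"
    for g :: "real \<Rightarrow> real \<Rightarrow> 'a" and \<xi>
  proof -
    have "continuous_on {0..T} (\<lambda>\<tau>. (\<tau>, \<xi>))"
      by (intro continuous_intros)
    from continuous_on_compose2[OF that(1) this] that(2) show ?thesis
      by (simp add: image_subset_iff abs_less_iff)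
  qed
  have contu: "continuous_on {0..T} (\<lambda>\<tau>. u \<tau> \<xi>)" if "\<bar>\<xi>\<bar> < \<delta>" for \<xi>
    using has_vector_derivative_continuous[OF ut[OF _ that]]
    by (simp add: continuous_on_eq_continuous_within)
  have contFu: "continuous_on {0..T} (\<lambda>\<tau>. F (u \<tau> \<xi>))" if "\<bar>\<xi>\<bar> < \<delta>" for \<xi>
    using continuous_on_compose2[OF Ck_on_imp_continuous_on[OF F] contu[OF that]] by simp
  \<comment> \<open>Here \<open>p\<close> and \<open>q\<close> carry only size bounds. Continuity of
    \<open>N\<close> in \<tau>, and with it integrability, is read off from the invariance equation
    solved for \<open>N\<close>.\<close>
  have N_eq: "N \<tau> \<xi> = F (u \<tau> \<xi>) - P \<xi> *\<^sub>R ut \<tau> \<xi> - (e * \<xi>^5) *\<^sub>R ux \<tau> \<xi>"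
    if "\<tau> \<in> {0..T}" "\<bar>\<xi>\<bar> < \<delta>" for \<tau> \<xi>
    unfolding inv[OF that, symmetric] by (simp add: N_def P_def algebra_simps)
  have ev: "\<forall>\<^sub>F \<xi> in nhds 0. \<bar>\<xi>\<bar> < \<delta>"
    by (rule eventually_abs_less_nhds_0[OF \<delta>])
  have ON: "unif_O 6 {0..T} (\<lambda>s \<xi>. integral {0..s} (\<lambda>\<tau>. N \<tau> \<xi>))"
  proof (rule unif_O_integral)
    obtain M1 where M1: "M1 \<ge> 0" "\<forall>\<^sub>F \<xi> in nhds 0. \<forall>\<tau>\<in>{0..T}. norm (ut \<tau> \<xi>) \<le> M1"
      by (rule compact_strip_bounded[OF compact_Icc cont(1) \<delta>])
    obtain M2 where M2: "M2 \<ge> 0" "\<forall>\<^sub>F \<xi> in nhds 0. \<forall>\<tau>\<in>{0..T}. norm (ux \<tau> \<xi>) \<le> M2"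
      by (rule compact_strip_bounded[OF compact_Icc cont(2) \<delta>])
    show "unif_O 6 {0..T} N"
      unfolding N_def by (intro unif_O_add unif_O_scaleR_bounded[OF pq(1) M1(2,1)]
          unif_O_scaleR_bounded[OF pq(2) M2(2,1)])
    show "\<forall>\<^sub>F \<xi> in nhds 0. continuous_on {0..T} (\<lambda>\<tau>. N \<tau> \<xi>)"
      using ev
    proof eventually_elim
      case (elim \<xi>)
      have "continuous_on {0..T} (\<lambda>\<tau>. F (u \<tau> \<xi>) - P \<xi> *\<^sub>R ut \<tau> \<xi> - (e * \<xi>^5) *\<^sub>R ux \<tau> \<xi>)"
        using elim by (intro continuous_intros contFu cont_slice[OF cont(1)] cont_slice[OF cont(2)])
      then show ?case
        by (rule continuous_on_eq) (simp add: N_eq elim)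
    qed
  qed
  have ORF: "unif_O 6 {0..T} (\<lambda>s \<xi>. integral {0..s} (\<lambda>\<tau>. RF \<tau> \<xi>))"
  proof (rule unif_O_integral)
    show "unif_O 6 {0..T} RF"
      unfolding RF_def f_def by (rule perturbed_composition_expansion[OF F compact_Icc c u])
    show "\<forall>\<^sub>F \<xi> in nhds 0. continuous_on {0..T} (\<lambda>\<tau>. RF \<tau> \<xi>)"
      using ev by eventually_elim (unfold RF_def, intro continuous_intros contFu contf)
  qed
  have Oc: "unif_O 6 {0..T} (\<lambda>s \<xi>. \<xi> ^ m *\<^sub>R y)" if "6 \<le> m" for m and y :: 'a
    by (rule unif_O_power[OF _ that]) (simp add: image_constant_conv)
  \<comment> \<open>Integrating \<open>ut\<close> leaves only the values of \<open>u\<close> at the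
    two ends of the interval, so the expansion remainder of \<open>u\<close> enters only as a
    difference of endpoint values.\<close>
  have OR: "unif_O 6 {0..T} (\<lambda>\<tau> \<xi>. P \<xi> *\<^sub>R (R \<tau> \<xi> - R 0 \<xi>))"
  proof (rule unif_O_mult_bounded)
    show "unif_O 6 {0..T} (\<lambda>\<tau> \<xi>. R \<tau> \<xi> - R 0 \<xi>)"
    proof (rule unif_O_diff)
      show R: "unif_O 6 {0..T} R"
        using u unfolding R_def .
      have "0 \<in> {0..T}"
        using s by auto
      with R show "unif_O 6 {0..T} (\<lambda>\<tau>. R 0)"
        by (rule unif_O_at)
    qed
    have "norm (P \<xi> *\<^sub>R y) \<le> (1 + \<bar>\<alpha>1\<bar> + \<bar>\<alpha>2\<bar>) * norm y" if "\<bar>\<xi>\<bar> < 1" for \<xi> and y :: 'a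
    proof -
      have "\<bar>\<xi> ^ n\<bar> \<le> 1" for n
        using that by (simp add: power_abs power_le_one)
      then have "\<bar>\<alpha> * \<xi> ^ n\<bar> \<le> \<bar>\<alpha>\<bar>" for \<alpha> n
        using mult_left_mono[of "\<bar>\<xi> ^ n\<bar>" 1 "\<bar>\<alpha>\<bar>"] by (simp add: abs_mult)
      from this[of \<alpha>1 2] this[of \<alpha>2 4] have "\<bar>P \<xi>\<bar> \<le> 1 + \<bar>\<alpha>1\<bar> + \<bar>\<alpha>2\<bar>"
        unfolding P_def by linarith
      then show ?thesis
        by (simp add: mult_right_mono)
    qed
    then show "\<forall>\<^sub>F \<xi> in nhds 0. \<forall>\<tau>\<in>{0..T}. norm (P \<xi> *\<^sub>R (R \<tau> \<xi> - R 0 \<xi>))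
        \<le> (1 + \<bar>\<alpha>1\<bar> + \<bar>\<alpha>2\<bar>) * norm (R \<tau> \<xi> - R 0 \<xi>)"
      by (intro eventually_mono[OF eventually_abs_less_nhds_0[of 1]]) auto
  qed simp
  define tl where "tl \<xi> = \<xi> ^ 6 *\<^sub>R (\<alpha>1 *\<^sub>R d 4 + \<alpha>2 *\<^sub>R d 2) + \<xi> ^ 7 *\<^sub>R (\<alpha>1 *\<^sub>R d 5 + \<alpha>2 *\<^sub>R d 3)
    + \<xi> ^ 8 *\<^sub>R \<alpha>2 *\<^sub>R d 4 + \<xi> ^ 9 *\<^sub>R \<alpha>2 *\<^sub>R d 5" for \<xi>
  define rest where "rest s' \<xi> = integral {0..s'} (\<lambda>\<tau>. RF \<tau> \<xi>) - integral {0..s'} (\<lambda>\<tau>. N \<tau> \<xi>)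
    - P \<xi> *\<^sub>R (R s' \<xi> - R 0 \<xi>) - tl \<xi>" for s' \<xi>
  have rest: "unif_O 6 {0..T} rest"
    unfolding rest_def tl_def by (intro unif_O_diff unif_O_add ORF ON OR Oc) auto
  \<comment> \<open>Everything beyond degree 5 sits in \<open>rest\<close>, including the monomials
    of degree 6 to 9 of the product in \<open>tl\<close>. The last term is \<xi>^5 times a quantity
    that merely tends to 0, which still suffices to identify the coefficient at k = 5.\<close>
  have key: "(\<Sum>k<6. \<xi> ^ k *\<^sub>R a k) = rest s \<xi> - (e * \<xi>^5) *\<^sub>R (I \<xi> - I 0)" if \<xi>: "\<bar>\<xi>\<bar> < \<delta>" for \<xi>
  proof -
    have int: "g integrable_on {0..s}" if "continuous_on {0..T} g" for g :: "real \<Rightarrow> 'a"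
      using continuous_on_subset[OF that sT] by (rule integrable_continuous_real)
    have "(ut' has_integral u s \<xi> - u 0 \<xi>) {0..s}" if "ut' = (\<lambda>\<tau>. ut \<tau> \<xi>)" for ut'
      unfolding that
      using s by (intro fundamental_theorem_of_calculus has_vector_derivative_within_subset[OF ut[OF _ \<xi>] sT]) auto
    then have iut: "integral {0..s} (\<lambda>\<tau>. ut \<tau> \<xi>) = u s \<xi> - u 0 \<xi>"
      by (simp add: integral_unique)
    have "integral {0..s} (\<lambda>\<tau>. N \<tau> \<xi>)
        = integral {0..s} (\<lambda>\<tau>. F (u \<tau> \<xi>) - P \<xi> *\<^sub>R ut \<tau> \<xi> - (e * \<xi>^5) *\<^sub>R ux \<tau> \<xi>)"
      using sT by (intro integral_cong N_eq \<xi>) auto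
    also have "\<dots> = integral {0..s} (\<lambda>\<tau>. F (u \<tau> \<xi>)) - P \<xi> *\<^sub>R (u s \<xi> - u 0 \<xi>) - (e * \<xi>^5) *\<^sub>R I \<xi>"
      unfolding I_def iut[symmetric] integral_cmul[symmetric]
      by (subst integral_diff integral_diff, (intro int continuous_intros contFu cont_slice[OF cont(1)]
            cont_slice[OF cont(2)] \<xi>)+)+ simp
    finally have iN: "integral {0..s} (\<lambda>\<tau>. N \<tau> \<xi>) = \<dots>" .
    have "integral {0..s} (\<lambda>\<tau>. RF \<tau> \<xi>) = integral {0..s} (\<lambda>\<tau>. F (u \<tau> \<xi>))
        - integral {0..s} (\<lambda>\<tau>. \<Sum>k<6. \<xi> ^ k *\<^sub>R f k \<tau>)"
      unfolding RF_def by (intro integral_diff int continuous_intros contFu contf \<xi>)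
    also have "integral {0..s} (\<lambda>\<tau>. \<Sum>k<6. \<xi> ^ k *\<^sub>R f k \<tau>) = (\<Sum>k<6. \<xi> ^ k *\<^sub>R integral {0..s} (f k))"
      unfolding integral_cmul[symmetric] by (intro integral_sum int continuous_intros contf) auto
    finally have iRF: "integral {0..s} (\<lambda>\<tau>. RF \<tau> \<xi>) = integral {0..s} (\<lambda>\<tau>. F (u \<tau> \<xi>))
        - (\<Sum>k<6. \<xi> ^ k *\<^sub>R integral {0..s} (f k))" .
    have "(\<Sum>i<6. \<xi> ^ i *\<^sub>R d i) = (u s \<xi> - u 0 \<xi>) - (R s \<xi> - R 0 \<xi>)"
      by (simp add: R_def d_def scaleR_diff_right sum_subtractf)
    then have iR: "P \<xi> *\<^sub>R (\<Sum>i<6. \<xi> ^ i *\<^sub>R d i)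
        = P \<xi> *\<^sub>R (u s \<xi> - u 0 \<xi>) - P \<xi> *\<^sub>R (R s \<xi> - R 0 \<xi>)"
      by (simp add: scaleR_diff_right)
    define M where "M = (\<Sum>k<6. \<xi> ^ k *\<^sub>R (d k + (if 2 \<le> k then \<alpha>1 *\<^sub>R d (k - 2) else 0)
        + (if 4 \<le> k then \<alpha>2 *\<^sub>R d (k - 4) else 0)))"
    have "P \<xi> *\<^sub>R (\<Sum>i<6. \<xi> ^ i *\<^sub>R d i) = M + tl \<xi>"
      unfolding P_def M_def tl_def normal_form_cauchy_product by (simp only: add.assoc)
    then have M: "M = P \<xi> *\<^sub>R (u s \<xi> - u 0 \<xi>) - P \<xi> *\<^sub>R (R s \<xi> - R 0 \<xi>) - tl \<xi>"
      unfolding iR by (simp add: eq_diff_eq)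
    have "(\<Sum>k<6. \<xi> ^ k *\<^sub>R a k) = M - (\<Sum>k<6. \<xi> ^ k *\<^sub>R integral {0..s} (f k))
        + (\<Sum>k<6. \<xi> ^ k *\<^sub>R (if k = 5 then e *\<^sub>R I 0 else 0))"
      by (simp only: a_def M_def scaleR_right_distrib scaleR_diff_right sum.distrib sum_subtractf)
    also have "(\<Sum>k<6. \<xi> ^ k *\<^sub>R (if k = 5 then e *\<^sub>R I 0 else 0)) = (e * \<xi>^5) *\<^sub>R I 0"
      by (simp add: if_distrib[of "\<lambda>x. _ *\<^sub>R x"] mult.commute cong: if_cong)
    finally show ?thesis
      unfolding M rest_def iN iRF by (simp add: scaleR_diff_right)
  qed
  have I: "(I \<longlongrightarrow> I 0) (at_right 0)"
  proof -
    have "continuous_on ({-\<delta><..<\<delta>} \<times> cbox 0 s) (\<lambda>z. (snd z, fst z))"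
      by (intro continuous_intros)
    from continuous_on_compose2[OF cont(2) this]
    have "continuous_on ({-\<delta><..<\<delta>} \<times> cbox 0 s) (\<lambda>(\<xi>, \<tau>). ux \<tau> \<xi>)"
      using s by (simp add: case_prod_unfold image_subset_iff mem_Times_iff)
    then have "continuous_on {-\<delta><..<\<delta>} I"
      unfolding I_def cbox_interval[symmetric] by (rule integral_continuous_on_param)
    then have "isCont I 0"
      using \<delta> by (simp add: continuous_on_eq_continuous_at)
    then show ?thesis
      by (simp add: isCont_def filterlim_at_split)
  qed
  have six: "Suc 5 = (6::nat)"
    by simp
  have "((\<lambda>\<xi>. inverse (\<xi> ^ 5) *\<^sub>R rest s \<xi> - e *\<^sub>R (I \<xi> - I 0)) \<longlongrightarrow> 0 - e *\<^sub>R (I 0 - I 0)) (at_right 0)"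
    using unif_O_imp_tendsto_0[of 5 "{0..T}" rest s] rest s
    by (intro tendsto_intros I) simp
  then have "((\<lambda>\<xi>. inverse (\<xi> ^ 5) *\<^sub>R (\<Sum>k<Suc 5. \<xi> ^ k *\<^sub>R a k)) \<longlongrightarrow> 0) (at_right 0)"
  proof (rule Lim_transform_eventually[THEN tendsto_eq_rhs])
    show "\<forall>\<^sub>F \<xi> in at_right 0. inverse (\<xi> ^ 5) *\<^sub>R rest s \<xi> - e *\<^sub>R (I \<xi> - I 0)
        = inverse (\<xi> ^ 5) *\<^sub>R (\<Sum>k<Suc 5. \<xi> ^ k *\<^sub>R a k)"
      using filter_leD[OF at_within_le_nhds ev] eventually_at_right_less
    proof eventually_elim
      case (elim \<xi>)
      have "(\<Sum>k<Suc 5. \<xi> ^ k *\<^sub>R a k) = rest s \<xi> - (e * \<xi>^5) *\<^sub>R (I \<xi> - I 0)"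
        unfolding six by (rule key[OF elim(1)])
      moreover have "inverse (\<xi> ^ 5) * (e * \<xi>^5) = e"
        using elim(2) by simp
      ultimately show ?case
        by (simp only: scaleR_diff_right scaleR_scaleR)
    qed
  qed simp
  from polynomial_coeffs_zero[OF this k] have "a k = 0" .
  moreover have "x = y - z" if "x - y + z = 0" for x y z :: 'a
    using that by (simp add: algebra_simps)
  moreover have "integral {0..s} (\<lambda>\<tau>. f k \<tau> - (if k = 5 then e *\<^sub>R c 1 \<tau> else 0))
      = integral {0..s} (f k) - (if k = 5 then e *\<^sub>R I 0 else 0)"
  proof (cases "k = 5")
    case True
    have "I 0 = integral {0..s} (c 1)"
      unfolding I_def using s by (intro integral_cong ux0) auto
    then show ?thesis
      using True continuous_on_subset[OF contf sT] continuous_on_subset[OF c sT]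
      by (simp add: integral_diff integrable_continuous_real integral_cmul[symmetric] continuous_intros
          del: integral_cmul)
  qed simp
  ultimately show ?thesis
    unfolding a_def by metis
qed

text \<open>The fundamental theorem of calculus turns the integral equation into a derivative. It
  yields differentiability of the combination of coefficients as a whole; single coefficients are
  extracted afterwards by subtracting lower ones.\<close>

lemma coefficient_equations:
  fixes F :: "'a::euclidean_space \<Rightarrow> 'a" and c :: "nat \<Rightarrow> real \<Rightarrow> 'a" and u ut ux :: "real \<Rightarrow> real \<Rightarrow> 'a"
  assumes F: "Ck_on 6 UNIV F" and \<delta>: "\<delta> > 0" and c: "\<And>i. continuous_on {0..T} (c i)"
    and u: "unif_O 6 {0..T} (\<lambda>\<tau> \<xi>. u \<tau> \<xi> - (\<Sum>i<6. \<xi> ^ i *\<^sub>R c i \<tau>))"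
    and ut: "\<And>\<tau> \<xi>. \<tau> \<in> {0..T} \<Longrightarrow> \<bar>\<xi>\<bar> < \<delta> \<Longrightarrow>
      ((\<lambda>\<tau>. u \<tau> \<xi>) has_vector_derivative ut \<tau> \<xi>) (at \<tau> within {0..T})"
    and cont: "continuous_on ({0..T} \<times> {-\<delta><..<\<delta>}) (\<lambda>(\<tau>, \<xi>). ut \<tau> \<xi>)"
      "continuous_on ({0..T} \<times> {-\<delta><..<\<delta>}) (\<lambda>(\<tau>, \<xi>). ux \<tau> \<xi>)"
    and ux0: "\<And>\<tau>. \<tau> \<in> {0..T} \<Longrightarrow> ux \<tau> 0 = c 1 \<tau>"
    and pq: "unif_O 6 {0..T} p" "unif_O 6 {0..T} q"
    and inv: "\<And>\<tau> \<xi>. \<tau> \<in> {0..T} \<Longrightarrow> \<bar>\<xi>\<bar> < \<delta> \<Longrightarrow>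
      (1 + \<alpha>1 * \<xi>^2 + \<alpha>2 * \<xi>^4 + p \<tau> \<xi>) *\<^sub>R ut \<tau> \<xi> + (e * \<xi>^5 + q \<tau> \<xi>) *\<^sub>R ux \<tau> \<xi> = F (u \<tau> \<xi>)"
    and s: "s \<in> {0..T}" and k: "k \<le> 5"
  defines "f \<equiv> \<lambda>k \<tau>. comp_coeff F (\<lambda>i. c i \<tau>) k (c 0 \<tau>)"
  shows "((\<lambda>s. c k s + (if 2 \<le> k then \<alpha>1 *\<^sub>R c (k - 2) s else 0) + (if 4 \<le> k then \<alpha>2 *\<^sub>R c (k - 4) s else 0))
    has_vector_derivative f k s - (if k = 5 then e *\<^sub>R c 1 s else 0)) (at s within {0..T})"
    (is "(?l has_vector_derivative _) _")
proof -
  define g where "g \<tau> = f k \<tau> - (if k = 5 then e *\<^sub>R c 1 \<tau> else 0)" for \<tau>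
  have "continuous_on {0..T} (\<lambda>\<tau>. if k = 5 then e *\<^sub>R c 1 \<tau> else 0)"
    by (cases "k = 5") (auto intro!: continuous_intros c)
  then have "continuous_on {0..T} g"
    unfolding g_def f_def by (intro continuous_intros comp_coeff_continuous_on[OF F c c])
  then have "((\<lambda>s. ?l 0 + integral {0..s} g) has_vector_derivative 0 + g s) (at s within {0..T})"
    by (intro has_vector_derivative_add has_vector_derivative_const integral_has_vector_derivative s)
  note der = this
  have eq: "?l s = ?l 0 + integral {0..s} g" if "s \<in> {0..T}" for s
    using integrated_coefficient_equations[OF F \<delta> c u ut cont ux0 pq inv that k]
    unfolding g_def f_def by (auto simp: scaleR_diff_right algebra_simps)
  have "(?l has_vector_derivative 0 + g s) (at s within {0..T})"
    by (rule has_vector_derivative_transform[OF s eq der])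
  then show ?thesis
    by (simp only: g_def add_0_left)
qed

text \<open>Applied to \<open>H\<close>, whose expansion starts at \<xi>^2: its \<xi>-derivative
  vanishes at \<xi> = 0, so that of \<open>u\<close> equals \<open>v\<close>.\<close>

lemma quadratic_imp_has_vector_derivative_0:
  fixes g :: "real \<Rightarrow> 'a::real_normed_vector"
  assumes "unif_O 2 {\<tau>} (\<lambda>_. g)"
  shows "(g has_vector_derivative 0) (at 0)"
proof -
  obtain K where K: "\<forall>\<^sub>F \<xi> in nhds 0. norm (g \<xi>) \<le> K * \<bar>\<xi>\<bar> ^ 2"
    using assms unfolding unif_O_def by auto
  then obtain \<epsilon> where \<epsilon>: "\<epsilon> > 0" "\<And>\<xi>. dist \<xi> 0 < \<epsilon> \<Longrightarrow> norm (g \<xi>) \<le> K * \<bar>\<xi>\<bar> ^ 2"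
    unfolding eventually_nhds_metric by blast
  have g0: "g 0 = 0"
    using \<epsilon>(2)[of 0] \<epsilon>(1) by simp
  have "(g has_derivative (\<lambda>h. 0)) (at 0)"
  proof (rule has_derivativeI_sandwich[OF \<epsilon>(1)])
    show "norm (g \<xi> - g 0 - 0) / norm (\<xi> - 0) \<le> K * \<bar>\<xi>\<bar>" if "\<xi> \<noteq> 0" "dist \<xi> 0 < \<epsilon>" for \<xi>
      using \<epsilon>(2)[OF that(2)] that(1) g0 by (simp add: divide_le_eq power2_eq_square mult.assoc)
    have "((\<lambda>\<xi>. K * \<bar>\<xi>\<bar>) \<longlongrightarrow> K * \<bar>0\<bar>) (at 0)"
      by (intro tendsto_intros)
    then show "((\<lambda>\<xi>. K * \<bar>\<xi>\<bar>) \<longlongrightarrow> 0) (at 0)"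
      by simp
  qed simp
  then show ?thesis
    by (simp add: has_vector_derivative_def)
qed

lemma Ck_on_Suc_imp_C1:
  assumes "Ck_on (Suc k) S f"
  shows "x \<in> S \<Longrightarrow> (f has_derivative frechet_derivative f (at x)) (at x)"
    and "continuous_on S (\<lambda>x. frechet_derivative f (at x) w)"
  using assms Ck_on_imp_continuous_on[of k S] by (auto simp: frechet_derivative_works)

lemma O_xi6_iff: "O_xi6 g \<longleftrightarrow> unif_O 6 UNIV g"
  by (simp add: O_xi6_def unif_O_def)

lemma unif_O_expansion_unique:
  fixes c d :: "nat \<Rightarrow> 'a::real_normed_vector"
  assumes "unif_O (Suc n) {\<tau>} (\<lambda>_ \<xi>. g \<xi> - (\<Sum>k<Suc n. \<xi> ^ k *\<^sub>R c k))"
    and "unif_O (Suc n) {\<tau>} (\<lambda>_ \<xi>. g \<xi> - (\<Sum>k<Suc n. \<xi> ^ k *\<^sub>R d k))" and "k \<le> n"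
  shows "c k = d k"
proof -
  have "unif_O (Suc n) {\<tau>} (\<lambda>_ \<xi>. \<Sum>k<Suc n. \<xi> ^ k *\<^sub>R (c k - d k))"
    using unif_O_diff[OF assms(2,1)] by (simp add: scaleR_diff_right sum_subtractf algebra_simps)
  from unif_O_imp_tendsto_0[OF this, of \<tau>]
  have "((\<lambda>\<xi>. inverse (\<xi> ^ n) *\<^sub>R (\<Sum>k<Suc n. \<xi> ^ k *\<^sub>R (c k - d k))) \<longlongrightarrow> 0) (at_right 0)"
    by simp
  from polynomial_coeffs_zero[OF this assms(3)] show ?thesis
    by simp
qed

section \<open>The generalized period-doubling normal form\<close>

text \<open>Naming the remainders \<open>p\<close> and \<open>q\<close> turns the planar system into
  a definite vector field, and their C^1 regularity makes it locally Lipschitz, so that solutions to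
  which \<open>normal_form\<close> applies start at every point of the strip.\<close>

theorem mainTheorem2:
  fixes F :: "real^'n \<Rightarrow> real^'n"
    and u0 v \<phi>s vs h2 h3 h4 h5 :: "real \<Rightarrow> real^'n"
    and A Y :: "real \<Rightarrow> real^'n^'n"
    and B :: "real \<Rightarrow> real^'n \<Rightarrow> real^'n \<Rightarrow> real^'n"
    and C :: "real \<Rightarrow> real^'n \<Rightarrow> real^'n \<Rightarrow> real^'n \<Rightarrow> real^'n"
    and D :: "real \<Rightarrow> real^'n \<Rightarrow> real^'n \<Rightarrow> real^'n \<Rightarrow> real^'n \<Rightarrow> real^'n"
    and E :: "real \<Rightarrow> real^'n \<Rightarrow> real^'n \<Rightarrow> real^'n \<Rightarrow> real^'n \<Rightarrow> real^'n \<Rightarrow> real^'n"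
    and H u :: "real \<Rightarrow> real \<Rightarrow> real^'n"
    and p q :: "real \<Rightarrow> real \<Rightarrow> real"
    and T \<delta> \<alpha>1 \<alpha>2 e :: real
  assumes F_smooth: "Ck_on 6 UNIV F"
    \<comment> \<open>the limit cycle\<close>
    and u0_sol: "\<And>t. (u0 has_vector_derivative F (u0 t)) (at t)"
    and u0_nonconst: "\<not> (\<exists>c. \<forall>t. u0 t = c)"
    and u0_period: "minimal_period u0 T"
    \<comment> \<open>derivatives of F along the cycle\<close>
    and A: "\<And>\<tau>. A \<tau> = jacobian F (at (u0 \<tau>))"
    and B: "\<And>\<tau> a b. B \<tau> a b = deriv_form F [a, b] (u0 \<tau>)"
    and C: "\<And>\<tau> a b c. C \<tau> a b c = deriv_form F [a, b, c] (u0 \<tau>)"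
    and D: "\<And>\<tau> a b c d. D \<tau> a b c d = deriv_form F [a, b, c, d] (u0 \<tau>)"
    and E: "\<And>\<tau> a b c d f. E \<tau> a b c d f = deriv_form F [a, b, c, d, f] (u0 \<tau>)"
    \<comment> \<open>critical multipliers\<close>
    and Y_ode: "\<And>\<tau>. (Y has_vector_derivative A \<tau> ** Y \<tau>) (at \<tau>)"
    and Y_init: "Y 0 = mat 1"
    and mult_1: "simple_eigenvalue_of (Y T) 1"
    and mult_m1: "simple_eigenvalue_of (Y T) (-1)"
    and mult_crit: "\<And>z. eigenvalue_of (Y T) z \<Longrightarrow> cmod z = 1 \<Longrightarrow> z = 1 \<or> z = -1"
    \<comment> \<open>eigenfunction and adjoint eigenfunctions\<close>
    and v_ode: "\<And>\<tau>. \<tau> \<in> {0..T} \<Longrightarrow> (v has_vector_derivative A \<tau> *v v \<tau>) (at \<tau> within {0..T})"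
    and v_bc: "v T = - v 0"
    and v_norm: "integral {0..T} (\<lambda>\<tau>. v \<tau> \<bullet> v \<tau>) = 1"
    and v_ext: "\<And>\<tau>. v (\<tau> + T) = - v \<tau>"
    and \<phi>s_ode: "\<And>\<tau>. \<tau> \<in> {0..T} \<Longrightarrow>
           (\<phi>s has_vector_derivative - (transpose (A \<tau>) *v \<phi>s \<tau>)) (at \<tau> within {0..T})"
    and \<phi>s_bc: "\<phi>s T = \<phi>s 0"
    and \<phi>s_norm: "integral {0..T} (\<lambda>\<tau>. \<phi>s \<tau> \<bullet> F (u0 \<tau>)) = 1"
    and vs_ode: "\<And>\<tau>. \<tau> \<in> {0..T} \<Longrightarrow>
           (vs has_vector_derivative - (transpose (A \<tau>) *v vs \<tau>)) (at \<tau> within {0..T})"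
    and vs_bc: "vs T = - vs 0"
    and vs_norm: "integral {0..T} (\<lambda>\<tau>. vs \<tau> \<bullet> v \<tau>) = 1"
    \<comment> \<open>parametrization of the critical center manifold\<close>
    and \<delta>_pos: "\<delta> > 0"
    and u: "\<And>\<tau> \<xi>. u \<tau> \<xi> = u0 \<tau> + \<xi> *\<^sub>R v \<tau> + H \<tau> \<xi>"
    and H_smooth: "Ck_on 6 (UNIV \<times> {-\<delta><..<\<delta>}) (\<lambda>(\<tau>, \<xi>). H \<tau> \<xi>)"
    and H_periodic: "\<And>\<tau> \<xi>. \<bar>\<xi>\<bar> < \<delta> \<Longrightarrow> H (\<tau> + 2 * T) \<xi> = H \<tau> \<xi>"
    and H_expansion: "O_xi6 (\<lambda>\<tau> \<xi>. H \<tau> \<xi> - ((\<xi>^2 / 2) *\<^sub>R h2 \<tau> + (\<xi>^3 / 6) *\<^sub>R h3 \<tau>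
                                  + (\<xi>^4 / 24) *\<^sub>R h4 \<tau> + (\<xi>^5 / 120) *\<^sub>R h5 \<tau>))"
    and u_symmetric: "\<And>\<tau> \<xi>. \<bar>\<xi>\<bar> < \<delta> \<Longrightarrow> u \<tau> \<xi> = u (\<tau> + T) (- \<xi>)"
    and h2_fix: "integral {0..T} (\<lambda>\<tau>. \<phi>s \<tau> \<bullet> h2 \<tau>) = 0"
    and h3_fix: "integral {0..T} (\<lambda>\<tau>. vs \<tau> \<bullet> h3 \<tau>) = 0"
    and h4_fix: "integral {0..T} (\<lambda>\<tau>. \<phi>s \<tau> \<bullet> h4 \<tau>) = 0"
    \<comment> \<open>periodic normal form on the manifold, with remainders p and q\<close>
    and p_smooth: "Ck_on 1 (UNIV \<times> {-\<delta><..<\<delta>}) (\<lambda>(\<tau>, \<xi>). p \<tau> \<xi>)"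
    and q_smooth: "Ck_on 1 (UNIV \<times> {-\<delta><..<\<delta>}) (\<lambda>(\<tau>, \<xi>). q \<tau> \<xi>)"
    and p_periodic: "\<And>\<tau> \<xi>. \<bar>\<xi>\<bar> < \<delta> \<Longrightarrow> p (\<tau> + 2 * T) \<xi> = p \<tau> \<xi>"
    and q_periodic: "\<And>\<tau> \<xi>. \<bar>\<xi>\<bar> < \<delta> \<Longrightarrow> q (\<tau> + 2 * T) \<xi> = q \<tau> \<xi>"
    and p_O: "O_xi6 p"
    and q_O: "O_xi6 q"
    and normal_form: "\<And>a b \<theta> x. (\<And>t. t \<in> {a<..<b} \<Longrightarrow>
             \<bar>x t\<bar> < \<delta> \<and>
             (\<theta> has_real_derivative 1 + \<alpha>1 * (x t)^2 + \<alpha>2 * (x t)^4 + p (\<theta> t) (x t)) (at t) \<and>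
             (x has_real_derivative e * (x t)^5 + q (\<theta> t) (x t)) (at t)) \<Longrightarrow>
           (\<And>t. t \<in> {a<..<b} \<Longrightarrow>
             ((\<lambda>s. u (\<theta> s) (x s)) has_vector_derivative F (u (\<theta> t) (x t))) (at t))"
  shows "\<alpha>1 = 1/2 * integral {0..T} (\<lambda>\<tau>. \<phi>s \<tau> \<bullet> B \<tau> (v \<tau>) (v \<tau>))
    \<and> unique_bvp_solution T A
        (\<lambda>\<tau>. - B \<tau> (v \<tau>) (v \<tau>) + (2 * \<alpha>1) *\<^sub>R F (u0 \<tau>)) 1 \<phi>s h2
    \<and> unique_bvp_solution T A
        (\<lambda>\<tau>. - C \<tau> (v \<tau>) (v \<tau>) (v \<tau>) - 3 *\<^sub>R B \<tau> (v \<tau>) (h2 \<tau>)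
              + (6 * \<alpha>1) *\<^sub>R (A \<tau> *v v \<tau>)) (-1) vs h3
    \<and> \<alpha>2 = 1/24 * integral {0..T} (\<lambda>\<tau>. \<phi>s \<tau> \<bullet>
              (D \<tau> (v \<tau>) (v \<tau>) (v \<tau>) (v \<tau>) + 6 *\<^sub>R C \<tau> (v \<tau>) (v \<tau>) (h2 \<tau>)
               + 3 *\<^sub>R B \<tau> (h2 \<tau>) (h2 \<tau>) + 4 *\<^sub>R B \<tau> (v \<tau>) (h3 \<tau>)
               - (12 * \<alpha>1) *\<^sub>R (A \<tau> *v h2 \<tau> + B \<tau> (v \<tau>) (v \<tau>)))) + \<alpha>1^2
    \<and> unique_bvp_solution T A
        (\<lambda>\<tau>. - D \<tau> (v \<tau>) (v \<tau>) (v \<tau>) (v \<tau>) - 6 *\<^sub>R C \<tau> (v \<tau>) (v \<tau>) (h2 \<tau>)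
              - 3 *\<^sub>R B \<tau> (h2 \<tau>) (h2 \<tau>) - 4 *\<^sub>R B \<tau> (v \<tau>) (h3 \<tau>)
              + (12 * \<alpha>1) *\<^sub>R (A \<tau> *v h2 \<tau> + B \<tau> (v \<tau>) (v \<tau>) - (2 * \<alpha>1) *\<^sub>R F (u0 \<tau>))
              + (24 * \<alpha>2) *\<^sub>R F (u0 \<tau>)) 1 \<phi>s h4
    \<and> e = 1/120 * integral {0..T} (\<lambda>\<tau>. vs \<tau> \<bullet>
              (E \<tau> (v \<tau>) (v \<tau>) (v \<tau>) (v \<tau>) (v \<tau>) + 10 *\<^sub>R D \<tau> (v \<tau>) (v \<tau>) (v \<tau>) (h2 \<tau>)
               + 15 *\<^sub>R C \<tau> (v \<tau>) (h2 \<tau>) (h2 \<tau>) + 10 *\<^sub>R C \<tau> (v \<tau>) (v \<tau>) (h3 \<tau>)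
               + 10 *\<^sub>R B \<tau> (h2 \<tau>) (h3 \<tau>) + 5 *\<^sub>R B \<tau> (v \<tau>) (h4 \<tau>)
               - (120 * \<alpha>2) *\<^sub>R (A \<tau> *v v \<tau>) - (20 * \<alpha>1) *\<^sub>R (A \<tau> *v h3 \<tau>)))"
proof -
  let ?I = "{0..T}" and ?X = "{-\<delta><..<\<delta>}"
  define HH where "HH = (\<lambda>(\<tau>, \<xi>). H \<tau> \<xi>)"
  define DH where "DH z = frechet_derivative HH (at z)" for z
  \<comment> \<open>The default 0 for k >= 6 gives a sequence indexed by all naturals, continuous at
    every index, as the composition lemmas require.\<close>
  define h where "h k \<tau> = (if k < 6 then ([u0, v, h2, h3, h4, h5] ! k) \<tau> else 0)" for k \<tau>
  define c where "c k \<tau> = (1 / fact k) *\<^sub>R h k \<tau>" for k \<tau>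
  \<comment> \<open>The candidate for the \<tau>-derivative of \<open>u\<close>, with
    \<open>A \<tau> *v v \<tau>\<close> in place of the derivative of \<open>v\<close>: this is
    continuous up to the ends of the period.\<close>
  define ut where "ut \<tau> \<xi> = F (u0 \<tau>) + \<xi> *\<^sub>R (A \<tau> *v v \<tau>) + DH (\<tau>, \<xi>) (1, 0)" for \<tau> \<xi>
  define ux where "ux \<tau> \<xi> = v \<tau> + DH (\<tau>, \<xi>) (0, 1)" for \<tau> \<xi>
  define f where "f k \<tau> = comp_coeff F (\<lambda>i. c i \<tau>) k (c 0 \<tau>)" for k \<tau>

  have T: "T > 0"
    using u0_period by (simp add: minimal_period_def)
  have h_eqs: "h 1 = v" "h 2 = h2" "h 3 = h3" "h 4 = h4" "h 5 = h5"
    by (auto simp: h_def fun_eq_iff eval_nat_numeral)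
  have c_eqs: "c 0 = u0" "c 1 = v" "c 2 = (\<lambda>\<tau>. (1/2) *\<^sub>R h2 \<tau>)" "c 3 = (\<lambda>\<tau>. (1/6) *\<^sub>R h3 \<tau>)"
    "c 4 = (\<lambda>\<tau>. (1/24) *\<^sub>R h4 \<tau>)" "c 5 = (\<lambda>\<tau>. (1/120) *\<^sub>R h5 \<tau>)"
    by (auto simp: c_def h_def fun_eq_iff fact_numeral eval_nat_numeral)
  have u_poly: "u \<tau> \<xi> - (\<Sum>k<6. \<xi> ^ k *\<^sub>R c k \<tau>) = H \<tau> \<xi> - ((\<xi>^2 / 2) *\<^sub>R h2 \<tau> + (\<xi>^3 / 6) *\<^sub>R h3 \<tau>
      + (\<xi>^4 / 24) *\<^sub>R h4 \<tau> + (\<xi>^5 / 120) *\<^sub>R h5 \<tau>)" for \<tau> \<xi>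
  proof -
    have "(\<Sum>k<6. g k) = g 0 + g 1 + g 2 + g 3 + g 4 + g 5" for g :: "nat \<Rightarrow> real^'n"
      by (simp add: eval_nat_numeral)
    then show ?thesis
      by (simp only: c_eqs u) simp
  qed
  then have u_exp: "unif_O 6 UNIV (\<lambda>\<tau> \<xi>. u \<tau> \<xi> - (\<Sum>k<6. \<xi> ^ k *\<^sub>R c k \<tau>))"
    using H_expansion by (simp only: O_xi6_iff)

  \<comment> \<open>Regularity along the cycle and the partial derivatives of u\<close>
  have F_der: "(F has_derivative (\<lambda>w. deriv_form F [w] x)) (at x)" for x
    using deriv_form_has_derivative[OF F_smooth, of "[]"] by simp
  have A_eq: "A \<tau> *v w = deriv_form F [w] (u0 \<tau>)" for \<tau> w
  proof -
    have "(F has_derivative (*v) (A \<tau>)) (at (u0 \<tau>))"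
      unfolding A jacobian_works[symmetric] using F_der by (auto simp: differentiable_def)
    from fun_cong[OF has_derivative_unique[OF this F_der]] show ?thesis .
  qed
  have contF: "continuous_on UNIV F"
    by (rule Ck_on_imp_continuous_on[OF F_smooth])
  have cont_u0: "continuous_on R u0" for R
    using u0_sol has_vector_derivative_continuous
    by (intro continuous_at_imp_continuous_on) blast
  have cont_v: "continuous_on ?I v"
    using has_vector_derivative_continuous[OF v_ode] by (simp add: continuous_on_eq_continuous_within)
  have cont_Aw: "continuous_on R (\<lambda>\<tau>. A \<tau> *v w \<tau>)" if "continuous_on R w" for R w
    using deriv_form_continuous_slots[OF F_smooth, of "[w]" "[]" R u0] cont_u0 that by (simp add: A_eq)
  have cont_Fu0: "continuous_on R (\<lambda>\<tau>. F (u0 \<tau>))" for R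
    by (rule continuous_on_compose2[OF contF cont_u0]) simp

  have H_C1: "(HH has_derivative DH z) (at z)" if "z \<in> UNIV \<times> ?X" for z
    unfolding DH_def by (rule Ck_on_Suc_imp_C1(1)[of 5]) (use H_smooth that in \<open>simp_all add: HH_def\<close>)
  have contDH: "continuous_on (UNIV \<times> ?X) (\<lambda>z. DH z w)" for w
    unfolding DH_def by (rule Ck_on_Suc_imp_C1(2)[of 5]) (use H_smooth in \<open>simp add: HH_def\<close>)
  have DH_split: "DH z w = fst w *\<^sub>R DH z (1, 0) + snd w *\<^sub>R DH z (0, 1)" if "z \<in> UNIV \<times> ?X" for z w
  proof -
    have lin: "linear (DH z)"
      by (rule has_derivative_linear[OF H_C1[OF that]])
    have "w = fst w *\<^sub>R (1, 0) + snd w *\<^sub>R (0, 1)"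
      by (simp add: prod_eq_iff)
    then have "DH z w = DH z (fst w *\<^sub>R (1, 0) + snd w *\<^sub>R (0, 1))"
      by simp
    then show ?thesis
      by (simp only: linear_add[OF lin] linear_scale[OF lin])
  qed
  have H_tau: "((\<lambda>\<tau>. H \<tau> \<xi>) has_vector_derivative DH (\<tau>, \<xi>) (1, 0)) (at \<tau> within R)"
    and H_xi: "((\<lambda>\<xi>. H \<tau> \<xi>) has_vector_derivative DH (\<tau>, \<xi>) (0, 1)) (at \<xi>)"
    if "\<bar>\<xi>\<bar> < \<delta>" for \<tau> \<xi> R
  proof -
    have z: "(\<tau>, \<xi>) \<in> UNIV \<times> ?X"
      using that by auto
    have "((\<lambda>\<tau>. (\<tau>, \<xi>)) has_vector_derivative (1, 0)) (at \<tau> within R)"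
      by (intro has_vector_derivative_Pair has_vector_derivative_id has_vector_derivative_const)
    from vector_derivative_diff_chain_within[OF this has_derivative_at_withinI[OF H_C1[OF z]]]
    show "((\<lambda>\<tau>. H \<tau> \<xi>) has_vector_derivative DH (\<tau>, \<xi>) (1, 0)) (at \<tau> within R)"
      by (simp add: HH_def o_def)
    have "((\<lambda>\<xi>. (\<tau>, \<xi>)) has_vector_derivative (0, 1)) (at \<xi>)"
      by (intro has_vector_derivative_Pair has_vector_derivative_id has_vector_derivative_const)
    from vector_derivative_diff_chain_within[OF this has_derivative_at_withinI[OF H_C1[OF z]]]
    show "((\<lambda>\<xi>. H \<tau> \<xi>) has_vector_derivative DH (\<tau>, \<xi>) (0, 1)) (at \<xi>)"
      by (simp add: HH_def o_def)
  qed
  have u_tau: "((\<lambda>\<tau>. u \<tau> \<xi>) has_vector_derivative ut \<tau> \<xi>) (at \<tau> within ?I)"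
    if "\<tau> \<in> ?I" "\<bar>\<xi>\<bar> < \<delta>" for \<tau> \<xi>
    unfolding u ut_def
    by (intro has_vector_derivative_add H_tau[OF that(2)] has_vector_derivative_at_within[OF u0_sol]
        bounded_linear.has_vector_derivative[OF bounded_linear_scaleR_right] v_ode that)
  have on_strip: "continuous_on (?I \<times> ?X) (\<lambda>z. g (fst z))" if "continuous_on ?I g" for g :: "real \<Rightarrow> real^'n"
    by (rule continuous_on_compose2[OF that]) (auto intro!: continuous_intros)
  have contDH': "continuous_on (?I \<times> ?X) (\<lambda>z. DH z w)" for w
    using contDH by (rule continuous_on_subset) auto
  have cont_ut: "continuous_on (?I \<times> ?X) (\<lambda>(\<tau>, \<xi>). ut \<tau> \<xi>)"
    unfolding ut_def case_prod_unfold prod.collapse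
    by (intro continuous_intros on_strip[OF cont_Fu0] on_strip[OF cont_Aw[OF cont_v]] contDH')
  have cont_ux: "continuous_on (?I \<times> ?X) (\<lambda>(\<tau>, \<xi>). ux \<tau> \<xi>)"
    unfolding ux_def case_prod_unfold prod.collapse
    by (intro continuous_intros on_strip[OF cont_v] contDH')
  have ux0: "ux \<tau> 0 = c 1 \<tau>" for \<tau>
  proof -
    have "unif_O 6 {\<tau>} (\<lambda>\<tau> \<xi>. H \<tau> \<xi> - ((\<xi>^2 / 2) *\<^sub>R h2 \<tau> + (\<xi>^3 / 6) *\<^sub>R h3 \<tau>
        + (\<xi>^4 / 24) *\<^sub>R h4 \<tau> + (\<xi>^5 / 120) *\<^sub>R h5 \<tau>))"
      using H_expansion unfolding O_xi6_iff by (rule unif_O_subset) simp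
    then have "unif_O (Suc (Suc (Suc (Suc 2)))) {\<tau>} (\<lambda>\<tau> \<xi>. H \<tau> \<xi> - ((\<xi>^2 / 2) *\<^sub>R h2 \<tau> + (\<xi>^3 / 6) *\<^sub>R h3 \<tau>
        + (\<xi>^4 / 24) *\<^sub>R h4 \<tau> + (\<xi>^5 / 120) *\<^sub>R h5 \<tau>))"
      by simp
    then have "unif_O 2 {\<tau>} (\<lambda>\<tau> \<xi>. H \<tau> \<xi> - ((\<xi>^2 / 2) *\<^sub>R h2 \<tau> + (\<xi>^3 / 6) *\<^sub>R h3 \<tau>
        + (\<xi>^4 / 24) *\<^sub>R h4 \<tau> + (\<xi>^5 / 120) *\<^sub>R h5 \<tau>))"
      by (intro unif_O_Suc[of 2] unif_O_Suc[of "Suc 2"] unif_O_Suc[of "Suc (Suc 2)"]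
          unif_O_Suc[of "Suc (Suc (Suc 2))"])
    moreover have "unif_O 2 {\<tau>} (\<lambda>\<tau> \<xi>. \<xi>^2 *\<^sub>R (1/2) *\<^sub>R h2 \<tau> + \<xi>^3 *\<^sub>R (1/6) *\<^sub>R h3 \<tau>
        + \<xi>^4 *\<^sub>R (1/24) *\<^sub>R h4 \<tau> + \<xi>^5 *\<^sub>R (1/120) *\<^sub>R h5 \<tau>)"
      by (intro unif_O_add unif_O_power) auto
    ultimately have "unif_O 2 {\<tau>} H"
      using unif_O_add by force
    then have "unif_O 2 {\<tau>} (\<lambda>_. H \<tau>)"
      by (simp add: unif_O_def)
    from vector_derivative_unique_at[OF quadratic_imp_has_vector_derivative_0[OF this] H_xi[of 0 \<tau>]]
    show ?thesis
      using \<delta>_pos by (simp add: ux_def c_eqs del: One_nat_def)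
  qed

  \<comment> \<open>The invariance equation on the strip\<close>
  have inv: "(1 + \<alpha>1 * \<xi>^2 + \<alpha>2 * \<xi>^4 + p \<tau> \<xi>) *\<^sub>R ut \<tau> \<xi> + (e * \<xi>^5 + q \<tau> \<xi>) *\<^sub>R ux \<tau> \<xi> = F (u \<tau> \<xi>)"
    if \<tau>: "\<tau> \<in> ?I" and \<xi>: "\<bar>\<xi>\<bar> < \<delta>" for \<tau> \<xi>
  proof -
    \<comment> \<open>The derivative of \<open>v\<close> is prescribed only within [0,T], so it is
      two-sided on the open interval alone. The equation is obtained on the open rectangle and
      extended to \<tau> = 0 and \<tau> = T by continuity of the defect \<phi>.\<close>
    define S where "S = {0<..<T} \<times> ?X"
    define U where "U z = u (fst z) (snd z)" for z
    define DU where "DU z w = fst w *\<^sub>R F (u0 (fst z)) + (snd z *\<^sub>R (fst w *\<^sub>R (A (fst z) *v v (fst z)))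
      + snd w *\<^sub>R v (fst z)) + DH z w" for z w
    define pp where "pp = (\<lambda>(\<tau>, \<xi>). p \<tau> \<xi>)"
    define qq where "qq = (\<lambda>(\<tau>, \<xi>). q \<tau> \<xi>)"
    define V where "V z = (1 + \<alpha>1 * (snd z)^2 + \<alpha>2 * (snd z)^4 + pp z, e * (snd z)^5 + qq z)" for z
    define DV where "DV z w = ((2 * \<alpha>1 * snd z + 4 * \<alpha>2 * (snd z)^3) * snd w + frechet_derivative pp (at z) w,
      5 * e * (snd z)^4 * snd w + frechet_derivative qq (at z) w)" for z w
    have p1: "(pp has_derivative frechet_derivative pp (at z)) (at z)"
      and q1: "(qq has_derivative frechet_derivative qq (at z)) (at z)" if "z \<in> UNIV \<times> ?X" for z
      using that p_smooth q_smooth Ck_on_Suc_imp_C1(1)[of 0] unfolding pp_def qq_def One_nat_def by blast+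
    have p2: "continuous_on (UNIV \<times> ?X) (\<lambda>z. frechet_derivative pp (at z) w)"
      and q2: "continuous_on (UNIV \<times> ?X) (\<lambda>z. frechet_derivative qq (at z) w)" for w
      using p_smooth q_smooth Ck_on_Suc_imp_C1(2)[of 0] unfolding pp_def qq_def One_nat_def by blast+
    have SX: "S \<subseteq> UNIV \<times> ?X"
      by (auto simp: S_def)
    have U: "(U has_derivative DU z) (at z)" if z: "z \<in> S" for z
    proof -
      have \<tau>: "fst z \<in> {0<..<T}"
        using z by (auto simp: S_def)
      then have "(v has_vector_derivative A (fst z) *v v (fst z)) (at (fst z))"
        using v_ode[of "fst z"] at_within_Icc_at[of 0 "fst z" T] by simp
      note v1 = has_derivative_compose[OF has_derivative_fst[OF has_derivative_ident]
          this[unfolded has_vector_derivative_def]]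
      note u1 = has_derivative_compose[OF has_derivative_fst[OF has_derivative_ident]
          u0_sol[of "fst z", unfolded has_vector_derivative_def]]
      have "U = (\<lambda>z. u0 (fst z) + snd z *\<^sub>R v (fst z) + HH z)"
        by (simp add: fun_eq_iff U_def u HH_def case_prod_unfold)
      then show ?thesis
        unfolding DU_def
        by (simp only:) (intro has_derivative_add u1 has_derivative_scaleR v1 has_derivative_snd
            has_derivative_ident H_C1 subsetD[OF SX z])
    qed
    have on_S: "continuous_on S (\<lambda>z. g (fst z))" if "continuous_on ?I g" for g :: "real \<Rightarrow> real^'n"
      by (rule continuous_on_compose2[OF that]) (auto simp: S_def intro!: continuous_intros)
    have main: "DU z (V z) = F (U z)" if "z \<in> S" for z
    proof (rule invariance_equation[where S = S and f' = DV])
      show "open S"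
        unfolding S_def by (intro open_Times open_greaterThanLessThan)
      show "(V has_derivative DV z) (at z)" if "z \<in> S" for z
        unfolding V_def DV_def using that SX
        by (auto intro!: derivative_eq_intros p1 q1 simp: algebra_simps)
      show "continuous_on S (\<lambda>z. DV z w)" for w
        unfolding DV_def by (intro continuous_intros continuous_on_subset[OF p2 SX] continuous_on_subset[OF q2 SX])
      show "continuous_on S (\<lambda>z. DU z w)" for w
        unfolding DU_def
        by (intro continuous_intros on_S cont_Fu0 cont_Aw cont_v continuous_on_subset[OF contDH SX])
      have "continuous_on S U"
        using U by (intro continuous_at_imp_continuous_on) (blast intro: has_derivative_continuous)
      then show "continuous_on S (\<lambda>z. F (U z))"
        by (rule continuous_on_compose2[OF contF]) simp
      fix c :: "real \<Rightarrow> real \<times> real" and a b t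
      assume c: "\<And>t. t \<in> {a<..<b} \<Longrightarrow> c t \<in> S \<and> (c has_vector_derivative V (c t)) (at t)"
        and t: "t \<in> {a<..<b}"
      have "((\<lambda>s. u (fst (c s)) (snd (c s))) has_vector_derivative F (u (fst (c t)) (snd (c t)))) (at t)"
      proof (rule normal_form[OF _ t])
        fix t assume t: "t \<in> {a<..<b}"
        have "\<bar>snd (c t)\<bar> < \<delta>"
          using c[OF t] by (auto simp: S_def)
        moreover have "((\<lambda>t. fst (c t)) has_vector_derivative fst (V (c t))) (at t)"
          "((\<lambda>t. snd (c t)) has_vector_derivative snd (V (c t))) (at t)"
          using c[OF t] bounded_linear.has_vector_derivative[OF bounded_linear_fst]
            bounded_linear.has_vector_derivative[OF bounded_linear_snd] by blast+
        ultimately show "\<bar>snd (c t)\<bar> < \<delta> \<and>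
             ((\<lambda>t. fst (c t)) has_real_derivative
               1 + \<alpha>1 * (snd (c t))^2 + \<alpha>2 * (snd (c t))^4 + p (fst (c t)) (snd (c t))) (at t) \<and>
             ((\<lambda>t. snd (c t)) has_real_derivative e * (snd (c t))^5 + q (fst (c t)) (snd (c t))) (at t)"
          by (simp add: has_real_derivative_iff_has_vector_derivative V_def pp_def qq_def case_prod_unfold)
      qed
      then show "((\<lambda>s. U (c s)) has_vector_derivative F (U (c t))) (at t)"
        by (simp add: U_def)
    qed (use that U in auto)
    define \<phi> where "\<phi> \<tau> = (1 + \<alpha>1 * \<xi>^2 + \<alpha>2 * \<xi>^4 + p \<tau> \<xi>) *\<^sub>R ut \<tau> \<xi>
      + (e * \<xi>^5 + q \<tau> \<xi>) *\<^sub>R ux \<tau> \<xi> - F (u \<tau> \<xi>)" for \<tau>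
    have slice: "continuous_on ?I (\<lambda>\<tau>. (\<tau>, \<xi>))" "(\<lambda>\<tau>. (\<tau>, \<xi>)) ` ?I \<subseteq> ?I \<times> ?X"
      "(\<lambda>\<tau>. (\<tau>, \<xi>)) ` ?I \<subseteq> UNIV \<times> ?X"
      using \<xi> by (auto intro!: continuous_intros)
    have "continuous_on (UNIV \<times> ?X) pp" "continuous_on (UNIV \<times> ?X) qq"
      unfolding pp_def qq_def by (rule Ck_on_imp_continuous_on[OF p_smooth] Ck_on_imp_continuous_on[OF q_smooth])+
    from continuous_on_compose2[OF this(1) slice(1,3)] continuous_on_compose2[OF this(2) slice(1,3)]
    have pq': "continuous_on ?I (\<lambda>\<tau>. p \<tau> \<xi>)" "continuous_on ?I (\<lambda>\<tau>. q \<tau> \<xi>)"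
      by (simp_all add: pp_def qq_def)
    from continuous_on_compose2[OF cont_ut slice(1,2)] continuous_on_compose2[OF cont_ux slice(1,2)]
    have utx: "continuous_on ?I (\<lambda>\<tau>. ut \<tau> \<xi>)" "continuous_on ?I (\<lambda>\<tau>. ux \<tau> \<xi>)"
      by simp_all
    have "continuous_on ?I (\<lambda>\<tau>. u \<tau> \<xi>)"
      using has_vector_derivative_continuous[OF u_tau[OF _ \<xi>]]
      by (simp add: continuous_on_eq_continuous_within)
    then have "continuous_on ?I (\<lambda>\<tau>. F (u \<tau> \<xi>))"
      by (rule continuous_on_compose2[OF contF]) simp
    with pq' utx have "continuous_on ?I \<phi>"
      unfolding \<phi>_def by (intro continuous_intros)
    moreover have "\<phi> \<tau> = 0" if "\<tau> \<in> {0<..<T}" for \<tau>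
    proof -
      have z: "(\<tau>, \<xi>) \<in> S"
        using that \<xi> by (auto simp: S_def)
      have "DH (\<tau>, \<xi>) (V (\<tau>, \<xi>)) = fst (V (\<tau>, \<xi>)) *\<^sub>R DH (\<tau>, \<xi>) (1, 0) + snd (V (\<tau>, \<xi>)) *\<^sub>R DH (\<tau>, \<xi>) (0, 1)"
        by (rule DH_split[OF subsetD[OF SX z]])
      with main[OF z] have "fst (V (\<tau>, \<xi>)) *\<^sub>R ut \<tau> \<xi> + snd (V (\<tau>, \<xi>)) *\<^sub>R ux \<tau> \<xi> = F (u \<tau> \<xi>)"
        by (simp add: DU_def U_def ut_def ux_def scaleR_right_distrib add_ac mult.commute)
      then show ?thesis
        by (simp add: \<phi>_def V_def pp_def qq_def)
    qed
    ultimately have "\<phi> \<tau> = 0"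
      using continuous_constant_on_closure[of "{0<..<T}" \<phi> 0 \<tau>] \<tau> T
      by (simp add: closure_greaterThanLessThan)
    then show ?thesis
      by (simp add: \<phi>_def)
  qed

  \<comment> \<open>Continuity of the coefficients and the coefficient equations\<close>
  have c_cont: "continuous_on ?I (c k)" for k
  proof (cases "k < 6")
    case True
    have "\<forall>\<^sub>F \<xi> in nhds 0. continuous_on ?I (\<lambda>\<tau>. u \<tau> \<xi>)"
      using eventually_abs_less_nhds_0[OF \<delta>_pos]
    proof eventually_elim
      case (elim \<xi>)
      then show ?case
        using has_vector_derivative_continuous[OF u_tau] by (simp add: continuous_on_eq_continuous_within)
    qed
    from expansion_coeffs_continuous_on[OF this unif_O_subset[OF u_exp subset_UNIV] True] show ?thesis .
  next
    case False
    then show ?thesis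
      by (simp add: c_def[abs_def] h_def)
  qed
  have coeff: "((\<lambda>s. c k s + (if 2 \<le> k then \<alpha>1 *\<^sub>R c (k - 2) s else 0) + (if 4 \<le> k then \<alpha>2 *\<^sub>R c (k - 4) s else 0))
      has_vector_derivative f k \<tau> - (if k = 5 then e *\<^sub>R c 1 \<tau> else 0)) (at \<tau> within ?I)"
    if "\<tau> \<in> ?I" "k \<le> 5" for k \<tau>
    unfolding f_def
    using p_O q_O unfolding O_xi6_iff
    by (intro coefficient_equations[OF F_smooth \<delta>_pos c_cont unif_O_subset[OF u_exp subset_UNIV] u_tau
          cont_ut cont_ux ux0 _ _ inv that]) (auto intro: unif_O_subset)

  have f_eqs: "2 *\<^sub>R f 2 \<tau> = A \<tau> *v h2 \<tau> + B \<tau> (v \<tau>) (v \<tau>)"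
    "6 *\<^sub>R f 3 \<tau> = A \<tau> *v h3 \<tau> + 3 *\<^sub>R B \<tau> (v \<tau>) (h2 \<tau>) + C \<tau> (v \<tau>) (v \<tau>) (v \<tau>)"
    "24 *\<^sub>R f 4 \<tau> = A \<tau> *v h4 \<tau> + 4 *\<^sub>R B \<tau> (v \<tau>) (h3 \<tau>) + 3 *\<^sub>R B \<tau> (h2 \<tau>) (h2 \<tau>)
      + 6 *\<^sub>R C \<tau> (v \<tau>) (v \<tau>) (h2 \<tau>) + D \<tau> (v \<tau>) (v \<tau>) (v \<tau>) (v \<tau>)"
    "120 *\<^sub>R f 5 \<tau> = A \<tau> *v h5 \<tau> + 5 *\<^sub>R B \<tau> (v \<tau>) (h4 \<tau>) + 10 *\<^sub>R B \<tau> (h2 \<tau>) (h3 \<tau>)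
      + 10 *\<^sub>R C \<tau> (v \<tau>) (v \<tau>) (h3 \<tau>) + 15 *\<^sub>R C \<tau> (v \<tau>) (h2 \<tau>) (h2 \<tau>)
      + 10 *\<^sub>R D \<tau> (v \<tau>) (v \<tau>) (v \<tau>) (h2 \<tau>) + E \<tau> (v \<tau>) (v \<tau>) (v \<tau>) (v \<tau>) (v \<tau>)" for \<tau>
    using comp_coeff_eqs(3-6)[OF F_smooth, of "\<lambda>k. h k \<tau>" "u0 \<tau>"]
    unfolding f_def A_eq B C D E c_eqs(1) by (simp_all only: c_def h_eqs)

  \<comment> \<open>Linear equations for h2 to h5\<close>
  define r2 where "r2 \<tau> = - B \<tau> (v \<tau>) (v \<tau>) + (2 * \<alpha>1) *\<^sub>R F (u0 \<tau>)" for \<tau>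
  define r3 where "r3 \<tau> = - C \<tau> (v \<tau>) (v \<tau>) (v \<tau>) - 3 *\<^sub>R B \<tau> (v \<tau>) (h2 \<tau>)
    + (6 * \<alpha>1) *\<^sub>R (A \<tau> *v v \<tau>)" for \<tau>
  define r4 where "r4 \<tau> = - D \<tau> (v \<tau>) (v \<tau>) (v \<tau>) (v \<tau>) - 6 *\<^sub>R C \<tau> (v \<tau>) (v \<tau>) (h2 \<tau>)
    - 3 *\<^sub>R B \<tau> (h2 \<tau>) (h2 \<tau>) - 4 *\<^sub>R B \<tau> (v \<tau>) (h3 \<tau>)
    + (12 * \<alpha>1) *\<^sub>R (A \<tau> *v h2 \<tau> + B \<tau> (v \<tau>) (v \<tau>) - (2 * \<alpha>1) *\<^sub>R F (u0 \<tau>))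
    + (24 * \<alpha>2) *\<^sub>R F (u0 \<tau>)" for \<tau>
  define Z where "Z \<tau> = E \<tau> (v \<tau>) (v \<tau>) (v \<tau>) (v \<tau>) (v \<tau>) + 10 *\<^sub>R D \<tau> (v \<tau>) (v \<tau>) (v \<tau>) (h2 \<tau>)
    + 15 *\<^sub>R C \<tau> (v \<tau>) (h2 \<tau>) (h2 \<tau>) + 10 *\<^sub>R C \<tau> (v \<tau>) (v \<tau>) (h3 \<tau>)
    + 10 *\<^sub>R B \<tau> (h2 \<tau>) (h3 \<tau>) + 5 *\<^sub>R B \<tau> (v \<tau>) (h4 \<tau>)
    - (120 * \<alpha>2) *\<^sub>R (A \<tau> *v v \<tau>) - (20 * \<alpha>1) *\<^sub>R (A \<tau> *v h3 \<tau>)" for \<tau>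
  \<comment> \<open>\<open>Z\<close> is the integrand of the formula for \<open>e\<close>. The term
    with \<open>r3\<close> is left over when the derivative of \<open>h3\<close> is replaced by
    \<open>A \<tau> *v h3 \<tau> - r3 \<tau>\<close>, and 120 e v comes from the quintic term of the
    normal form.\<close>
  define r5 where "r5 \<tau> = - Z \<tau> - (20 * \<alpha>1) *\<^sub>R r3 \<tau> + (120 * e) *\<^sub>R v \<tau>" for \<tau>

  note u0' = has_vector_derivative_at_within[OF u0_sol, of _ ?I]
  note scale' = bounded_linear.has_vector_derivative[OF bounded_linear_scaleR_right]
  \<comment> \<open>Only the combination with \<open>c 0\<close> is known to be differentiable;
    subtracting the known \<open>u0\<close> isolates \<open>h2\<close>. The higher cases repeat
    this, with weights k! divided by the factorial of the lower index: 12 = 24/2 for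
    \<open>h2\<close> in \<open>h4\<close>, and 20 = 120/6 for \<open>h3\<close> in
    \<open>h5\<close>.\<close>
  have h2_der: "(h2 has_vector_derivative A \<tau> *v h2 \<tau> - r2 \<tau>) (at \<tau> within ?I)" if "\<tau> \<in> ?I" for \<tau>
  proof -
    have "((\<lambda>s. 2 *\<^sub>R (c 2 s + \<alpha>1 *\<^sub>R c 0 s) - (2 * \<alpha>1) *\<^sub>R u0 s) has_vector_derivative
        2 *\<^sub>R f 2 \<tau> - (2 * \<alpha>1) *\<^sub>R F (u0 \<tau>)) (at \<tau> within ?I)"
      using coeff[OF that, of 2] by (intro has_vector_derivative_diff scale' u0') simp
    moreover have "(\<lambda>s. 2 *\<^sub>R (c 2 s + \<alpha>1 *\<^sub>R c 0 s) - (2 * \<alpha>1) *\<^sub>R u0 s) = h2"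
      by (simp add: c_eqs fun_eq_iff scaleR_right_distrib)
    moreover have "2 *\<^sub>R f 2 \<tau> - (2 * \<alpha>1) *\<^sub>R F (u0 \<tau>) = A \<tau> *v h2 \<tau> - r2 \<tau>"
      by (simp add: f_eqs r2_def)
    ultimately show ?thesis
      by simp
  qed
  have h3_der: "(h3 has_vector_derivative A \<tau> *v h3 \<tau> - r3 \<tau>) (at \<tau> within ?I)" if "\<tau> \<in> ?I" for \<tau>
  proof -
    have "((\<lambda>s. 6 *\<^sub>R (c 3 s + \<alpha>1 *\<^sub>R c 1 s) - (6 * \<alpha>1) *\<^sub>R v s) has_vector_derivative
        6 *\<^sub>R f 3 \<tau> - (6 * \<alpha>1) *\<^sub>R (A \<tau> *v v \<tau>)) (at \<tau> within ?I)"
      using coeff[OF that, of 3] by (intro has_vector_derivative_diff scale' v_ode that) simp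
    moreover have "(\<lambda>s. 6 *\<^sub>R (c 3 s + \<alpha>1 *\<^sub>R c 1 s) - (6 * \<alpha>1) *\<^sub>R v s) = h3"
      by (simp add: c_eqs fun_eq_iff scaleR_right_distrib del: One_nat_def)
    moreover have "6 *\<^sub>R f 3 \<tau> - (6 * \<alpha>1) *\<^sub>R (A \<tau> *v v \<tau>) = A \<tau> *v h3 \<tau> - r3 \<tau>"
      by (simp add: f_eqs r3_def)
    ultimately show ?thesis
      by simp
  qed
  have h4_der: "(h4 has_vector_derivative A \<tau> *v h4 \<tau> - r4 \<tau>) (at \<tau> within ?I)" if "\<tau> \<in> ?I" for \<tau>
  proof -
    have "((\<lambda>s. 24 *\<^sub>R (c 4 s + \<alpha>1 *\<^sub>R c 2 s + \<alpha>2 *\<^sub>R c 0 s) - (12 * \<alpha>1) *\<^sub>R h2 s - (24 * \<alpha>2) *\<^sub>R u0 s)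
        has_vector_derivative
        24 *\<^sub>R f 4 \<tau> - (12 * \<alpha>1) *\<^sub>R (A \<tau> *v h2 \<tau> - r2 \<tau>) - (24 * \<alpha>2) *\<^sub>R F (u0 \<tau>)) (at \<tau> within ?I)"
      using coeff[OF that, of 4] by (intro has_vector_derivative_diff scale' u0' h2_der that) simp
    moreover have "(\<lambda>s. 24 *\<^sub>R (c 4 s + \<alpha>1 *\<^sub>R c 2 s + \<alpha>2 *\<^sub>R c 0 s) - (12 * \<alpha>1) *\<^sub>R h2 s - (24 * \<alpha>2) *\<^sub>R u0 s) = h4"
      by (simp add: c_eqs fun_eq_iff scaleR_right_distrib)
    \<comment> \<open>The \<alpha>1 squared term of \<open>r4\<close> originates here: the
      derivative of \<open>h2\<close> carries -2 \<alpha>1 F(u0) through \<open>r2\<close>,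
      multiplied by the weight -12 \<alpha>1.\<close>
    moreover have "24 *\<^sub>R f 4 \<tau> - (12 * \<alpha>1) *\<^sub>R (A \<tau> *v h2 \<tau> - r2 \<tau>) - (24 * \<alpha>2) *\<^sub>R F (u0 \<tau>)
        = A \<tau> *v h4 \<tau> - r4 \<tau>"
      by (simp add: f_eqs r2_def r4_def algebra_simps)
    ultimately show ?thesis
      by simp
  qed
  have h5_der: "(h5 has_vector_derivative A \<tau> *v h5 \<tau> - r5 \<tau>) (at \<tau> within ?I)" if "\<tau> \<in> ?I" for \<tau>
  proof -
    have "((\<lambda>s. 120 *\<^sub>R (c 5 s + \<alpha>1 *\<^sub>R c 3 s + \<alpha>2 *\<^sub>R c 1 s) - (20 * \<alpha>1) *\<^sub>R h3 s - (120 * \<alpha>2) *\<^sub>R v s)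
        has_vector_derivative
        120 *\<^sub>R (f 5 \<tau> - e *\<^sub>R c 1 \<tau>) - (20 * \<alpha>1) *\<^sub>R (A \<tau> *v h3 \<tau> - r3 \<tau>) - (120 * \<alpha>2) *\<^sub>R (A \<tau> *v v \<tau>))
        (at \<tau> within ?I)"
      using coeff[OF that, of 5] by (intro has_vector_derivative_diff scale' v_ode h3_der that) simp
    moreover have "(\<lambda>s. 120 *\<^sub>R (c 5 s + \<alpha>1 *\<^sub>R c 3 s + \<alpha>2 *\<^sub>R c 1 s) - (20 * \<alpha>1) *\<^sub>R h3 s - (120 * \<alpha>2) *\<^sub>R v s) = h5"
      by (simp add: c_eqs fun_eq_iff scaleR_right_distrib del: One_nat_def)
    moreover have "120 *\<^sub>R (f 5 \<tau> - e *\<^sub>R c 1 \<tau>) - (20 * \<alpha>1) *\<^sub>R (A \<tau> *v h3 \<tau> - r3 \<tau>) - (120 * \<alpha>2) *\<^sub>R (A \<tau> *v v \<tau>)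
        = A \<tau> *v h5 \<tau> - r5 \<tau>"
      unfolding scaleR_diff_right[of 120] f_eqs c_eqs
      by (simp add: r5_def Z_def algebra_simps)
    ultimately show ?thesis
      by simp
  qed

  \<comment> \<open>Parity of the coefficients and uniqueness\<close>
  \<comment> \<open>Since u(0,\<xi>) = u(T,-\<xi>), reflecting the expansion at T gives a second
    expansion at 0; coefficients of expansions are unique.\<close>
  have c_bc: "c k 0 = (-1) ^ k *\<^sub>R c k T" if "k \<le> 5" for k
  proof (rule unif_O_expansion_unique[OF _ _ that])
    have six: "Suc 5 = (6::nat)"
      by simp
    show "unif_O (Suc 5) {0} (\<lambda>_ \<xi>. u 0 \<xi> - (\<Sum>k<Suc 5. \<xi> ^ k *\<^sub>R c k 0))"
      using unif_O_at[OF u_exp] unfolding six by simp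
    have "unif_O 6 UNIV (\<lambda>\<tau> \<xi>. u \<tau> ((-1) * \<xi>) - (\<Sum>k<6. ((-1) * \<xi>) ^ k *\<^sub>R c k \<tau>))"
      by (rule unif_O_dilate[OF u_exp])
    then have "unif_O 6 {0} (\<lambda>_ \<xi>. u T (- \<xi>) - (\<Sum>k<6. ((-1) * \<xi>) ^ k *\<^sub>R c k T))"
      using unif_O_at by fastforce
    then have "unif_O 6 {0} (\<lambda>_ \<xi>. u 0 \<xi> - (\<Sum>k<6. ((-1) * \<xi>) ^ k *\<^sub>R c k T))"
      by (rule unif_O_cong) (use u_symmetric[of _ 0] in \<open>auto intro!: eventually_mono[OF eventually_abs_less_nhds_0[OF \<delta>_pos]]\<close>)
    then show "unif_O (Suc 5) {0} (\<lambda>_ \<xi>. u 0 \<xi> - (\<Sum>k<Suc 5. \<xi> ^ k *\<^sub>R (-1) ^ k *\<^sub>R c k T))"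
      unfolding six power_mult_distrib scaleR_scaleR by (simp only: mult.commute)
  qed
  have h_bc: "h k 0 = (-1) ^ k *\<^sub>R h k T" if "k \<le> 5" for k
  proof -
    have h: "h k \<tau> = fact k *\<^sub>R c k \<tau>" for \<tau>
      by (simp add: c_def)
    show ?thesis
      unfolding h c_bc[OF that] by (rule scaleR_left_commute)
  qed
  have bc: "h2 T = 1 *\<^sub>R h2 0" "h3 T = (-1) *\<^sub>R h3 0" "h4 T = 1 *\<^sub>R h4 0" "h5 T = (-1) *\<^sub>R h5 0"
    using h_bc[of 2] h_bc[of 3] h_bc[of 4] h_bc[of 5] by (simp_all add: h_eqs)

  have cont_ode: "continuous_on ?I w" if "\<And>\<tau>. \<tau> \<in> ?I \<Longrightarrow> (w has_vector_derivative w' \<tau>) (at \<tau> within ?I)"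
    for w w' :: "real \<Rightarrow> real^'n"
    using has_vector_derivative_continuous[OF that] by (simp add: continuous_on_eq_continuous_within)
  have solves: "solves_bvp T A r \<sigma> \<psi> w"
    if "\<And>\<tau>. \<tau> \<in> ?I \<Longrightarrow> (w has_vector_derivative A \<tau> *v w \<tau> - r \<tau>) (at \<tau> within ?I)"
      "w T = \<sigma> *\<^sub>R w 0" "integral ?I (\<lambda>\<tau>. \<psi> \<tau> \<bullet> w \<tau>) = 0" for w r \<psi> :: "real \<Rightarrow> real^'n" and \<sigma>
    unfolding solves_bvp_def using that by fastforce
  obtain K where K: "\<And>\<tau> x. \<tau> \<in> ?I \<Longrightarrow> norm (A \<tau> *v x) \<le> K * norm x"
    using linear_family_bounded[of ?I "\<lambda>\<tau> x. A \<tau> *v x"]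
      compact_imp_bounded[OF compact_continuous_image[OF cont_Aw[OF continuous_on_const] compact_Icc]]
    by (metis matrix_vector_mul_linear)
  \<comment> \<open>Differentiating the equation of the cycle: its velocity solves the variational
    equation and is T-periodic, so it spans the eigenspace of the multiplier 1.\<close>
  have F_ode: "((\<lambda>\<tau>. F (u0 \<tau>)) has_vector_derivative A \<tau> *v F (u0 \<tau>)) (at \<tau> within ?I)" for \<tau>
    using vector_derivative_diff_chain_within[OF u0' has_derivative_at_withinI[OF F_der]]
    by (simp add: o_def A_eq)
  have F_bc: "F (u0 T) = 1 *\<^sub>R F (u0 0)"
    using u0_period by (auto simp: minimal_period_def dest: spec[of _ 0])
  have v_bc': "v T = (-1) *\<^sub>R v 0" and \<phi>s_bc': "\<phi>s T = 1 *\<^sub>R \<phi>s 0" and vs_bc': "vs T = (-1) *\<^sub>R vs 0"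
    using v_bc \<phi>s_bc vs_bc by simp_all
  have cont_\<phi>s: "continuous_on ?I \<phi>s" and cont_vs: "continuous_on ?I vs"
    by (rule cont_ode, erule \<phi>s_ode) (rule cont_ode, erule vs_ode)
  note unique_1 = bvp_solution_unique[OF T K Y_ode Y_init _ F_ode F_bc cont_\<phi>s \<phi>s_norm]
  note unique_m1 = bvp_solution_unique[OF T K Y_ode Y_init _ v_ode v_bc' cont_vs vs_norm]
  have uniq: "unique_bvp_solution T A r2 1 \<phi>s h2" "unique_bvp_solution T A r3 (-1) vs h3"
    "unique_bvp_solution T A r4 1 \<phi>s h4"
    using mult_1 mult_m1 by (intro unique_1 unique_m1 solves h2_der h3_der h4_der bc h2_fix h3_fix h4_fix; simp)+

  \<comment> \<open>Solvability conditions and the formulas for the coefficients\<close>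
  have T0: "0 \<le> T"
    using T by simp
  \<comment> \<open>In the boundary value problems the inhomogeneity stands on the left as
    \<open>r\<close>, hence the sign: the forcing of the linear equation is
    \<open>- r\<close>.\<close>
  have solv: "((\<lambda>\<tau>. \<psi> \<tau> \<bullet> - r \<tau>) has_integral 0) ?I"
    if "\<And>\<tau>. \<tau> \<in> ?I \<Longrightarrow> (\<psi> has_vector_derivative - (transpose (A \<tau>) *v \<psi> \<tau>)) (at \<tau> within ?I)"
      "\<psi> T = \<sigma> *\<^sub>R \<psi> 0" and w: "\<And>\<tau>. \<tau> \<in> ?I \<Longrightarrow> (w has_vector_derivative A \<tau> *v w \<tau> - r \<tau>) (at \<tau> within ?I)"
    and w_bc: "w T = \<sigma> *\<^sub>R w 0" "\<sigma> * \<sigma> = 1" for w r \<psi> :: "real \<Rightarrow> real^'n" and \<sigma>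
  proof (rule solvability_condition[OF T0 that(1,2) _ w_bc])
    show "(w has_vector_derivative A \<tau> *v w \<tau> + - r \<tau>) (at \<tau> within ?I)" if "\<tau> \<in> ?I" for \<tau>
      using w[OF that] by (simp only: diff_conv_add_uminus)
  qed
  have i2: "((\<lambda>\<tau>. \<phi>s \<tau> \<bullet> - r2 \<tau>) has_integral 0) ?I"
    by (rule solv[OF \<phi>s_ode \<phi>s_bc' h2_der bc(1)]) auto
  have i3: "((\<lambda>\<tau>. vs \<tau> \<bullet> - r3 \<tau>) has_integral 0) ?I"
    by (rule solv[OF vs_ode vs_bc' h3_der bc(2)]) auto
  have i4: "((\<lambda>\<tau>. \<phi>s \<tau> \<bullet> - r4 \<tau>) has_integral 0) ?I"
    by (rule solv[OF \<phi>s_ode \<phi>s_bc' h4_der bc(3)]) auto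
  have i5: "((\<lambda>\<tau>. vs \<tau> \<bullet> - r5 \<tau>) has_integral 0) ?I"
    by (rule solv[OF vs_ode vs_bc' h5_der bc(4)]) auto
  have iF: "((\<lambda>\<tau>. \<phi>s \<tau> \<bullet> F (u0 \<tau>)) has_integral 1) ?I"
    unfolding \<phi>s_norm[symmetric]
    by (intro integrable_integral integrable_continuous_real continuous_intros cont_\<phi>s cont_Fu0)
  have iv: "((\<lambda>\<tau>. vs \<tau> \<bullet> v \<tau>) has_integral 1) ?I"
    unfolding vs_norm[symmetric]
    by (intro integrable_integral integrable_continuous_real continuous_intros cont_vs cont_v)

  have "((\<lambda>\<tau>. \<phi>s \<tau> \<bullet> - r2 \<tau> + (2 * \<alpha>1) * (\<phi>s \<tau> \<bullet> F (u0 \<tau>))) has_integral 0 + (2 * \<alpha>1) * 1) ?I"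
    by (intro has_integral_add has_integral_mult_right i2 iF)
  then have "((\<lambda>\<tau>. \<phi>s \<tau> \<bullet> B \<tau> (v \<tau>) (v \<tau>)) has_integral 2 * \<alpha>1) ?I"
    by (simp add: r2_def inner_diff_right inner_add_right)
  then have \<alpha>1: "\<alpha>1 = 1/2 * integral ?I (\<lambda>\<tau>. \<phi>s \<tau> \<bullet> B \<tau> (v \<tau>) (v \<tau>))"
    by (simp add: integral_unique)
  \<comment> \<open>The factor 24 \<alpha>2 - 24 \<alpha>1^2 is the total coefficient of F(u0) in
    \<open>r4\<close>. The added multiple removes this term from the integrand and, by the
    normalisation of \<open>\<phi>s\<close>, reappears as the value of the integral.\<close>
  have "((\<lambda>\<tau>. \<phi>s \<tau> \<bullet> - r4 \<tau> + (24 * \<alpha>2 - 24 * \<alpha>1^2) * (\<phi>s \<tau> \<bullet> F (u0 \<tau>)))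
      has_integral 0 + (24 * \<alpha>2 - 24 * \<alpha>1^2) * 1) ?I"
    by (intro has_integral_add has_integral_mult_right i4 iF)
  moreover have "\<phi>s \<tau> \<bullet> - r4 \<tau> + (24 * \<alpha>2 - 24 * \<alpha>1^2) * (\<phi>s \<tau> \<bullet> F (u0 \<tau>)) = \<phi>s \<tau> \<bullet>
      (D \<tau> (v \<tau>) (v \<tau>) (v \<tau>) (v \<tau>) + 6 *\<^sub>R C \<tau> (v \<tau>) (v \<tau>) (h2 \<tau>)
       + 3 *\<^sub>R B \<tau> (h2 \<tau>) (h2 \<tau>) + 4 *\<^sub>R B \<tau> (v \<tau>) (h3 \<tau>)
       - (12 * \<alpha>1) *\<^sub>R (A \<tau> *v h2 \<tau> + B \<tau> (v \<tau>) (v \<tau>)))" for \<tau>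
    by (simp add: r4_def inner_diff_right inner_add_right algebra_simps power2_eq_square)
  ultimately have \<alpha>2: "\<alpha>2 = 1/24 * integral ?I (\<lambda>\<tau>. \<phi>s \<tau> \<bullet>
      (D \<tau> (v \<tau>) (v \<tau>) (v \<tau>) (v \<tau>) + 6 *\<^sub>R C \<tau> (v \<tau>) (v \<tau>) (h2 \<tau>)
       + 3 *\<^sub>R B \<tau> (h2 \<tau>) (h2 \<tau>) + 4 *\<^sub>R B \<tau> (v \<tau>) (h3 \<tau>)
       - (12 * \<alpha>1) *\<^sub>R (A \<tau> *v h2 \<tau> + B \<tau> (v \<tau>) (v \<tau>)))) + \<alpha>1^2"
    by (simp add: integral_unique diff_divide_distrib)
  \<comment> \<open>The weights undo the terms by which \<open>- r5\<close> differs from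
    \<open>Z\<close>. Abstract \<pi>5 and \<pi>3 stand for the pairings of \<open>vs\<close> with
    \<open>- r5\<close> and \<open>- r3\<close>, so that the integral rules do not open
    them.\<close>
  have "((\<lambda>\<tau>. \<pi>5 \<tau> + 120 * e * (vs \<tau> \<bullet> v \<tau>) + 20 * \<alpha>1 * \<pi>3 \<tau>) has_integral 0 + 120 * e * 1 + 20 * \<alpha>1 * 0) ?I"
    if "(\<pi>5 has_integral 0) ?I" "(\<pi>3 has_integral 0) ?I" for \<pi>5 \<pi>3 :: "real \<Rightarrow> real"
    by (intro has_integral_add has_integral_mult_right that iv)
  from this[OF i5 i3]
  have "((\<lambda>\<tau>. vs \<tau> \<bullet> Z \<tau>) has_integral 120 * e) ?I"
    by (simp add: r5_def inner_diff_right inner_add_right)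
  then have "e = 1/120 * integral ?I (\<lambda>\<tau>. vs \<tau> \<bullet> Z \<tau>)"
    by (simp add: integral_unique)
  then show ?thesis
    using \<alpha>1 \<alpha>2 uniq unfolding Z_def r2_def r3_def r4_def by blast
qed

end
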